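(* Let $X$ be a compact connected $3$-manifold and let $(L,h,K)$ be a CMC Einstein flow on $X$ with a crushing singularity as $t\to0$, parametrized by the Hubble time $t = -\frac{3}{H}\in(0,t_0]$. Let $R$ be the scalar curvature of $h(t)$. Then $$\frac{d}{dt}\left(t^{-1}\operatorname{vol}(X,h(t))\right) = -\frac13\int_X L R\, \operatorname{dvol}_{h}.$$ Hence $$\int_0^{t_0}\int_X (-t^2R)\, L\, \frac{\operatorname{dvol}_{h(t)}}{t}\,\frac{dt}{t} < \infty .$$
   Context: Einstein flow. An Einstein flow on an $n$-manifold $X$ (here $n=3$) over a time interval is a smooth family of positive functions $L(t)$ (lapse), Riemannian metrics $h(t)$ and symmetric covariant $2$-tensor fields $K(t)$ on $X$ such that, with $H = h^{ij}K_{ij}$, $K^0 = K-\frac{H}{n}h$, $R_{ij}$ and $R$ the Ricci tensor and scalar curvature of $h(t)$, one has the constraint equations $R - |K^0|^2 + (1-\frac1n)H^2 = 0$ and $\nabla_iK^i{}_j - \nabla_jH = 0$, and the evolution equations $\partial_t h_{ij} = -2LK_{ij}$ and $\partial_tK_{ij} = LHK_{ij} - 2Lh^{kl}K_{ik}K_{lj} - L_{;ij} + LR_{ij}$. Equivalently, the Lorentzian metric $g = -L^2dt^2+h(t)$ is Ricci-flat with $K(t)$ the second fundamental form of the time-$t$ slice. The flow is CMC if $H$ depends only on $t$. With a crushing singularity as $t\to0$, the mean curvature $H$ is negative, increasing in $t$, and $H\to-\infty$ as $t\to0$; one takes as time parameter the Hubble time $t = -\frac{n}{H}\in(0,t_0]$.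 Convention: since $R$ has no assumed sign, the final inequality "$<\infty$" means that the integrals over $t\in[t_1,t_0]$ are bounded above uniformly as $t_1\to0$. *)

theory Defs
  imports "HOL-Analysis.Analysis"
begin

section \<open>Smooth maps\<close>

text \<open>Meant for open \<open>S\<close> in a Euclidean space.\<close>
primrec Ck_on :: "nat \<Rightarrow> ('a::real_normed_vector \<Rightarrow> 'b::real_normed_vector) \<Rightarrow> 'a set \<Rightarrow> bool" where
  "Ck_on 0 f S \<longleftrightarrow> continuous_on S f"
| "Ck_on (Suc k) f S \<longleftrightarrow>
     (\<forall>x\<in>S. f differentiable (at x)) \<and> (\<forall>v. Ck_on k (\<lambda>x. frechet_derivative f (at x) v) S)"

text \<open>On an arbitrary set, smooth means: locally the restriction of a smooth map on an open set.
  This is needed because the time interval may contain an end point.\<close>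
definition smooth_on :: "'a::real_normed_vector set \<Rightarrow> ('a \<Rightarrow> 'b::real_normed_vector) \<Rightarrow> bool" where
  "smooth_on S f \<longleftrightarrow>
     (\<forall>p\<in>S. \<exists>W F. open W \<and> p \<in> W \<and> (\<forall>k. Ck_on k F W) \<and> (\<forall>x\<in>W \<inter> S. F x = f x))"


section \<open>Smooth manifolds and tensor fields\<close>

text \<open>The underlying space of the manifold is the whole type \<open>'a\<close>; its dimension is \<open>CARD('n)\<close>.
  A chart is a pair of an open domain and a coordinate map, whose values outside the domain are
  irrelevant.\<close>
type_synonym ('a, 'n) chart = "'a set \<times> ('a \<Rightarrow> real^'n)"

abbreviation chart_dom :: "('a, 'n::finite) chart \<Rightarrow> 'a set" where
  "chart_dom c \<equiv> fst c"

abbreviation coord :: "('a, 'n::finite) chart \<Rightarrow> 'a \<Rightarrow> real^'n" where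
  "coord c \<equiv> snd c"

abbreviation chart_im :: "('a, 'n::finite) chart \<Rightarrow> (real^'n) set" where
  "chart_im c \<equiv> coord c ` chart_dom c"

definition chart_inv :: "('a, 'n::finite) chart \<Rightarrow> real^'n \<Rightarrow> 'a" where
  "chart_inv c = inv_into (chart_dom c) (coord c)"

definition smooth_atlas ::
  "('a::{t2_space,second_countable_topology}, 'n::finite) chart set \<Rightarrow> bool" where
  "smooth_atlas A \<longleftrightarrow>
     (\<Union>c\<in>A. chart_dom c) = UNIV \<and>
     (\<forall>c\<in>A. open (chart_dom c) \<and> open (chart_im c) \<and>
        homeomorphism (chart_dom c) (chart_im c) (coord c) (chart_inv c)) \<and>
     (\<forall>c\<in>A. \<forall>d\<in>A.
        smooth_on (coord c ` (chart_dom c \<inter> chart_dom d)) (coord d \<circ> chart_inv c))"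

text \<open>A covariant 2-tensor field is given by its components in each chart of the atlas, as
  functions of the coordinates, subject to the usual transformation law.\<close>
type_synonym ('a, 'n) tensor2 = "('a, 'n) chart \<Rightarrow> real^'n \<Rightarrow> real^'n^'n"

definition tensor2_field :: "('a, 'n::finite) chart set \<Rightarrow> ('a, 'n) tensor2 \<Rightarrow> bool" where
  "tensor2_field A T \<longleftrightarrow>
     (\<forall>c\<in>A. \<forall>d\<in>A. \<forall>p \<in> chart_dom c \<inter> chart_dom d.
        (let J = matrix (frechet_derivative (coord d \<circ> chart_inv c) (at (coord c p)))
         in T c (coord c p) = transpose J ** T d (coord d p) ** J))"

definition symmetric_tensor2 :: "('a, 'n::finite) chart set \<Rightarrow> ('a, 'n) tensor2 \<Rightarrow> bool" where
  "symmetric_tensor2 A T \<longleftrightarrow>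
     tensor2_field A T \<and> (\<forall>c\<in>A. \<forall>x\<in>chart_im c. transpose (T c x) = T c x)"

definition pos_def_tensor2 :: "('a, 'n::finite) chart set \<Rightarrow> ('a, 'n) tensor2 \<Rightarrow> bool" where
  "pos_def_tensor2 A T \<longleftrightarrow> (\<forall>c\<in>A. \<forall>x\<in>chart_im c. \<forall>v. v \<noteq> 0 \<longrightarrow> v \<bullet> (T c x *v v) > 0)"

text \<open>Smoothness of time-dependent objects is joint smoothness in time and position.\<close>
definition smooth_tensor2_family ::
  "('a, 'n::finite) chart set \<Rightarrow> real set \<Rightarrow> (real \<Rightarrow> ('a, 'n) tensor2) \<Rightarrow> bool" where
  "smooth_tensor2_family A I T \<longleftrightarrow>
     (\<forall>c\<in>A. smooth_on (I \<times> chart_im c) (\<lambda>(t, x). T t c x))"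

definition smooth_function_family ::
  "('a, 'n::finite) chart set \<Rightarrow> real set \<Rightarrow> (real \<Rightarrow> 'a \<Rightarrow> real) \<Rightarrow> bool" where
  "smooth_function_family A I f \<longleftrightarrow>
     (\<forall>c\<in>A. smooth_on (I \<times> chart_im c) (\<lambda>(t, x). f t (chart_inv c x)))"


section \<open>Riemannian geometry in coordinates\<close>

text \<open>In this section \<open>g\<close> is the matrix-valued function of the components of a metric in a
  coordinate domain, and \<open>K\<close> that of a symmetric covariant 2-tensor field.\<close>

definition pd :: "'n::finite \<Rightarrow> (real^'n \<Rightarrow> real) \<Rightarrow> real^'n \<Rightarrow> real" where
  "pd i f x = frechet_derivative f (at x) (axis i 1)"

abbreviation ginv :: "(real^'n \<Rightarrow> real^'n^'n) \<Rightarrow> real^'n \<Rightarrow> real^'n^'n::finite" where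
  "ginv g x \<equiv> matrix_inv (g x)"

text \<open>\<open>christoffel g k i j\<close> has upper index \<open>k\<close> and lower indices \<open>i, j\<close>.\<close>
definition christoffel ::
  "(real^'n \<Rightarrow> real^'n^'n::finite) \<Rightarrow> 'n \<Rightarrow> 'n \<Rightarrow> 'n \<Rightarrow> real^'n \<Rightarrow> real" where
  "christoffel g k i j x =
     (\<Sum>l\<in>UNIV. ginv g x $ k $ l *
        (pd i (\<lambda>y. g y $ j $ l) x + pd j (\<lambda>y. g y $ i $ l) x - pd l (\<lambda>y. g y $ i $ j) x)) / 2"

text \<open>The sign is such that round spheres have positive Ricci curvature.\<close>
definition ricci :: "(real^'n \<Rightarrow> real^'n^'n::finite) \<Rightarrow> 'n \<Rightarrow> 'n \<Rightarrow> real^'n \<Rightarrow> real" where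
  "ricci g i j x =
     (\<Sum>k\<in>UNIV. pd k (christoffel g k i j) x) - (\<Sum>k\<in>UNIV. pd j (christoffel g k i k) x)
     + (\<Sum>k\<in>UNIV. \<Sum>l\<in>UNIV. christoffel g k k l x * christoffel g l i j x)
     - (\<Sum>k\<in>UNIV. \<Sum>l\<in>UNIV. christoffel g k j l x * christoffel g l i k x)"

definition trace_wrt ::
  "(real^'n \<Rightarrow> real^'n^'n::finite) \<Rightarrow> (real^'n \<Rightarrow> real^'n^'n) \<Rightarrow> real^'n \<Rightarrow> real" where
  "trace_wrt g K x = (\<Sum>i\<in>UNIV. \<Sum>j\<in>UNIV. ginv g x $ i $ j * K x $ i $ j)"

definition scal :: "(real^'n \<Rightarrow> real^'n^'n::finite) \<Rightarrow> real^'n \<Rightarrow> real" where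
  "scal g = trace_wrt g (\<lambda>x. \<chi> i j. ricci g i j x)"

definition traceless_part ::
  "(real^'n \<Rightarrow> real^'n^'n::finite) \<Rightarrow> (real^'n \<Rightarrow> real^'n^'n) \<Rightarrow> real^'n \<Rightarrow> real^'n^'n" where
  "traceless_part g K x = K x - (trace_wrt g K x / real CARD('n)) *\<^sub>R g x"

definition norm2_wrt ::
  "(real^'n \<Rightarrow> real^'n^'n::finite) \<Rightarrow> (real^'n \<Rightarrow> real^'n^'n) \<Rightarrow> real^'n \<Rightarrow> real" where
  "norm2_wrt g K x =
     (\<Sum>i\<in>UNIV. \<Sum>j\<in>UNIV. \<Sum>k\<in>UNIV. \<Sum>l\<in>UNIV.
        ginv g x $ i $ k * ginv g x $ j $ l * K x $ i $ j * K x $ k $ l)"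

text \<open>\<open>cov_deriv2 g K k i j\<close> is \<open>(\<nabla>\<^sub>k K)\<^sub>i\<^sub>j\<close>.\<close>
definition cov_deriv2 ::
  "(real^'n \<Rightarrow> real^'n^'n::finite) \<Rightarrow> (real^'n \<Rightarrow> real^'n^'n) \<Rightarrow> 'n \<Rightarrow> 'n \<Rightarrow> 'n \<Rightarrow> real^'n \<Rightarrow> real" where
  "cov_deriv2 g K k i j x =
     pd k (\<lambda>y. K y $ i $ j) x
     - (\<Sum>l\<in>UNIV. christoffel g l k i x * K x $ l $ j)
     - (\<Sum>l\<in>UNIV. christoffel g l k j x * K x $ i $ l)"

text \<open>\<open>\<nabla>\<^sub>i K\<^sup>i\<^sub>j\<close>\<close>
definition divergence2 ::
  "(real^'n \<Rightarrow> real^'n^'n::finite) \<Rightarrow> (real^'n \<Rightarrow> real^'n^'n) \<Rightarrow> 'n \<Rightarrow> real^'n \<Rightarrow> real" where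
  "divergence2 g K j x = (\<Sum>i\<in>UNIV. \<Sum>k\<in>UNIV. ginv g x $ i $ k * cov_deriv2 g K k i j x)"

text \<open>The second covariant derivative \<open>f\<^sub>;\<^sub>i\<^sub>j\<close> of a function.\<close>
definition hessian ::
  "(real^'n \<Rightarrow> real^'n^'n::finite) \<Rightarrow> (real^'n \<Rightarrow> real) \<Rightarrow> 'n \<Rightarrow> 'n \<Rightarrow> real^'n \<Rightarrow> real" where
  "hessian g f i j x = pd i (pd j f) x - (\<Sum>k\<in>UNIV. christoffel g k i j x * pd k f x)"


section \<open>Scalars and volume on the manifold\<close>

text \<open>The following two quantities do not depend on the chart, so any chart around \<open>p\<close> may be
  chosen to evaluate them.\<close>

definition chart_at :: "('a, 'n::finite) chart set \<Rightarrow> 'a \<Rightarrow> ('a, 'n) chart" where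
  "chart_at A p = (SOME c. c \<in> A \<and> p \<in> chart_dom c)"

definition scalar_curvature ::
  "('a, 'n::finite) chart set \<Rightarrow> ('a, 'n) tensor2 \<Rightarrow> 'a \<Rightarrow> real" where
  "scalar_curvature A g p = (let c = chart_at A p in scal (g c) (coord c p))"

definition mean_curvature ::
  "('a, 'n::finite) chart set \<Rightarrow> ('a, 'n) tensor2 \<Rightarrow> ('a, 'n) tensor2 \<Rightarrow> 'a \<Rightarrow> real" where
  "mean_curvature A g K p = (let c = chart_at A p in trace_wrt (g c) (K c) (coord c p))"

text \<open>The Riemannian volume measure (the density \<open>dvol\<close>): the Borel measure which in every
  chart is \<open>sqrt (det g)\<close> times Lebesgue measure. By second countability the charts determine it.\<close>
definition vol_measure ::
  "('a::{t2_space,second_countable_topology}, 'n::finite) chart set \<Rightarrow> ('a, 'n) tensor2 \<Rightarrow> 'a measure"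
  where
  "vol_measure A g =
     (THE \<mu>. sets \<mu> = sets borel \<and>
        (\<forall>c\<in>A. \<forall>B\<in>sets borel. B \<subseteq> chart_dom c \<longrightarrow>
           emeasure \<mu> B = (\<integral>\<^sup>+ x \<in> coord c ` B. ennreal (sqrt (det (g c x))) \<partial>lborel)))"

definition vol ::
  "('a::{t2_space,second_countable_topology}, 'n::finite) chart set \<Rightarrow> ('a, 'n) tensor2 \<Rightarrow> real" where
  "vol A g = measure (vol_measure A g) UNIV"


section \<open>Einstein flows\<close>

definition constraint_equations ::
  "('a, 'n::finite) chart set \<Rightarrow> ('a, 'n) tensor2 \<Rightarrow> ('a, 'n) tensor2 \<Rightarrow> bool" where
  "constraint_equations A g K \<longleftrightarrow>
     (\<forall>c\<in>A. \<forall>x\<in>chart_im c.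
        scal (g c) x - norm2_wrt (g c) (traceless_part (g c) (K c)) x
          + (1 - 1 / real CARD('n)) * (trace_wrt (g c) (K c) x)\<^sup>2 = 0 \<and>
        (\<forall>j. divergence2 (g c) (K c) j x - pd j (trace_wrt (g c) (K c)) x = 0))"

text \<open>The time derivatives are taken within \<open>I\<close>, hence one-sided at end points of \<open>I\<close>.\<close>
definition evolution_equations ::
  "('a, 'n::finite) chart set \<Rightarrow> real set \<Rightarrow> (real \<Rightarrow> 'a \<Rightarrow> real) \<Rightarrow>
     (real \<Rightarrow> ('a, 'n) tensor2) \<Rightarrow> (real \<Rightarrow> ('a, 'n) tensor2) \<Rightarrow> bool" where
  "evolution_equations A I L h K \<longleftrightarrow>
     (\<forall>t\<in>I. \<forall>c\<in>A. \<forall>x\<in>chart_im c. \<forall>i j.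
        (let g = h t c; k = K t c; N = L t \<circ> chart_inv c in
          ((\<lambda>s. h s c x $ i $ j) has_real_derivative (- 2 * N x * k x $ i $ j)) (at t within I) \<and>
          ((\<lambda>s. K s c x $ i $ j) has_real_derivative
             (N x * trace_wrt g k x * k x $ i $ j
              - 2 * N x * (\<Sum>a\<in>UNIV. \<Sum>b\<in>UNIV. ginv g x $ a $ b * k x $ i $ a * k x $ b $ j)
              - hessian g N i j x
              + N x * ricci g i j x)) (at t within I)))"

definition einstein_flow ::
  "('a, 'n::finite) chart set \<Rightarrow> real set \<Rightarrow> (real \<Rightarrow> 'a \<Rightarrow> real) \<Rightarrow>
     (real \<Rightarrow> ('a, 'n) tensor2) \<Rightarrow> (real \<Rightarrow> ('a, 'n) tensor2) \<Rightarrow> bool" where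
  "einstein_flow A I L h K \<longleftrightarrow>
     smooth_function_family A I L \<and> smooth_tensor2_family A I h \<and> smooth_tensor2_family A I K \<and>
     (\<forall>t\<in>I. (\<forall>p. L t p > 0) \<and>
        symmetric_tensor2 A (h t) \<and> pos_def_tensor2 A (h t) \<and> symmetric_tensor2 A (K t) \<and>
        constraint_equations A (h t) (K t)) \<and>
     evolution_equations A I L h K"

definition cmc ::
  "('a, 'n::finite) chart set \<Rightarrow> real set \<Rightarrow>
     (real \<Rightarrow> ('a, 'n) tensor2) \<Rightarrow> (real \<Rightarrow> ('a, 'n) tensor2) \<Rightarrow> bool" where
  "cmc A I h K \<longleftrightarrow>
     (\<forall>t\<in>I. \<forall>p q. mean_curvature A (h t) (K t) p = mean_curvature A (h t) (K t) q)"

text \<open>For a flow on a time interval with left end point 0.\<close>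
definition crushing_singularity ::
  "('a, 'n::finite) chart set \<Rightarrow> real set \<Rightarrow>
     (real \<Rightarrow> ('a, 'n) tensor2) \<Rightarrow> (real \<Rightarrow> ('a, 'n) tensor2) \<Rightarrow> bool" where
  "crushing_singularity A I h K \<longleftrightarrow>
     (\<forall>p. (\<forall>t\<in>I. mean_curvature A (h t) (K t) p < 0) \<and>
          strict_mono_on I (\<lambda>t. mean_curvature A (h t) (K t) p) \<and>
          filterlim (\<lambda>t. mean_curvature A (h t) (K t) p) at_bot (at_right 0))"

end

(* Since H = -3/t, the evolution of h gives d/dt vol = -(integral of H L) = (3/t) (integral of L).
   Taking the trace of the evolution of K gives dH/dt = L H^2 - Laplacian L + L R, that is,
   Laplacian L = (9/t^2) L + L R - 3/t^2. The integral of a Laplacian over a compact manifold vanishes,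
   so (9/t^2) (integral of L) + (integral of L R) = (3/t^2) vol, and the product rule for vol/t yields
   the formula for the derivative. Integrating it over [t1, t0] bounds the last integral by 3 vol(t0)/t0,
   because vol(t1)/t1 is nonnegative. *)

theory Submission
  imports Defs
begin

section \<open>Matrices\<close>

text \<open>Two obstacles shape the development. \<open>vol_measure\<close> is a definite
  description, so it means nothing until exactly one measure is known to fit. That measure is glued
  from weighted Lebesgue measures along a finite Borel partition, each cell lying in a coordinate
  ball whose closed ball stays inside the chart. The partition depends on the atlas alone, so the
  same cells serve at all times, and volumes are differentiated under ordinary integrals over fixed
  sets. For the integral of a Laplacian such cells are useless, because their sharp edges would
  leave boundary terms; a partition of unity replaces them. Only one derivative falls on the
  cutoffs, hence C1 bumps suffice. \<open>scalar_curvature\<close> is evaluated in an arbitrarily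
  chosen chart. Its chart independence comes from the Hamiltonian constraint and the continuity of
  \<open>L * R\<close> from the lapse equation, so that Christoffel symbols never have to be
  transformed or shown to be differentiable. The closed end \<open>t0\<close> of the time interval
  is why time derivatives are taken within intervals.\<close>

lemma
  fixes M :: "real^'n^'n"
  assumes "det M \<noteq> 0"
  shows matrix_inv_right: "M ** matrix_inv M = mat 1"
    and matrix_inv_left: "matrix_inv M ** M = mat 1"
proof -
  have "\<exists>M'. M ** M' = mat 1 \<and> M' ** M = mat 1"
    using assms by (simp flip: invertible_det_nz add: invertible_def)
  from someI_ex[OF this] show "M ** matrix_inv M = mat 1" "matrix_inv M ** M = mat 1"
    by (simp_all add: matrix_inv_def)
qed

lemma matrix_inv_unique:
  fixes M :: "real^'n^'n"
  assumes "M ** N = mat 1"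
  shows "matrix_inv M = N"
proof -
  have "det M * det N = 1"
    by (metis assms det_I det_mul)
  then have "matrix_inv M ** M = mat 1"
    by (intro matrix_inv_left) auto
  then show ?thesis
    by (metis assms matrix_mul_assoc matrix_mul_lid matrix_mul_rid)
qed

lemma transpose_matrix_inv:
  fixes M :: "real^'n^'n"
  assumes "det M \<noteq> 0"
  shows "transpose (matrix_inv M) = matrix_inv (transpose M)"
  by (metis assms matrix_inv_left matrix_inv_unique matrix_transpose_mul transpose_mat)

text \<open>Cramer's rule for the columns of the inverse. Entries of the inverse become quotients of
  determinants, so limits, continuity and C1 regularity of \<open>matrix_inv\<close> reduce to those
  of polynomials.\<close>

lemma matrix_inv_component:
  fixes M :: "real^'n^'n"
  assumes "det M \<noteq> 0"
  shows "matrix_inv M $ k $ l =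
    det (\<chi> i j. if j = k then axis l 1 $ i else M $ i $ j) / det M"
proof -
  have "M *v (matrix_inv M *v axis l 1) = axis l 1"
    using assms by (simp add: matrix_vector_mul_assoc matrix_inv_right)
  then have "(matrix_inv M *v axis l 1) $ k =
    det (\<chi> i j. if j = k then axis l 1 $ i else M $ i $ j) / det M"
    using cramer[OF assms, of "matrix_inv M *v axis l 1" "axis l 1"]
    by (metis (no_types, lifting) vec_lambda_beta)
  then show ?thesis
    by (simp add: matrix_vector_mul_component inner_axis)
qed

lemma
  fixes B C D :: "real^'n^'n"
  shows matrix_sub_ldistrib: "B ** (C - D) = B ** C - B ** D"
    and matrix_sub_rdistrib: "(B - C) ** D = B ** D - C ** D"
  by (simp_all add: matrix_matrix_mult_def vec_eq_iff sum_subtractf algebra_simps)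

lemma tendsto_matrix_mult_component:
  fixes M N :: "'x \<Rightarrow> real^'n^'n"
  assumes "\<And>i j. ((\<lambda>s. M s $ i $ j) \<longlongrightarrow> M0 $ i $ j) F" "\<And>i j. ((\<lambda>s. N s $ i $ j) \<longlongrightarrow> N0 $ i $ j) F"
  shows "((\<lambda>s. (M s ** N s) $ i $ j) \<longlongrightarrow> (M0 ** N0) $ i $ j) F"
  unfolding matrix_matrix_mult_def vec_lambda_beta by (intro tendsto_intros assms)

lemma tendsto_det:
  fixes M :: "'x \<Rightarrow> real^'n^'n"
  assumes "\<And>i j. ((\<lambda>s. M s $ i $ j) \<longlongrightarrow> M0 $ i $ j) F"
  shows "((\<lambda>s. det (M s)) \<longlongrightarrow> det M0) F"
  unfolding det_def by (intro tendsto_intros assms)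

lemma continuous_on_det:
  fixes M :: "'x::topological_space \<Rightarrow> real^'n^'n"
  assumes "\<And>i j. continuous_on S (\<lambda>s. M s $ i $ j)"
  shows "continuous_on S (\<lambda>s. det (M s))"
  unfolding det_def by (intro continuous_intros assms)

lemma continuous_on_matrix_inv:
  fixes M :: "'x::topological_space \<Rightarrow> real^'n^'n"
  assumes "\<And>i j. continuous_on S (\<lambda>s. M s $ i $ j)" and nz: "\<And>s. s \<in> S \<Longrightarrow> det (M s) \<noteq> 0"
  shows "continuous_on S (\<lambda>s. matrix_inv (M s) $ k $ l)"
proof -
  have entry: "continuous_on S (\<lambda>s. (\<chi> i j. if j = k then axis l 1 $ i else M s $ i $ j) $ a $ b)" for a b
    using assms(1) by (cases "b = k") (auto intro: continuous_intros)
  have "continuous_on S (\<lambda>s. det (\<chi> i j. if j = k then axis l 1 $ i else M s $ i $ j) / det (M s))"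
    using nz by (intro continuous_intros continuous_on_det assms entry) auto
  then show ?thesis
    by (rule continuous_on_eq) (simp add: matrix_inv_component nz)
qed

text \<open>The segment from the identity to \<open>M\<close> consists of matrices with positive
  quadratic form, hence invertible ones; by the intermediate value theorem the determinant keeps the
  sign it has at the identity.\<close>

lemma pos_def_imp_det_pos:
  fixes M :: "real^'n^'n"
  assumes "\<And>v. v \<noteq> 0 \<Longrightarrow> v \<bullet> (M *v v) > 0"
  shows "det M > 0"
proof (rule ccontr)
  assume "\<not> det M > 0"
  define P where "P s = (1 - s) *\<^sub>R mat 1 + s *\<^sub>R M" for s :: real
  have P: "v \<bullet> (P s *v v) > 0" if "s \<in> {0..1}" "v \<noteq> 0" for s v
  proof (cases "s = 0")
    case False
    have eq: "v \<bullet> (P s *v v) = (1 - s) * (v \<bullet> v) + s * (v \<bullet> (M *v v))"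
      by (simp add: P_def matrix_vector_mult_add_rdistrib scaleR_matrix_vector_assoc[symmetric]
          inner_add_right inner_scaleR_right)
    show ?thesis
      using that False assms[OF that(2)] unfolding eq
      by (intro add_nonneg_pos mult_pos_pos mult_nonneg_nonneg) auto
  qed (use that in \<open>simp add: P_def\<close>)
  have nz: "det (P s) \<noteq> 0" if "s \<in> {0..1}" for s
  proof
    assume "det (P s) = 0"
    then obtain v where "v \<noteq> 0" "P s *v v = 0"
      by (metis invertible_det_nz invertible_left_inverse matrix_left_invertible_ker)
    with P[OF that] show False by force
  qed
  have cont: "continuous_on {0..1} (\<lambda>s. det (P s))"
    by (rule continuous_on_det) (auto simp: P_def intro!: continuous_intros)
  have "det (P 0) = 1" "det (P 1) = det M"
    by (simp_all add: P_def)
  then obtain s where "s \<in> {0..1}" "det (P s) = 0"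
    using IVT2'[of "\<lambda>s. det (P s)" 1 0 0] cont \<open>\<not> det M > 0\<close> by auto
  with nz show False by blast
qed

text \<open>Jacobi's formula at the identity, read off from the six-term expansion. Every term but
  the diagonal one has at least two factors that vanish at the identity, so its derivative is
  zero.\<close>

lemma has_real_derivative_det_at_id:
  fixes M :: "real \<Rightarrow> real^3^3"
  assumes D: "\<And>i j. ((\<lambda>s. M s $ i $ j) has_real_derivative D $ i $ j) (at t within S)"
    and "M t = mat 1"
  shows "((\<lambda>s. det (M s)) has_real_derivative trace D) (at t within S)"
proof -
  have Mt: "M t $ i $ j = (if i = j then 1 else 0)" for i j
    by (simp add: assms(2) mat_def)
  have prod: "((\<lambda>s. M s $ a $ b * M s $ c $ d * M s $ e $ f) has_real_derivative
      D $ a $ b * M t $ c $ d * M t $ e $ f + M t $ a $ b * D $ c $ d * M t $ e $ f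
      + M t $ a $ b * M t $ c $ d * D $ e $ f) (at t within S)" for a b c d e f
    by (rule DERIV_cong[OF DERIV_mult[OF DERIV_mult[OF D D] D]]) (simp add: algebra_simps)
  show ?thesis
    unfolding det_3
    by (rule DERIV_cong[OF DERIV_diff[OF DERIV_diff[OF DERIV_diff[OF DERIV_add[OF DERIV_add[OF
              prod prod] prod] prod] prod] prod]]) (simp add: trace_def sum_3 Mt)
qed

lemma has_real_derivative_matrix_mult:
  fixes M :: "real \<Rightarrow> real^'n^'n"
  assumes D: "\<And>i j. ((\<lambda>s. M s $ i $ j) has_real_derivative D $ i $ j) (at t within S)"
  shows "((\<lambda>s. (B ** M s ** C) $ i $ j) has_real_derivative (B ** D ** C) $ i $ j) (at t within S)"
  by (auto simp: matrix_matrix_mult_def sum_distrib_right sum_distrib_left intro!: derivative_eq_intros D sum.cong)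

text \<open>Multiplication by the constant matrix \<open>matrix_inv (M t)\<close> moves the curve to
  one through the identity.\<close>

lemma has_real_derivative_det:
  fixes M :: "real \<Rightarrow> real^3^3"
  assumes D: "\<And>i j. ((\<lambda>s. M s $ i $ j) has_real_derivative D $ i $ j) (at t within S)"
    and nz: "det (M t) \<noteq> 0"
  shows "((\<lambda>s. det (M s)) has_real_derivative det (M t) * trace (matrix_inv (M t) ** D)) (at t within S)"
proof -
  \<comment> \<open>The trailing \<open>mat 1\<close> only provides the two-sided shape of
    \<open>has_real_derivative_matrix_mult\<close>.\<close>
  have "((\<lambda>s. det (matrix_inv (M t) ** M s ** mat 1)) has_real_derivative
      trace (matrix_inv (M t) ** D ** mat 1)) (at t within S)"
    by (intro has_real_derivative_det_at_id has_real_derivative_matrix_mult D)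
      (simp add: matrix_inv_left nz)
  from DERIV_cmult[OF this, of "det (M t)"]
  have "((\<lambda>s. det (M t) * (det (matrix_inv (M t)) * det (M s))) has_real_derivative
      det (M t) * trace (matrix_inv (M t) ** D)) (at t within S)"
    by (simp add: det_mul)
  moreover have "det (M t) * det (matrix_inv (M t)) = 1"
    by (metis det_I det_mul matrix_inv_right nz)
  ultimately show ?thesis
    by (simp flip: mult.assoc)
qed

text \<open>The resolvent identity \<open>I s - I t = - I s ** (M s - M t) ** I t\<close>, with
  \<open>I\<close> the inverse of \<open>M\<close>, is exact. After division by \<open>s - t\<close>
  only the continuity of \<open>I\<close> at \<open>t\<close> is needed to pass to the
  limit.\<close>

lemma has_real_derivative_matrix_inv:
  fixes M :: "real \<Rightarrow> real^'n^'n"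
  assumes D: "\<And>i j. ((\<lambda>s. M s $ i $ j) has_real_derivative D $ i $ j) (at t within S)"
    and nz: "\<And>s. s \<in> S \<Longrightarrow> det (M s) \<noteq> 0" and "t \<in> S"
  shows "((\<lambda>s. matrix_inv (M s) $ i $ j) has_real_derivative
      - (matrix_inv (M t) ** D ** matrix_inv (M t)) $ i $ j) (at t within S)"
proof -
  let ?I = "\<lambda>s. matrix_inv (M s)"
  \<comment> \<open>Continuity of the inverse at \<open>t\<close>, through Cramer's rule: column
    \<open>i\<close> is replaced by a constant vector and the other columns converge.\<close>
  have lim_I: "((\<lambda>s. ?I s $ i $ j) \<longlongrightarrow> ?I t $ i $ j) (at t within S)" for i j
  proof -
    have nz_t: "det (M t) \<noteq> 0"
      using nz \<open>t \<in> S\<close> by blast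
    have lim_M: "((\<lambda>s. M s $ i $ j) \<longlongrightarrow> M t $ i $ j) (at t within S)" for i j
      using D[of i j] by (meson DERIV_isCont continuous_within DERIV_continuous)
    have "((\<lambda>s. (\<chi> a b. if b = i then axis j 1 $ a else M s $ a $ b) $ k $ l) \<longlongrightarrow>
        (\<chi> a b. if b = i then axis j 1 $ a else M t $ a $ b) $ k $ l) (at t within S)" for k l
      using lim_M[of k l] by (cases "l = i") simp_all
    then have "((\<lambda>s. det (\<chi> a b. if b = i then axis j 1 $ a else M s $ a $ b) / det (M s)) \<longlongrightarrow>
        det (\<chi> a b. if b = i then axis j 1 $ a else M t $ a $ b) / det (M t)) (at t within S)"
      using nz_t lim_M by (intro tendsto_divide tendsto_det)
    moreover have "\<forall>\<^sub>F s in at t within S.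
        det (\<chi> a b. if b = i then axis j 1 $ a else M s $ a $ b) / det (M s) = ?I s $ i $ j"
      by (simp add: eventually_at_filter matrix_inv_component nz)
    ultimately show ?thesis
      unfolding matrix_inv_component[OF nz_t] by (rule Lim_transform_eventually)
  qed
  let ?Q = "\<lambda>s. \<chi> i j. (M s $ i $ j - M t $ i $ j) / (s - t)"
  have lim_Q: "((\<lambda>s. ?Q s $ i $ j) \<longlongrightarrow> D $ i $ j) (at t within S)" for i j
    using D[of i j] by (simp add: has_field_derivative_iff)
  have "((\<lambda>s. - (?I s ** ?Q s ** ?I t) $ i $ j) \<longlongrightarrow> - (?I t ** D ** ?I t) $ i $ j) (at t within S)"
    by (intro tendsto_minus tendsto_matrix_mult_component lim_I lim_Q tendsto_const)
  moreover have "\<forall>\<^sub>F s in at t within S. s \<in> S \<and> s \<noteq> t"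
    by (simp add: eventually_at_filter)
  then have "\<forall>\<^sub>F s in at t within S. - (?I s ** ?Q s ** ?I t) $ i $ j = (?I s $ i $ j - ?I t $ i $ j) / (s - t)"
  proof eventually_elim
    case (elim s)
    have "(s - t) *\<^sub>R ?Q s = M s - M t"
      using elim by (simp add: vec_eq_iff)
    moreover have "(s - t) *\<^sub>R (?I s ** ?Q s ** ?I t) = ?I s ** ((s - t) *\<^sub>R ?Q s) ** ?I t"
      by (simp only: scalar_matrix_assoc matrix_scalar_ac)
    ultimately have "(s - t) *\<^sub>R (?I s ** ?Q s ** ?I t) = ?I s ** (M s - M t) ** ?I t"
      by simp
    also have "\<dots> = ?I s ** M s ** ?I t - ?I s ** (M t ** ?I t)"
      by (simp add: matrix_mul_assoc matrix_sub_ldistrib matrix_sub_rdistrib)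
    also have "\<dots> = ?I t - ?I s"
      using elim nz \<open>t \<in> S\<close> by (simp add: matrix_inv_left matrix_inv_right)
    finally have "(s - t) * (?I s ** ?Q s ** ?I t) $ i $ j = ?I t $ i $ j - ?I s $ i $ j"
      by (simp only: vec_eq_iff vector_scaleR_component vector_minus_component real_scaleR_def)
    then have "(?I s ** ?Q s ** ?I t) $ i $ j = (?I t $ i $ j - ?I s $ i $ j) / (s - t)"
      using elim by (simp only: nonzero_eq_divide_eq right_minus_eq mult.commute simp_thms)
    then show ?case
      by (simp only: minus_divide_left minus_diff_eq)
  qed
  ultimately show ?thesis
    unfolding has_field_derivative_iff by (rule Lim_transform_eventually)
qed

text \<open>Turns index contractions into traces, where cyclicity replaces the renaming of
  indices.\<close>

lemma sum_mult_eq_trace: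
  fixes B C :: "real^'n^'n"
  shows "(\<Sum>i\<in>UNIV. \<Sum>j\<in>UNIV. B $ i $ j * C $ i $ j) = trace (B ** transpose C)"
  by (simp add: trace_def matrix_matrix_mult_def transpose_def)

section \<open>Continuously differentiable functions\<close>

lemma Ck_on_subset: "Ck_on k f S \<Longrightarrow> T \<subseteq> S \<Longrightarrow> Ck_on k f T"
  by (induction k arbitrary: f) (auto intro: continuous_on_subset)

lemma Ck_on_cong:
  assumes "open S" "\<And>x. x \<in> S \<Longrightarrow> f x = g x" "Ck_on k f S"
  shows "Ck_on k g S"
  using assms(2,3)
proof (induction k arbitrary: f g)
  case 0
  then show ?case by (simp cong: continuous_on_cong)
next
  case (Suc k)
  have deriv: "(g has_derivative frechet_derivative f (at x)) (at x)" if "x \<in> S" for x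
  proof (rule has_derivative_transform_within_open)
    show "(f has_derivative frechet_derivative f (at x)) (at x)"
      using Suc.prems(2) that by (simp add: frechet_derivative_works)
  qed (use assms(1) that Suc.prems(1) in auto)
  have "Ck_on k (\<lambda>x. frechet_derivative g (at x) v) S" for v
  proof (rule Suc.IH)
    show "Ck_on k (\<lambda>x. frechet_derivative f (at x) v) S"
      using Suc.prems(2) by simp
  qed (simp add: frechet_derivative_at[OF deriv])
  then show ?case
    using deriv by (auto simp: differentiable_def)
qed

lemma Ck_on_local:
  assumes "\<And>p. p \<in> S \<Longrightarrow> \<exists>W. open W \<and> p \<in> W \<and> Ck_on k f W"
  shows "Ck_on k f S"
  using assms
proof (induction k arbitrary: f)
  case 0
  have "continuous (at p) f" if "p \<in> S" for p
    using 0[OF that] by (auto simp: continuous_on_eq_continuous_at)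
  then show ?case
    by (simp add: continuous_at_imp_continuous_on)
next
  case (Suc k)
  have "f differentiable (at x)" if "x \<in> S" for x
    using Suc.prems[OF that] by auto
  moreover have "Ck_on k (\<lambda>x. frechet_derivative f (at x) v) S" for v
    using Suc.prems by (intro Suc.IH) (metis Ck_on.simps(2))
  ultimately show ?case by simp
qed

lemma smooth_onD:
  assumes "smooth_on S f" "p \<in> S"
  shows "\<exists>W F. open W \<and> p \<in> W \<and> (\<forall>k. Ck_on k F W) \<and> (\<forall>x\<in>W \<inter> S. F x = f x)"
  using bspec[OF assms(1)[unfolded smooth_on_def] assms(2)] .

text \<open>Around a point of an open \<open>S\<close> the smooth extension coincides with
  \<open>f\<close>, so its derivatives are those of \<open>f\<close>.\<close>

lemma smooth_on_imp_Ck_on: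
  assumes "open S" "smooth_on S f"
  shows "Ck_on k f S"
proof (rule Ck_on_local)
  fix p assume "p \<in> S"
  from smooth_onD[OF assms(2) this] obtain W F
    where W: "open W" "p \<in> W" "\<forall>k. Ck_on k F W" "\<forall>x\<in>W \<inter> S. F x = f x"
    by blast
  have "Ck_on k F (W \<inter> S)"
    using spec[OF W(3)] by (rule Ck_on_subset) simp
  then have "Ck_on k f (W \<inter> S)"
    by (rule Ck_on_cong[rotated 2]) (use W(1,4) assms(1) in \<open>auto intro: open_Int\<close>)
  then show "\<exists>W. open W \<and> p \<in> W \<and> Ck_on k f W"
    using W(1,2) assms(1) \<open>p \<in> S\<close> by (intro exI[of _ "W \<inter> S"]) (simp add: open_Int)
qed

text \<open>Meant for \<open>{0<..t0} \<times> chart_im c\<close>, which contains its end time and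
  is not open; continuity within the set is inherited from the local extensions.\<close>

lemma smooth_on_imp_continuous_on:
  assumes "smooth_on S f"
  shows "continuous_on S f"
proof -
  have "(f \<longlongrightarrow> f p) (at p within S)" if p: "p \<in> S" for p
  proof -
    from smooth_onD[OF assms p] obtain W F
      where W: "open W" "p \<in> W" "\<forall>k. Ck_on k F W" "\<forall>x\<in>W \<inter> S. F x = f x"
      by blast
    have "continuous_on W F"
      using spec[OF W(3), of 0] by simp
    then have "isCont F p"
      using W(1,2) by (simp add: continuous_on_eq_continuous_at)
    from continuous_at_imp_continuous_at_within[OF this, of S] have "(F \<longlongrightarrow> F p) (at p within S)"
      by (simp only: continuous_within)
    then have "(F \<longlongrightarrow> f p) (at p within S)"
      using bspec[OF W(4), of p] p W(2) by simp
    moreover have "\<forall>\<^sub>F x in at p within S. F x = f x"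
      unfolding eventually_at_topological using W(1,2,4) by (intro exI[of _ W]) simp
    ultimately show ?thesis
      by (rule Lim_transform_eventually)
  qed
  then show ?thesis
    by (simp add: continuous_on_def)
qed

text \<open>The derivative of a slice is the derivative of \<open>F\<close> in directions
  \<open>(0, v)\<close>, which is again a slice; this carries the induction.\<close>

lemma Ck_on_slice:
  fixes F :: "'b::real_normed_vector \<times> 'a::real_normed_vector \<Rightarrow> 'c::real_normed_vector"
  assumes "open W" "Ck_on k F W"
  shows "Ck_on k (\<lambda>x. F (t, x)) {x. (t, x) \<in> W}"
  using assms(2)
proof (induction k arbitrary: F)
  case 0
  then show ?case
    by (auto intro!: continuous_on_compose2[of W F] continuous_intros)
next
  case (Suc k)
  have openT: "open {x. (t, x) \<in> W}"
    using open_vimage[OF assms(1), of "\<lambda>x. (t, x)"]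
    by (simp add: vimage_def continuous_on_Pair)
  have deriv: "((\<lambda>x. F (t, x)) has_derivative (\<lambda>v. frechet_derivative F (at (t, x)) (0, v))) (at x)"
    if "(t, x) \<in> W" for x
  proof -
    have "(F has_derivative frechet_derivative F (at (t, x))) (at (t, x))"
      using Suc.prems that by (simp add: frechet_derivative_works)
    moreover have "((\<lambda>x. (t, x)) has_derivative (\<lambda>v. (0, v))) (at x)"
      by (intro derivative_intros)
    ultimately show ?thesis
      using has_derivative_compose by blast
  qed
  have "Ck_on k (\<lambda>x. frechet_derivative (\<lambda>x. F (t, x)) (at x) v) {x. (t, x) \<in> W}" for v
  proof (rule Ck_on_cong[OF openT])
    show "Ck_on k (\<lambda>x. (\<lambda>z. frechet_derivative F (at z) (0, v)) (t, x)) {x. (t, x) \<in> W}"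
      using Suc.prems by (intro Suc.IH) simp
  qed (simp add: frechet_derivative_at[OF deriv, symmetric])
  then show ?case
    using deriv by (auto simp: differentiable_def)
qed

text \<open>The family may have no neighbourhood of \<open>t\<close> in time, but its local
  extension \<open>F\<close> has one, and the slice of \<open>F\<close> at \<open>t\<close> agrees
  with \<open>f t\<close> near \<open>p\<close>.\<close>

lemma smooth_on_slice:
  fixes f :: "real \<Rightarrow> 'a::real_normed_vector \<Rightarrow> 'c::real_normed_vector"
  assumes "smooth_on (I \<times> S) (\<lambda>(t, x). f t x)" "open S" "t \<in> I"
  shows "Ck_on k (f t) S"
proof (rule Ck_on_local)
  fix p assume "p \<in> S"
  with assms(3) have "(t, p) \<in> I \<times> S" by simp
  from smooth_onD[OF assms(1) this] obtain W F where W: "open W" "(t, p) \<in> W" "\<forall>k. Ck_on k F W"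
    "\<forall>z\<in>W \<inter> (I \<times> S). F z = (case z of (s, x) \<Rightarrow> f s x)"
    by blast
  have openT: "open {x. (t, x) \<in> W}"
    using open_vimage[OF W(1), of "\<lambda>x. (t, x)"]
    by (simp add: vimage_def continuous_on_Pair)
  have "Ck_on k (\<lambda>x. F (t, x)) ({x. (t, x) \<in> W} \<inter> S)"
    using Ck_on_slice[OF W(1) spec[OF W(3)]] by (rule Ck_on_subset) auto
  then have "Ck_on k (f t) ({x. (t, x) \<in> W} \<inter> S)"
    by (rule Ck_on_cong[rotated 2]) (use openT assms(2,3) W(4) in \<open>auto intro: open_Int\<close>)
  then show "\<exists>W. open W \<and> p \<in> W \<and> Ck_on k (f t) W"
    using W(2) openT assms(2) \<open>p \<in> S\<close>
    by (intro exI[of _ "{x. (t, x) \<in> W} \<inter> S"]) (simp add: open_Int)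
qed

lemma Ck_on_bounded_linear:
  assumes "open S" "bounded_linear T" "Ck_on k f S"
  shows "Ck_on k (\<lambda>x. T (f x)) S"
  using assms(3)
proof (induction k arbitrary: f)
  case 0
  then show ?case
    using assms(2) by (auto intro: bounded_linear.continuous_on)
next
  case (Suc k)
  have deriv: "((\<lambda>x. T (f x)) has_derivative (\<lambda>v. T (frechet_derivative f (at x) v))) (at x)"
    if "x \<in> S" for x
    using Suc.prems that by (intro bounded_linear.has_derivative[OF assms(2)]) (simp add: frechet_derivative_works)
  have "Ck_on k (\<lambda>x. frechet_derivative (\<lambda>x. T (f x)) (at x) v) S" for v
  proof (rule Ck_on_cong[OF assms(1)])
    show "Ck_on k (\<lambda>x. T (frechet_derivative f (at x) v)) S"
      using Suc.prems by (intro Suc.IH) simp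
  qed (simp add: frechet_derivative_at[OF deriv, symmetric])
  then show ?case
    using deriv by (auto simp: differentiable_def)
qed

lemma Ck_on_matrix_component:
  fixes f :: "'a::real_normed_vector \<Rightarrow> real^'n^'m"
  shows "open S \<Longrightarrow> Ck_on k f S \<Longrightarrow> Ck_on k (\<lambda>x. f x $ i $ j) S"
  by (rule Ck_on_bounded_linear[where T = "\<lambda>M. M $ i $ j"])
    (auto intro: bounded_linear_intros bounded_linear_compose[OF bounded_linear_vec_nth bounded_linear_vec_nth])

section \<open>Calculus of C1 functions\<close>

lemma C1_onI:
  assumes "\<And>x. x \<in> S \<Longrightarrow> (f has_derivative f' x) (at x)" "\<And>v. continuous_on S (\<lambda>x. f' x v)"
  shows "Ck_on (Suc 0) f S"
proof -
  have "continuous_on S (\<lambda>x. frechet_derivative f (at x) v)" for v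
    using assms(2) by (rule continuous_on_eq) (simp add: frechet_derivative_at[OF assms(1)])
  then show ?thesis
    using assms(1) by (auto simp: differentiable_def)
qed

lemma
  assumes "Ck_on (Suc k) f S"
  shows Ck_on_Suc_differentiable: "x \<in> S \<Longrightarrow> f differentiable (at x)"
    and Ck_on_Suc_has_derivative: "x \<in> S \<Longrightarrow> (f has_derivative frechet_derivative f (at x)) (at x)"
    and Ck_on_Suc_continuous_on: "continuous_on S f"
  using assms
  by (auto simp: frechet_derivative_works intro!: continuous_at_imp_continuous_on differentiable_imp_continuous_within)

lemma C1_on_continuous_derivative:
  "Ck_on (Suc 0) f S \<Longrightarrow> continuous_on S (\<lambda>x. frechet_derivative f (at x) v)"
  by simp

lemma C1_on_const: "Ck_on (Suc 0) (\<lambda>x. c) S"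
  by (rule C1_onI[where f' = "\<lambda>_ _. 0"]) auto

lemma C1_on_add:
  assumes "Ck_on (Suc 0) f S" "Ck_on (Suc 0) g S"
  shows "Ck_on (Suc 0) (\<lambda>x. f x + g x) S"
proof (rule C1_onI)
  show "((\<lambda>x. f x + g x) has_derivative
      (\<lambda>v. frechet_derivative f (at x) v + frechet_derivative g (at x) v)) (at x)" if "x \<in> S" for x
    using that by (intro has_derivative_add assms[THEN Ck_on_Suc_has_derivative])
  show "continuous_on S (\<lambda>x. frechet_derivative f (at x) v + frechet_derivative g (at x) v)" for v
    by (intro continuous_on_add assms[THEN C1_on_continuous_derivative])
qed

lemma C1_on_mult:
  fixes f g :: "'a::real_normed_vector \<Rightarrow> real"
  assumes "Ck_on (Suc 0) f S" "Ck_on (Suc 0) g S"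
  shows "Ck_on (Suc 0) (\<lambda>x. f x * g x) S"
proof (rule C1_onI)
  show "((\<lambda>x. f x * g x) has_derivative
      (\<lambda>v. f x * frechet_derivative g (at x) v + frechet_derivative f (at x) v * g x)) (at x)" if "x \<in> S" for x
    using that by (intro has_derivative_mult assms[THEN Ck_on_Suc_has_derivative])
  show "continuous_on S (\<lambda>x. f x * frechet_derivative g (at x) v + frechet_derivative f (at x) v * g x)" for v
    by (intro continuous_on_add continuous_on_mult assms[THEN C1_on_continuous_derivative]
        assms[THEN Ck_on_Suc_continuous_on])
qed

text \<open>The outer function is controlled only on the values of \<open>f\<close>, so that
  \<open>inverse\<close> and \<open>sqrt\<close> can be applied away from their
  singularities.\<close>

lemma C1_on_compose_real:
  fixes f :: "'a::real_normed_vector \<Rightarrow> real"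
  assumes f: "Ck_on (Suc 0) f S"
    and \<phi>: "\<And>x. x \<in> S \<Longrightarrow> (\<phi> has_real_derivative \<phi>' (f x)) (at (f x))"
      "continuous_on (f ` S) \<phi>'"
  shows "Ck_on (Suc 0) (\<lambda>x. \<phi> (f x)) S"
proof (rule C1_onI)
  show "((\<lambda>x. \<phi> (f x)) has_derivative (\<lambda>v. \<phi>' (f x) * frechet_derivative f (at x) v)) (at x)"
    if "x \<in> S" for x
    using has_derivative_compose[OF Ck_on_Suc_has_derivative[OF f that], of \<phi> "(*) (\<phi>' (f x))"] \<phi>(1)[OF that]
    by (simp add: has_field_derivative_def)
  show "continuous_on S (\<lambda>x. \<phi>' (f x) * frechet_derivative f (at x) v)" for v
    by (intro continuous_on_mult C1_on_continuous_derivative f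
        continuous_on_compose2[OF \<phi>(2) Ck_on_Suc_continuous_on[OF f]]) auto
qed

lemma C1_on_divide:
  fixes f g :: "'a::real_normed_vector \<Rightarrow> real"
  assumes "Ck_on (Suc 0) f S" "Ck_on (Suc 0) g S" "\<And>x. x \<in> S \<Longrightarrow> g x \<noteq> 0"
  shows "Ck_on (Suc 0) (\<lambda>x. f x / g x) S"
proof -
  have "Ck_on (Suc 0) (\<lambda>x. inverse (g x)) S"
    by (rule C1_on_compose_real[where \<phi>' = "\<lambda>y. - (inverse y ^ Suc (Suc 0))", OF assms(2)])
      (use assms(3) in \<open>auto simp del: power_Suc intro!: DERIV_inverse continuous_on_minus
        continuous_on_power continuous_on_inverse continuous_on_id\<close>)
  with assms(1) show ?thesis
    unfolding divide_inverse by (rule C1_on_mult)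
qed

lemma C1_on_sqrt:
  fixes f :: "'a::real_normed_vector \<Rightarrow> real"
  assumes "Ck_on (Suc 0) f S" "\<And>x. x \<in> S \<Longrightarrow> f x > 0"
  shows "Ck_on (Suc 0) (\<lambda>x. sqrt (f x)) S"
proof (rule C1_on_compose_real[where \<phi>' = "\<lambda>y. inverse (sqrt y) / 2", OF assms(1)])
  show "(sqrt has_real_derivative inverse (sqrt (f x)) / 2) (at (f x))" if "x \<in> S" for x
    using assms(2)[OF that] by (rule DERIV_real_sqrt)
  have "sqrt y \<noteq> 0" if "y \<in> f ` S" for y
    using assms(2) that by force
  then show "continuous_on (f ` S) (\<lambda>y. inverse (sqrt y) / 2)"
    by (intro continuous_on_divide continuous_on_inverse continuous_on_real_sqrt continuous_on_id
        continuous_on_const) auto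
qed

lemma C1_on_sum:
  assumes "\<And>i. i \<in> F \<Longrightarrow> Ck_on (Suc 0) (f i) S"
  shows "Ck_on (Suc 0) (\<lambda>x. \<Sum>i\<in>F. f i x) S"
  using assms by (induction F rule: infinite_finite_induct) (auto intro!: C1_on_const C1_on_add simp del: Ck_on.simps)

lemma C1_on_prod:
  fixes f :: "'i \<Rightarrow> 'a::real_normed_vector \<Rightarrow> real"
  assumes "\<And>i. i \<in> F \<Longrightarrow> Ck_on (Suc 0) (f i) S"
  shows "Ck_on (Suc 0) (\<lambda>x. \<Prod>i\<in>F. f i x) S"
  using assms by (induction F rule: infinite_finite_induct) (auto intro!: C1_on_const C1_on_mult simp del: Ck_on.simps)

lemma C1_on_det:
  fixes M :: "'a::real_normed_vector \<Rightarrow> real^'n^'n"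
  assumes "\<And>i j. Ck_on (Suc 0) (\<lambda>x. M x $ i $ j) S"
  shows "Ck_on (Suc 0) (\<lambda>x. det (M x)) S"
  unfolding det_def by (intro C1_on_sum C1_on_mult C1_on_prod C1_on_const assms)

lemma C1_on_matrix_inv:
  fixes M :: "'a::real_normed_vector \<Rightarrow> real^'n^'n"
  assumes "open S" and C1: "\<And>i j. Ck_on (Suc 0) (\<lambda>x. M x $ i $ j) S"
    and nz: "\<And>x. x \<in> S \<Longrightarrow> det (M x) \<noteq> 0"
  shows "Ck_on (Suc 0) (\<lambda>x. matrix_inv (M x) $ k $ l) S"
proof -
  have "Ck_on (Suc 0) (\<lambda>x. (\<chi> i j. if j = k then axis l 1 $ i else M x $ i $ j) $ a $ b) S" for a b
    using C1[of a b] by (cases "b = k") (auto intro!: C1_on_const simp del: Ck_on.simps)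
  then have "Ck_on (Suc 0) (\<lambda>x. det (\<chi> i j. if j = k then axis l 1 $ i else M x $ i $ j) / det (M x)) S"
    using nz by (intro C1_on_divide C1_on_det C1) auto
  then show ?thesis
    by (rule Ck_on_cong[OF assms(1), rotated]) (simp add: matrix_inv_component nz)
qed

lemma C1_on_compose:
  fixes f :: "'b::euclidean_space \<Rightarrow> real" and \<theta> :: "'a::real_normed_vector \<Rightarrow> 'b"
  assumes f: "Ck_on (Suc 0) f T" and \<theta>: "Ck_on (Suc 0) \<theta> S" and "\<theta> ` S \<subseteq> T"
  shows "Ck_on (Suc 0) (\<lambda>x. f (\<theta> x)) S"
proof (rule C1_onI)
  show "((\<lambda>x. f (\<theta> x)) has_derivative (\<lambda>v. frechet_derivative f (at (\<theta> x)) (frechet_derivative \<theta> (at x) v))) (at x)"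
    if "x \<in> S" for x
    using assms(3) that
    by (intro has_derivative_compose[OF Ck_on_Suc_has_derivative[OF \<theta> that] Ck_on_Suc_has_derivative[OF f]]) auto
  show "continuous_on S (\<lambda>x. frechet_derivative f (at (\<theta> x)) (frechet_derivative \<theta> (at x) v))" for v
  proof (rule continuous_on_eq)
    \<comment> \<open>The definition of C1 gives continuity of derivatives in a fixed direction, but
      here the direction moves with \<open>x\<close>. Expanding it in the basis leaves only fixed
      directions.\<close>
    show "continuous_on S (\<lambda>x. \<Sum>b\<in>Basis. (frechet_derivative \<theta> (at x) v \<bullet> b) * frechet_derivative f (at (\<theta> x)) b)"
      using assms(3)
      by (intro continuous_on_sum continuous_on_mult continuous_on_inner continuous_on_const
          C1_on_continuous_derivative[OF \<theta>]
          continuous_on_compose2[OF C1_on_continuous_derivative[OF f] Ck_on_Suc_continuous_on[OF \<theta>]])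
    fix x assume "x \<in> S"
    then have "linear (frechet_derivative f (at (\<theta> x)))"
      using assms by (intro linear_frechet_derivative Ck_on_Suc_differentiable[OF f]) auto
    then show "(\<Sum>b\<in>Basis. (frechet_derivative \<theta> (at x) v \<bullet> b) * frechet_derivative f (at (\<theta> x)) b)
        = frechet_derivative f (at (\<theta> x)) (frechet_derivative \<theta> (at x) v)"
      by (subst (2) euclidean_representation[symmetric]) (simp add: linear_sum linear_cmul)
  qed
qed

subsection \<open>Partial derivatives\<close>

lemma has_real_derivative_line:
  assumes "f differentiable (at x)"
  shows "((\<lambda>s. f (x + s *\<^sub>R axis i 1)) has_real_derivative pd i f x) (at 0)"
proof -
  have "((\<lambda>s. x + s *\<^sub>R axis i 1) has_vector_derivative axis i 1) (at 0)"
    by (auto intro!: derivative_eq_intros simp: has_vector_derivative_def)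
  moreover have "(f has_derivative frechet_derivative f (at x)) (at (x + 0 *\<^sub>R axis i 1))"
    using assms by (simp add: frechet_derivative_works)
  ultimately have "((\<lambda>s. f (x + s *\<^sub>R axis i 1)) has_vector_derivative pd i f x) (at 0)"
    unfolding pd_def using vector_derivative_diff_chain_within[of "\<lambda>s. x + s *\<^sub>R axis i 1" _ 0 UNIV f]
    by (simp add: o_def has_derivative_at_withinI)
  then show ?thesis
    by (simp add: has_real_derivative_iff_has_vector_derivative)
qed

text \<open>Gives access to one-variable differentiation rules: once differentiability is known, a
  partial derivative is computed along a coordinate line.\<close>

lemma pd_eqI:
  assumes "f differentiable (at x)" "((\<lambda>s. f (x + s *\<^sub>R axis i 1)) has_real_derivative d) (at 0)"
  shows "pd i f x = d"
  using has_real_derivative_line[OF assms(1)] assms(2) by (rule DERIV_unique)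

lemma pd_mult:
  assumes "f differentiable (at x)" "g differentiable (at x)"
  shows "pd i (\<lambda>y. f y * g y) x = pd i f x * g x + f x * pd i g x"
  using DERIV_mult[OF assms[THEN has_real_derivative_line]] assms
  by (intro pd_eqI) (simp_all add: add.commute mult.commute)

lemma pd_sum:
  assumes "\<And>a. a \<in> F \<Longrightarrow> f a differentiable (at x)"
  shows "pd i (\<lambda>y. \<Sum>a\<in>F. f a y) x = (\<Sum>a\<in>F. pd i (f a) x)"
proof (cases "finite F")
  case True
  then show ?thesis
    using assms by (intro pd_eqI DERIV_sum has_real_derivative_line differentiable_sum) auto
next
  case False
  then show ?thesis
    using pd_eqI[of "\<lambda>y. 0" x i 0] by simp
qed

lemma pd_const: "pd i (\<lambda>y. c) x = 0"
  by (rule pd_eqI) auto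

text \<open>Both functions have the same derivatives at \<open>x\<close>, possibly none, so the
  choice operator inside \<open>frechet_derivative\<close> picks the same map for both.\<close>

lemma pd_cong:
  assumes "open S" "x \<in> S" "\<And>y. y \<in> S \<Longrightarrow> f y = g y"
  shows "pd i f x = pd i g x"
proof -
  have "(f has_derivative D) (at x) \<longleftrightarrow> (g has_derivative D) (at x)" for D
    using assms(3) has_derivative_transform_within_open[OF _ assms(1,2), of f D UNIV g]
      has_derivative_transform_within_open[OF _ assms(1,2), of g D UNIV f] by auto
  then show ?thesis
    by (simp add: pd_def frechet_derivative_def)
qed

lemma Ck_on_pd: "Ck_on (Suc k) f S \<Longrightarrow> Ck_on k (pd i f) S"
  by (simp add: pd_def[abs_def])

lemma pd_matrix_inv:
  fixes g :: "real^'n \<Rightarrow> real^'n^'n"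
  assumes S: "open S" "x \<in> S" and g: "\<And>i j. Ck_on (Suc 0) (\<lambda>y. g y $ i $ j) S"
    and nz: "\<And>y. y \<in> S \<Longrightarrow> det (g y) \<noteq> 0"
  shows "pd a (\<lambda>y. matrix_inv (g y) $ i $ j) x =
    - (matrix_inv (g x) ** (\<chi> i j. pd a (\<lambda>y. g y $ i $ j) x) ** matrix_inv (g x)) $ i $ j"
proof (rule pd_eqI)
  show "(\<lambda>y. matrix_inv (g y) $ i $ j) differentiable (at x)"
    using C1_on_matrix_inv[OF S(1) g nz] S(2) by (rule Ck_on_Suc_differentiable)
  \<comment> \<open>The derivative rule for the inverse wants invertibility on the whole parameter
    set. \<open>?T\<close> collects the parameters whose points on the line stay in
    \<open>S\<close>; it is open, so derivatives within it are ordinary ones.\<close>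
  let ?T = "(\<lambda>s. x + s *\<^sub>R axis a 1) -` S"
  have T: "open ?T" "0 \<in> ?T"
    by (rule open_vimage[OF S(1)], intro continuous_on_add continuous_on_scaleR continuous_on_const continuous_on_id)
      (use S in simp)
  have "((\<lambda>s. matrix_inv (g (x + s *\<^sub>R axis a 1)) $ i $ j) has_real_derivative
    - (matrix_inv (g (x + 0 *\<^sub>R axis a 1)) ** (\<chi> i j. pd a (\<lambda>y. g y $ i $ j) x) ** matrix_inv (g (x + 0 *\<^sub>R axis a 1))) $ i $ j)
    (at 0 within ?T)"
  proof (rule has_real_derivative_matrix_inv)
    show "((\<lambda>s. g (x + s *\<^sub>R axis a 1) $ i $ j) has_real_derivative
        (\<chi> i j. pd a (\<lambda>y. g y $ i $ j) x) $ i $ j) (at 0 within ?T)" for i j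
      unfolding vec_lambda_beta
      using has_real_derivative_line[OF Ck_on_Suc_differentiable[OF g S(2)]] by (rule DERIV_subset) simp
    show "det (g (x + s *\<^sub>R axis a 1)) \<noteq> 0" if "s \<in> ?T" for s
      using that by (intro nz) simp
  qed (rule T(2))
  then show "((\<lambda>s. matrix_inv (g (x + s *\<^sub>R axis a 1)) $ i $ j) has_real_derivative
    - (matrix_inv (g x) ** (\<chi> i j. pd a (\<lambda>y. g y $ i $ j) x) ** matrix_inv (g x)) $ i $ j) (at 0)"
    unfolding at_within_open[OF T(2,1)] scaleR_zero_left add_0_right .
qed

text \<open>Jacobi's formula along a coordinate line; the factor 1/2 and the cancellation
  \<open>det / sqrt det = sqrt det\<close> come from the square root.\<close>

lemma pd_sqrt_det:
  fixes g :: "real^3 \<Rightarrow> real^3^3"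
  assumes x: "x \<in> S" and g: "\<And>i j. Ck_on (Suc 0) (\<lambda>y. g y $ i $ j) S"
    and pos: "\<And>y. y \<in> S \<Longrightarrow> det (g y) > 0"
  shows "pd a (\<lambda>y. sqrt (det (g y))) x =
    sqrt (det (g x)) * trace (matrix_inv (g x) ** (\<chi> i j. pd a (\<lambda>y. g y $ i $ j) x)) / 2"
proof (rule pd_eqI)
  show "(\<lambda>y. sqrt (det (g y))) differentiable (at x)"
    using C1_on_sqrt[OF C1_on_det[OF g] pos] x by (rule Ck_on_Suc_differentiable)
  have "((\<lambda>s. det (g (x + s *\<^sub>R axis a 1))) has_real_derivative
      det (g (x + 0 *\<^sub>R axis a 1)) * trace (matrix_inv (g (x + 0 *\<^sub>R axis a 1)) ** (\<chi> i j. pd a (\<lambda>y. g y $ i $ j) x))) (at 0)"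
    using x pos[OF x] by (intro has_real_derivative_det)
      (auto intro!: has_real_derivative_line Ck_on_Suc_differentiable[OF g])
  then have "((\<lambda>s. sqrt (det (g (x + s *\<^sub>R axis a 1)))) has_real_derivative
      det (g x) * trace (matrix_inv (g x) ** (\<chi> i j. pd a (\<lambda>y. g y $ i $ j) x)) * (inverse (sqrt (det (g x))) / 2)) (at 0)"
    using pos[OF x] by (auto intro!: derivative_eq_intros)
  also have "det (g x) * trace (matrix_inv (g x) ** (\<chi> i j. pd a (\<lambda>y. g y $ i $ j) x)) * (inverse (sqrt (det (g x))) / 2)
    = sqrt (det (g x)) * trace (matrix_inv (g x) ** (\<chi> i j. pd a (\<lambda>y. g y $ i $ j) x)) / 2"
    using pos[OF x] real_div_sqrt[of "det (g x)"] by (simp add: field_simps)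
  finally show "((\<lambda>s. sqrt (det (g (x + s *\<^sub>R axis a 1)))) has_real_derivative
    sqrt (det (g x)) * trace (matrix_inv (g x) ** (\<chi> i j. pd a (\<lambda>y. g y $ i $ j) x)) / 2) (at 0)" .
qed

section \<open>Integrals depending on a parameter\<close>

lemma set_integrable_continuous_on_compact:
  fixes f :: "'b::euclidean_space \<Rightarrow> real"
  assumes "compact K" "continuous_on K f" "D \<in> sets borel" "D \<subseteq> K"
  shows "set_integrable lborel D f"
proof -
  have "set_integrable lborel K f"
    unfolding set_integrable_def by (rule borel_integrable_compact[OF assms(1,2)])
  then show ?thesis
    by (rule set_integrable_subset) (use assms(3,4) in simp_all)
qed

text \<open>Dominated convergence with a constant on \<open>K\<close> as majorant. Regularity is
  assumed on the compact \<open>K\<close>, while the integration runs over a part \<open>D\<close>: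
  the pieces of the manifold used later are merely Borel but sit in closed balls.\<close>

lemma set_integral_tendsto_bounded:
  fixes f :: "nat \<Rightarrow> 'b::euclidean_space \<Rightarrow> real"
  assumes K: "compact K" "D \<in> sets borel" "D \<subseteq> K"
    and f: "\<And>n. continuous_on K (f n)" "continuous_on K g"
    and lim: "\<And>x. x \<in> K \<Longrightarrow> (\<lambda>n. f n x) \<longlonglongrightarrow> g x"
    and bound: "\<And>n x. x \<in> K \<Longrightarrow> \<bar>f n x\<bar> \<le> B"
  shows "(\<lambda>n. LINT x:D|lborel. f n x) \<longlonglongrightarrow> (LINT x:D|lborel. g x)"
  unfolding set_lebesgue_integral_def
proof (rule integral_dominated_convergence)
  show "(\<lambda>x. indicator D x *\<^sub>R g x) \<in> borel_measurable lborel"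
    using set_integrable_continuous_on_compact[OF K(1) f(2) K(2,3)]
    by (simp add: set_integrable_def borel_measurable_integrable del: real_scaleR_def)
  show "(\<lambda>x. indicator D x *\<^sub>R f n x) \<in> borel_measurable lborel" for n
    using set_integrable_continuous_on_compact[OF K(1) f(1) K(2,3)]
    by (simp add: set_integrable_def borel_measurable_integrable del: real_scaleR_def)
  show "integrable lborel (\<lambda>x. indicator K x *\<^sub>R B)"
    by (rule borel_integrable_compact[OF K(1) continuous_on_const])
  show "AE x in lborel. (\<lambda>n. indicator D x *\<^sub>R f n x) \<longlonglongrightarrow> indicator D x *\<^sub>R g x"
    using lim K(3) by (intro AE_I2) (auto simp: indicator_def)
  show "AE x in lborel. norm (indicator D x *\<^sub>R f n x) \<le> indicator K x *\<^sub>R B" for n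
  proof (intro AE_I2)
    fix x show "norm (indicator D x *\<^sub>R f n x) \<le> indicator K x *\<^sub>R B"
      using bound[of x n] abs_ge_zero[of "f n x"] K(3) by (cases "x \<in> K"; cases "x \<in> D") auto
  qed
qed

lemma continuous_on_set_integral_param:
  fixes f :: "real \<Rightarrow> 'b::euclidean_space \<Rightarrow> real"
  assumes K: "compact K" "D \<in> sets borel" "D \<subseteq> K"
    and f: "continuous_on ({a..b} \<times> K) (\<lambda>(t, x). f t x)"
  shows "continuous_on {a..b} (\<lambda>t. LINT x:D|lborel. f t x)"
  unfolding continuous_on_sequentially o_def
proof safe
  fix X t assume t: "t \<in> {a..b}" and X: "\<forall>n. X n \<in> {a..b}" "X \<longlonglongrightarrow> t"
  have slice: "continuous_on K (f s)" if "s \<in> {a..b}" for s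
    using continuous_on_compose2[OF f, of K "\<lambda>x. (s, x)"] that
    by (simp add: continuous_on_Pair image_subset_iff)
  have "compact ((\<lambda>(t, x). f t x) ` ({a..b} \<times> K))"
    by (intro compact_continuous_image f compact_Times compact_Icc K(1))
  then obtain B where B: "\<And>y. y \<in> (\<lambda>(t, x). f t x) ` ({a..b} \<times> K) \<Longrightarrow> norm y \<le> B"
    by (meson bounded_iff compact_imp_bounded)
  show "(\<lambda>n. LINT x:D|lborel. f (X n) x) \<longlonglongrightarrow> (LINT x:D|lborel. f t x)"
  proof (rule set_integral_tendsto_bounded[OF K])
    show "continuous_on K (f (X n))" for n
      using X(1) by (intro slice) blast
    show "continuous_on K (f t)"
      by (rule slice[OF t])
    show "\<bar>f (X n) x\<bar> \<le> B" if "x \<in> K" for n x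
      using B[OF imageI, of "(X n, x)"] X(1) that by simp
    show "(\<lambda>n. f (X n) x) \<longlonglongrightarrow> f t x" if "x \<in> K" for x
    proof -
      have "continuous_on {a..b} (\<lambda>s. f s x)"
        using continuous_on_compose2[OF f, of "{a..b}" "\<lambda>s. (s, x)"] that
        by (simp add: continuous_on_Pair image_subset_iff)
      from continuous_on_tendsto_compose[OF this X(2) t] show ?thesis
        using X(1) by simp
    qed
  qed
qed

text \<open>The difference quotients converge pointwise to \<open>f'\<close>, and by the mean value
  inequality they are bounded by the supremum of \<open>f'\<close> over the compact product, which
  serves as majorant.\<close>

lemma has_real_derivative_set_integral_param:
  fixes f f' :: "real \<Rightarrow> 'b::euclidean_space \<Rightarrow> real"
  assumes K: "compact K" "D \<in> sets borel" "D \<subseteq> K"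
    and cont: "\<And>s. s \<in> {a..b} \<Longrightarrow> continuous_on K (f s)"
    and f': "continuous_on ({a..b} \<times> K) (\<lambda>(t, x). f' t x)"
    and deriv: "\<And>s x. s \<in> {a..b} \<Longrightarrow> x \<in> K \<Longrightarrow> ((\<lambda>s. f s x) has_real_derivative f' s x) (at s within {a..b})"
    and t: "t \<in> {a..b}"
  shows "((\<lambda>s. LINT x:D|lborel. f s x) has_real_derivative (LINT x:D|lborel. f' t x)) (at t within {a..b})"
  unfolding has_field_derivative_iff tendsto_at_iff_sequentially o_def
proof (intro allI impI)
  fix X assume X: "\<forall>n. X n \<in> {a..b} - {t}" "X \<longlonglongrightarrow> t"
  have "compact ((\<lambda>(t, x). f' t x) ` ({a..b} \<times> K))"
    by (intro compact_continuous_image f' compact_Times compact_Icc K(1))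
  then obtain B where B: "\<And>y. y \<in> (\<lambda>(t, x). f' t x) ` ({a..b} \<times> K) \<Longrightarrow> norm y \<le> B"
    by (meson bounded_iff compact_imp_bounded)
  have bound: "\<bar>f' s x\<bar> \<le> B" if "s \<in> {a..b}" "x \<in> K" for s x
    using B[OF imageI, of "(s, x)"] that by simp
  have X': "X n \<in> {a..b}" "X n \<noteq> t" for n
    using X(1) by auto
  have int: "set_integrable lborel D (f s)" if "s \<in> {a..b}" for s
    by (rule set_integrable_continuous_on_compact[OF K(1) cont[OF that] K(2,3)])
  have "(\<lambda>n. LINT x:D|lborel. (f (X n) x - f t x) / (X n - t)) \<longlonglongrightarrow> (LINT x:D|lborel. f' t x)"
  proof (rule set_integral_tendsto_bounded[OF K])
    show "continuous_on K (\<lambda>x. (f (X n) x - f t x) / (X n - t))" for n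
      using X'[of n] by (intro continuous_on_divide continuous_on_diff cont t continuous_on_const) auto
    show "continuous_on K (f' t)"
      using continuous_on_compose2[OF f', of K "\<lambda>x. (t, x)"] t
      by (simp add: continuous_on_Pair image_subset_iff)
    show "(\<lambda>n. (f (X n) x - f t x) / (X n - t)) \<longlonglongrightarrow> f' t x" if "x \<in> K" for x
      using deriv[OF t that] X unfolding has_field_derivative_iff tendsto_at_iff_sequentially o_def
      by blast
    show "\<bar>(f (X n) x - f t x) / (X n - t)\<bar> \<le> B" if "x \<in> K" for n x
    proof -
      have "norm (f (X n) x - f t x) \<le> B * norm (X n - t)"
        using that bound by (intro field_differentiable_bound[OF convex_real_interval(5) deriv])
          (auto simp: t X'(1) simp del: atLeastAtMost_iff)
      then show ?thesis
        using X'(2)[of n] by (simp add: divide_le_eq)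
    qed
  qed
  moreover have "(LINT x:D|lborel. (f (X n) x - f t x) / (X n - t)) =
      ((LINT x:D|lborel. f (X n) x) - (LINT x:D|lborel. f t x)) / (X n - t)" for n
    by (simp only: set_integral_divide_zero set_integral_diff(2)[OF int[OF X'(1)] int[OF t]])
  ultimately show "(\<lambda>n. ((LINT x:D|lborel. f (X n) x) - (LINT x:D|lborel. f t x)) / (X n - t))
      \<longlonglongrightarrow> (LINT x:D|lborel. f' t x)"
    by (simp only:)
qed

lemma has_real_derivative_line_at:
  assumes "f differentiable (at (x + s *\<^sub>R axis i 1))"
  shows "((\<lambda>s. f (x + s *\<^sub>R axis i 1)) has_real_derivative pd i f (x + s *\<^sub>R axis i 1)) (at s)"
proof -
  have "((\<lambda>r. f (x + (r + s) *\<^sub>R axis i 1)) has_real_derivative pd i f (x + s *\<^sub>R axis i 1)) (at 0)"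
    using has_real_derivative_line[OF assms] by (simp add: algebra_simps)
  then show ?thesis
    using DERIV_shift[of "\<lambda>s. f (x + s *\<^sub>R axis i 1)" "pd i f (x + s *\<^sub>R axis i 1)" 0 s] by simp
qed

lemma continuous_on_pd: "Ck_on (Suc 0) f S \<Longrightarrow> continuous_on S (pd i f)"
  using Ck_on_pd[of 0] by simp

lemma integral_lborel_translate:
  fixes v :: "'b::euclidean_space \<Rightarrow> real"
  assumes "v \<in> borel_measurable borel"
  shows "(LINT x|lborel. v (x + c)) = (LINT x|lborel. v x)"
  using integral_distr[of "(+) c" lborel borel v] assms
  by (simp add: lborel_distr_plus add.commute)

text \<open>Lebesgue measure is translation invariant, so the integral of \<open>v (x + s e\<^sub>i)\<close> does not depend on
  \<open>s\<close>; differentiate at \<open>s = 0\<close>.\<close>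

lemma set_integral_pd_eq_0:
  fixes u :: "real^'n \<Rightarrow> real"
  assumes U: "open U" "Ck_on (Suc 0) u U" and K: "compact K" "K \<subseteq> U"
    and supp: "\<And>x. x \<in> U - K \<Longrightarrow> u x = 0"
  shows "(LINT x:K|lborel. pd i u x) = 0"
proof -
  define v where "v = (\<lambda>x. if x \<in> U then u x else 0)"
  have v_out: "v x = 0" if "x \<notin> K" for x
    using supp that by (auto simp: v_def)
  have v_U: "v x = u x" if "x \<in> U" for x
    using that by (simp add: v_def)
  have openK: "open (- K)"
    using compact_imp_closed[OF K(1)] by (rule open_Compl)
  \<comment> \<open>The extension by zero stays C1 because \<open>U\<close> and the complement of
    \<open>K\<close> are open sets that cover the space, with \<open>v = u\<close> on the one and
    \<open>v = 0\<close> on the other.\<close>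
  have v: "Ck_on (Suc 0) v UNIV"
  proof (rule Ck_on_local)
    fix p
    show "\<exists>W. open W \<and> p \<in> W \<and> Ck_on (Suc 0) v W"
    proof (cases "p \<in> U")
      case True
      have "Ck_on (Suc 0) v U"
        by (rule Ck_on_cong[OF U(1) _ U(2)]) (simp add: v_U)
      with True U(1) show ?thesis by blast
    next
      case False
      have "Ck_on (Suc 0) v (- K)"
        by (rule Ck_on_cong[OF openK _ C1_on_const[of 0]]) (simp add: v_out)
      with False K(2) openK show ?thesis by blast
    qed
  qed
  have v_diff: "v differentiable (at x)" for x
    by (rule Ck_on_Suc_differentiable[OF v]) simp
  have v_cont: "continuous_on S v" and dv_cont: "continuous_on S (pd i v)" for S
    using continuous_on_subset[OF Ck_on_Suc_continuous_on[OF v]] continuous_on_subset[OF continuous_on_pd[OF v]]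
    by auto
  obtain R where R: "\<And>x. x \<in> K \<Longrightarrow> norm x \<le> R"
    using compact_imp_bounded[OF K(1)] by (auto simp: bounded_iff)
  \<comment> \<open>Shifts by vectors of length at most 1 keep the support of \<open>v\<close>
    inside this ball, which is thus one compact domain of integration for all \<open>s\<close> in
    \<open>{-1..1}\<close>.\<close>
  define D where "D = cball (0::real^'n) (R + 2)"
  have D: "compact D" "D \<in> sets borel" "D \<subseteq> D" "K \<subseteq> D"
    using R by (force simp: D_def)+
  have const: "(LINT x:D|lborel. v (x + s *\<^sub>R axis i 1)) = (LINT x|lborel. v x)" if "s \<in> {-1..1}" for s
  proof -
    have "v (x + s *\<^sub>R axis i 1) = 0" if "x \<notin> D" for x
    proof (rule v_out)
      have "norm x \<le> norm (x + s *\<^sub>R axis i 1) + norm (s *\<^sub>R axis i (1::real))"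
        by (metis add_diff_cancel norm_triangle_ineq4)
      also have "norm (s *\<^sub>R axis i (1::real)) \<le> 1"
        using \<open>s \<in> {-1..1}\<close> by (simp add: abs_le_iff)
      finally show "x + s *\<^sub>R axis i 1 \<notin> K"
        using R[of "x + s *\<^sub>R axis i 1"] that by (auto simp: D_def)
    qed
    then have "(LINT x:D|lborel. v (x + s *\<^sub>R axis i 1)) = (LINT x|lborel. v (x + s *\<^sub>R axis i 1))"
      unfolding set_lebesgue_integral_def by (intro Bochner_Integration.integral_cong) (auto simp: indicator_def)
    also have "\<dots> = (LINT x|lborel. v x)"
      by (rule integral_lborel_translate[OF borel_measurable_continuous_onI[OF v_cont]])
    finally show ?thesis .
  qed
  have "((\<lambda>s. LINT x:D|lborel. v (x + s *\<^sub>R axis i 1)) has_real_derivative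
      (LINT x:D|lborel. pd i v (x + 0 *\<^sub>R axis i 1))) (at 0 within {-1..1})"
  proof (rule has_real_derivative_set_integral_param[OF D(1-3)])
    show "continuous_on D (\<lambda>x. v (x + s *\<^sub>R axis i 1))" for s
      by (rule continuous_on_compose2[OF v_cont[of UNIV]]) (auto intro: continuous_on_add)
    show "continuous_on ({-1..1} \<times> D) (\<lambda>(s, x). pd i v (x + s *\<^sub>R axis i 1))"
      unfolding case_prod_beta
      by (rule continuous_on_compose2[OF dv_cont[of UNIV]])
        (auto intro!: continuous_on_add continuous_on_scaleR continuous_on_fst continuous_on_snd)
    show "((\<lambda>s. v (x + s *\<^sub>R axis i 1)) has_real_derivative pd i v (x + s *\<^sub>R axis i 1)) (at s within {-1..1})"
      for s x
      using has_real_derivative_line_at[OF v_diff] by (rule has_field_derivative_at_within)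
  qed simp
  moreover have "((\<lambda>s. LINT x:D|lborel. v (x + s *\<^sub>R axis i 1)) has_real_derivative 0) (at 0 within {-1..1})"
    by (rule has_field_derivative_transform_within[OF DERIV_const[of "LINT x|lborel. v x"], of 1])
      (simp_all add: const)
  moreover have "at 0 within {-1..1::real} = at 0"
    by (rule at_within_interior) (simp add: interior_atLeastAtMost_real)
  ultimately have "(LINT x:D|lborel. pd i v x) = 0"
    using DERIV_unique by force
  moreover have "pd i v x = 0" if "x \<notin> K" for x
    using pd_cong[OF openK, of x v "\<lambda>_. 0" i] that v_out by (simp add: pd_const)
  then have "(LINT x:D|lborel. pd i v x) = (LINT x:K|lborel. pd i v x)"
    unfolding set_lebesgue_integral_def using D(4)
    by (intro Bochner_Integration.integral_cong) (auto simp: indicator_def)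
  moreover have "(LINT x:K|lborel. pd i v x) = (LINT x:K|lborel. pd i u x)"
    using pd_cong[OF U(1), of _ v u i] v_U K
    by (intro set_lebesgue_integral_cong) (auto simp: borel_compact)
  ultimately show ?thesis by simp
qed

section \<open>Charts and the volume measure\<close>

text \<open>Outside its open domain \<open>chart_inv c\<close> need not be measurable.\<close>
definition chart_ext :: "('a, 'n::finite) chart \<Rightarrow> real^'n \<Rightarrow> 'a" where
  "chart_ext c x = (if x \<in> chart_im c then chart_inv c x else undefined)"

abbreviation overlap :: "('a, 'n::finite) chart \<Rightarrow> ('a, 'n) chart \<Rightarrow> (real^'n) set" where
  "overlap c d \<equiv> coord c ` (chart_dom c \<inter> chart_dom d)"

abbreviation jacobian :: "('a, 'n::finite) chart \<Rightarrow> ('a, 'n) chart \<Rightarrow> real^'n \<Rightarrow> real^'n^'n" where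
  "jacobian c d x \<equiv> matrix (frechet_derivative (coord d \<circ> chart_inv c) (at x))"

text \<open>The sort \<open>wellorder\<close> on the index type is demanded by the
  change-of-variables theorem that compares two charts.\<close>

locale smooth_manifold =
  fixes A :: "('a::{t2_space,second_countable_topology}, 'n::{finite,wellorder}) chart set"
  assumes atlas: "smooth_atlas A"
begin

lemma
  assumes "c \<in> A"
  shows open_chart_dom: "open (chart_dom c)"
    and open_chart_im: "open (chart_im c)"
    and continuous_on_coord: "continuous_on (chart_dom c) (coord c)"
    and continuous_on_chart_inv: "continuous_on (chart_im c) (chart_inv c)"
    and chart_inv_coord: "p \<in> chart_dom c \<Longrightarrow> chart_inv c (coord c p) = p"
    and coord_chart_inv: "x \<in> chart_im c \<Longrightarrow> coord c (chart_inv c x) = x"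
    and chart_inv_in: "x \<in> chart_im c \<Longrightarrow> chart_inv c x \<in> chart_dom c"
proof -
  have "open (chart_dom c) \<and> open (chart_im c) \<and>
      homeomorphism (chart_dom c) (chart_im c) (coord c) (chart_inv c)"
    using atlas assms unfolding smooth_atlas_def by blast
  then show "open (chart_dom c)" "open (chart_im c)"
    "continuous_on (chart_dom c) (coord c)" "continuous_on (chart_im c) (chart_inv c)"
    "p \<in> chart_dom c \<Longrightarrow> chart_inv c (coord c p) = p"
    "x \<in> chart_im c \<Longrightarrow> coord c (chart_inv c x) = x"
    "x \<in> chart_im c \<Longrightarrow> chart_inv c x \<in> chart_dom c"
    unfolding homeomorphism_def by blast+
qed

lemma chart_at_mem: "chart_at A p \<in> A" "p \<in> chart_dom (chart_at A p)"
proof -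
  have "\<exists>c. c \<in> A \<and> p \<in> chart_dom c"
    using atlas unfolding smooth_atlas_def by blast
  from someI_ex[OF this] show "chart_at A p \<in> A" "p \<in> chart_dom (chart_at A p)"
    unfolding chart_at_def by blast+
qed

text \<open>Images under \<open>coord\<close> are hard to control directly; as preimages under the
  continuous inverse they are open or Borel at once.\<close>

lemma coord_image_eq:
  assumes "c \<in> A" "E \<subseteq> chart_dom c"
  shows "coord c ` E = chart_im c \<inter> chart_inv c -` E"
proof (intro equalityI subsetI)
  fix x assume "x \<in> coord c ` E"
  with assms show "x \<in> chart_im c \<inter> chart_inv c -` E"
    by (auto simp: chart_inv_coord subset_iff)
next
  fix x assume x: "x \<in> chart_im c \<inter> chart_inv c -` E"
  with assms(1) have "x = coord c (chart_inv c x)"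
    by (simp add: coord_chart_inv)
  with x show "x \<in> coord c ` E" by blast
qed

lemma open_coord_image:
  assumes "c \<in> A" "E \<subseteq> chart_dom c" "open E"
  shows "open (coord c ` E)"
  unfolding coord_image_eq[OF assms(1,2)]
  by (rule continuous_open_preimage[OF continuous_on_chart_inv[OF assms(1)] open_chart_im[OF assms(1)] assms(3)])

lemma chart_ext_measurable: "c \<in> A \<Longrightarrow> chart_ext c \<in> borel_measurable borel"
  unfolding chart_ext_def[abs_def]
  by (intro borel_measurable_continuous_on_if continuous_on_chart_inv continuous_on_const)
    (use open_chart_im in auto)

lemma coord_image_measurable:
  assumes "c \<in> A" "E \<subseteq> chart_dom c" "E \<in> sets borel"
  shows "coord c ` E \<in> sets borel"
proof -
  have "coord c ` E = chart_im c \<inter> chart_ext c -` E"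
    unfolding coord_image_eq[OF assms(1,2)] by (auto simp: chart_ext_def)
  also have "\<dots> \<in> sets borel"
    using measurable_sets[OF chart_ext_measurable[OF assms(1)] assms(3)] open_chart_im[OF assms(1)]
    by (intro sets.Int) auto
  finally show ?thesis .
qed

lemma
  assumes "c \<in> A" "d \<in> A"
  shows open_overlap: "open (overlap c d)"
    and Ck_on_transition: "Ck_on k (coord d \<circ> chart_inv c) (overlap c d)"
proof -
  show "open (overlap c d)"
    using assms by (intro open_coord_image open_Int open_chart_dom) auto
  moreover have "smooth_on (overlap c d) (coord d \<circ> chart_inv c)"
    using atlas assms unfolding smooth_atlas_def by blast
  ultimately show "Ck_on k (coord d \<circ> chart_inv c) (overlap c d)"
    by (rule smooth_on_imp_Ck_on)
qed

end

section \<open>Change of variables for nonnegative integrals\<close>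

lemma nn_integral_eq_if_absolutely_integrable:
  fixes u :: "real^'n \<Rightarrow> real"
  assumes "(\<lambda>x. indicator S x *\<^sub>R u x) \<in> borel_measurable borel" "\<And>x. x \<in> S \<Longrightarrow> u x \<ge> 0"
  shows "(\<integral>\<^sup>+ x \<in> S. ennreal (u x) \<partial>lborel) =
    (if u absolutely_integrable_on S then ennreal (integral S u) else \<infinity>)"
proof -
  let ?I = "\<lambda>x. indicator S x *\<^sub>R u x"
  have meas: "?I \<in> borel_measurable lborel"
    using assms(1) by simp
  have nonneg: "?I x \<ge> 0" for x
    using assms(2) by (simp add: indicator_def)
  have eq: "(\<integral>\<^sup>+ x \<in> S. ennreal (u x) \<partial>lborel) = (\<integral>\<^sup>+ x. ennreal (?I x) \<partial>lborel)"
    by (intro nn_integral_cong) (simp add: indicator_def)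
  have iff: "u absolutely_integrable_on S \<longleftrightarrow> integrable lborel ?I"
    unfolding set_integrable_def by (rule integrable_completion[OF meas])
  show ?thesis
  proof (cases "u absolutely_integrable_on S")
    case True
    have "(\<integral>\<^sup>+ x. ennreal (?I x) \<partial>lborel) = ennreal (integral\<^sup>L lborel ?I)"
      using True nonneg by (intro nn_integral_eq_integral) (simp_all add: iff)
    also have "integral\<^sup>L lborel ?I = integral S u"
      using set_lebesgue_integral_eq_integral(2)[OF True] integral_completion[OF meas]
      by (simp add: set_lebesgue_integral_def)
    finally show ?thesis
      using True eq by simp
  next
    case False
    then have "(\<integral>\<^sup>+ x. ennreal (?I x) \<partial>lborel) = \<infinity>"
      using meas nonneg unfolding iff integrable_iff_bounded
      by (auto simp: less_top[symmetric] abs_of_nonneg simp del: real_scaleR_def)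
    with False eq show ?thesis by simp
  qed
qed

text \<open>The classical theorem concerns absolutely integrable functions. Writing a nonnegative
  integral as the Henstock-Kurzweil integral when that exists absolutely, and as infinity otherwise,
  carries it over to values in \<open>ennreal\<close>.\<close>

lemma nn_integral_change_of_variables:
  fixes \<theta> :: "real^'n::{finite,wellorder} \<Rightarrow> real^'n::_" and u v :: "real^'n::_ \<Rightarrow> real"
  assumes S: "S \<in> sets borel"
    and deriv: "\<And>x. x \<in> S \<Longrightarrow> (\<theta> has_derivative \<theta>' x) (at x)" and inj: "inj_on \<theta> S"
    and u: "(\<lambda>x. indicator S x *\<^sub>R u x) \<in> borel_measurable borel"
    and v: "(\<lambda>x. indicator (\<theta> ` S) x *\<^sub>R v x) \<in> borel_measurable borel" "\<And>y. y \<in> \<theta> ` S \<Longrightarrow> v y \<ge> 0"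
    and eq: "\<And>x. x \<in> S \<Longrightarrow> u x = \<bar>det (matrix (\<theta>' x))\<bar> * v (\<theta> x)"
  shows "(\<integral>\<^sup>+ x \<in> S. ennreal (u x) \<partial>lborel) = (\<integral>\<^sup>+ x \<in> \<theta> ` S. ennreal (v x) \<partial>lborel)"
proof -
  have u_nonneg: "u x \<ge> 0" if "x \<in> S" for x
    unfolding eq[OF that] by (intro mult_nonneg_nonneg v(2) imageI that) simp
  let ?w = "\<lambda>x. \<bar>det (matrix (\<theta>' x))\<bar> * v (\<theta> x)"
  have cov: "(?w absolutely_integrable_on S \<and> integral S ?w = b) \<longleftrightarrow>
      (v absolutely_integrable_on (\<theta> ` S) \<and> integral (\<theta> ` S) v = b)" for b
  proof -
    have "S \<in> sets lebesgue" using S by simp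
    \<comment> \<open>The theorem is stated for vector-valued functions, hence the detour through
      \<open>real^1\<close>.\<close>
    from has_absolute_integral_change_of_variables[OF this has_derivative_at_withinI[OF deriv] inj,
        of "\<lambda>x. vec (v x) :: real^1" "vec b"]
    show ?thesis
      unfolding absolutely_integrable_on_1_iff integral_on_1_eq by (simp add: vec_eq_iff)
  qed
  have "u absolutely_integrable_on S \<longleftrightarrow> ?w absolutely_integrable_on S"
    unfolding set_integrable_def
    by (rule Bochner_Integration.integrable_cong) (auto simp: indicator_def eq)
  moreover have "integral S u = integral S ?w"
    by (rule Henstock_Kurzweil_Integration.integral_cong) (rule eq)
  moreover have "(\<integral>\<^sup>+ x \<in> S. ennreal (u x) \<partial>lborel) =
      (if u absolutely_integrable_on S then ennreal (integral S u) else \<infinity>)"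
    using u u_nonneg by (rule nn_integral_eq_if_absolutely_integrable)
  moreover have "(\<integral>\<^sup>+ x \<in> \<theta> ` S. ennreal (v x) \<partial>lborel) =
      (if v absolutely_integrable_on (\<theta> ` S) then ennreal (integral (\<theta> ` S) v) else \<infinity>)"
    using v by (rule nn_integral_eq_if_absolutely_integrable)
  \<comment> \<open>With \<open>b\<close> chosen as the value on either side, the equivalence
    \<open>cov\<close> shows that both sides are integrable or neither is, and that the values
    agree.\<close>
  ultimately show ?thesis
    using cov[of "integral S ?w"] cov[of "integral (\<theta> ` S) v"] by auto
qed

section \<open>Finite covers by coordinate balls and their Borel partitions\<close>

lemma finite_Borel_partition:
  fixes U :: "'i \<Rightarrow> 'a::topological_space set"
  assumes "finite J" "\<And>j. j \<in> J \<Longrightarrow> U j \<in> sets borel"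
  shows "\<exists>D. (\<forall>j\<in>J. D j \<in> sets borel \<and> D j \<subseteq> U j) \<and> disjoint_family_on D J \<and> (\<Union>j\<in>J. D j) = (\<Union>j\<in>J. U j)"
  using assms
proof (induction J rule: finite_induct)
  case empty
  then show ?case by (simp add: disjoint_family_on_def)
next
  case (insert i J)
  then obtain D where D: "\<And>j. j \<in> J \<Longrightarrow> D j \<in> sets borel" "\<And>j. j \<in> J \<Longrightarrow> D j \<subseteq> U j"
    "disjoint_family_on D J" "(\<Union>j\<in>J. D j) = (\<Union>j\<in>J. U j)"
    by auto
  let ?D = "\<lambda>j. if j = i then U i - (\<Union>j\<in>J. U j) else D j"
  have eq: "?D j = D j" if "j \<in> J" for j
    using that insert.hyps by auto
  have "U i - (\<Union>j\<in>J. U j) \<in> sets borel"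
    using insert.prems insert.hyps by (intro sets.Diff sets.finite_UN) auto
  then have "\<forall>j\<in>insert i J. ?D j \<in> sets borel \<and> ?D j \<subseteq> U j"
    using D eq by auto
  moreover have "disjoint_family_on ?D (insert i J)"
    using D(3) D(2)[THEN subsetD] unfolding disjoint_family_on_def by (simp add: eq) blast
  moreover have "(\<Union>j\<in>insert i J. ?D j) = (\<Union>j\<in>insert i J. U j)"
  proof -
    have "(\<Union>j\<in>J. ?D j) = (\<Union>j\<in>J. D j)"
      using eq by (intro SUP_cong) auto
    then show ?thesis
      using D(4) by (simp add: UN_insert) blast
  qed
  ultimately show ?case
    by (intro exI[of _ ?D] conjI)
qed

definition coord_ball :: "('a, 'n::finite) chart \<times> (real^'n) \<times> real \<Rightarrow> 'a set" where
  "coord_ball = (\<lambda>(c, x, r). chart_inv c ` ball x r)"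

abbreviation coord_cball :: "('a, 'n::finite) chart \<times> (real^'n) \<times> real \<Rightarrow> (real^'n) set" where
  "coord_cball j \<equiv> cball (fst (snd j)) (snd (snd j))"

locale compact_manifold = smooth_manifold A
  for A :: "('a::{t2_space,second_countable_topology}, 'n::{finite,wellorder}) chart set" +
  assumes compact_UNIV: "compact (UNIV :: 'a set)"
begin

lemma coord_ball_eq:
  assumes "c \<in> A" "cball x r \<subseteq> chart_im c"
  shows "coord_ball (c, x, r) = chart_dom c \<inter> coord c -` ball x r"
proof (intro equalityI subsetI)
  fix p assume "p \<in> coord_ball (c, x, r)"
  then obtain y where y: "y \<in> ball x r" "p = chart_inv c y"
    by (auto simp: coord_ball_def)
  then have "y \<in> chart_im c"
    using assms(2) by (meson ball_subset_cball subsetD)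
  with y show "p \<in> chart_dom c \<inter> coord c -` ball x r"
    by (simp add: chart_inv_in[OF assms(1)] coord_chart_inv[OF assms(1)])
next
  fix p assume "p \<in> chart_dom c \<inter> coord c -` ball x r"
  then show "p \<in> coord_ball (c, x, r)"
    unfolding coord_ball_def using chart_inv_coord[OF assms(1), of p] by (auto intro!: rev_image_eqI[of "coord c p"])
qed

lemma open_coord_ball:
  assumes "c \<in> A" "cball x r \<subseteq> chart_im c"
  shows "open (coord_ball (c, x, r))"
  unfolding coord_ball_eq[OF assms]
  by (rule continuous_open_preimage[OF continuous_on_coord[OF assms(1)] open_chart_dom[OF assms(1)] open_ball])

text \<open>Asking for the closed balls inside the chart images provides compact coordinate sets on
  which continuous integrands are bounded, and later compact supports. Radii are unrestricted: an
  index with nonpositive radius contributes an empty ball.\<close>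

lemma finite_coord_ball_cover:
  "\<exists>J. finite J \<and> (\<forall>j\<in>J. fst j \<in> A \<and> coord_cball j \<subseteq> chart_im (fst j)) \<and> (\<Union>j\<in>J. coord_ball j) = UNIV"
proof -
  let ?J = "{j. fst j \<in> A \<and> coord_cball j \<subseteq> chart_im (fst j)}"
  have cov: "UNIV \<subseteq> (\<Union>j\<in>?J. coord_ball j)"
  proof
    fix p
    let ?c = "chart_at A p"
    have c: "?c \<in> A" "p \<in> chart_dom ?c"
      by (rule chart_at_mem)+
    then obtain r where r: "r > 0" "cball (coord ?c p) r \<subseteq> chart_im ?c"
      using open_chart_im[OF c(1)] unfolding open_contains_cball by blast
    have "p \<in> coord_ball (?c, coord ?c p, r)"
      using c r by (simp add: coord_ball_eq)
    with c r show "p \<in> (\<Union>j\<in>?J. coord_ball j)"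
      by (intro UN_I[of "(?c, coord ?c p, r)"]) auto
  qed
  have op: "open (coord_ball j)" if "j \<in> ?J" for j
    using that open_coord_ball[of "fst j" "fst (snd j)" "snd (snd j)"] by simp
  obtain J where J: "J \<subseteq> ?J" "finite J" "UNIV \<subseteq> (\<Union>j\<in>J. coord_ball j)"
    by (rule compactE_image[OF compact_UNIV op cov])
  have "\<forall>j\<in>J. fst j \<in> A \<and> coord_cball j \<subseteq> chart_im (fst j)"
    using J(1) by blast
  with J(2,3) show ?thesis
    by (intro exI[of _ J] conjI) (simp_all add: top.extremum_uniqueI)
qed

text \<open>Chosen once, from the atlas alone and before any metric appears. For a flow, the metrics
  of all times are therefore integrated over the same coordinate sets.\<close>

definition cover :: "(('a, 'n) chart \<times> (real, 'n) vec \<times> real) set" where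
  "cover = (SOME J. finite J \<and> (\<forall>j\<in>J. fst j \<in> A \<and> coord_cball j \<subseteq> chart_im (fst j)) \<and>
    (\<Union>j\<in>J. coord_ball j) = UNIV)"

lemma
  shows finite_cover: "finite cover"
    and cover_chart: "j \<in> cover \<Longrightarrow> fst j \<in> A"
    and cover_cball: "j \<in> cover \<Longrightarrow> coord_cball j \<subseteq> chart_im (fst j)"
    and cover_UNIV: "(\<Union>j\<in>cover. coord_ball j) = UNIV"
  using someI_ex[OF finite_coord_ball_cover] unfolding cover_def[symmetric] by blast+

lemma cover_ball_eq:
  "j \<in> cover \<Longrightarrow> coord_ball j = chart_dom (fst j) \<inter> coord (fst j) -` ball (fst (snd j)) (snd (snd j))"
  using coord_ball_eq[of "fst j" "fst (snd j)" "snd (snd j)"] cover_chart[of j] cover_cball[of j] by simp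

lemma cover_ball_open: "j \<in> cover \<Longrightarrow> open (coord_ball j)"
  using open_coord_ball[of "fst j" "fst (snd j)" "snd (snd j)"] cover_chart[of j] cover_cball[of j] by simp

text \<open>Disjoint cells, so that measures and integrals split into sums without weights. The
  smooth weights \<open>part\<close> are a separate device, for the argument that moves
  derivatives.\<close>

definition piece :: "('a, 'n) chart \<times> (real, 'n) vec \<times> real \<Rightarrow> 'a set" where
  "piece = (SOME D. (\<forall>j\<in>cover. D j \<in> sets borel \<and> D j \<subseteq> coord_ball j) \<and>
    disjoint_family_on D cover \<and> (\<Union>j\<in>cover. D j) = UNIV)"

lemma
  shows piece_borel: "j \<in> cover \<Longrightarrow> piece j \<in> sets borel"
    and piece_subset: "j \<in> cover \<Longrightarrow> piece j \<subseteq> coord_ball j"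
    and disjoint_pieces: "disjoint_family_on piece cover"
    and pieces_UNIV: "(\<Union>j\<in>cover. piece j) = UNIV"
proof -
  have "\<exists>D. (\<forall>j\<in>cover. D j \<in> sets borel \<and> D j \<subseteq> coord_ball j) \<and>
      disjoint_family_on D cover \<and> (\<Union>j\<in>cover. D j) = UNIV"
    unfolding cover_UNIV[symmetric]
    by (rule finite_Borel_partition[OF finite_cover borel_open[OF cover_ball_open]])
  note * = someI_ex[OF this, folded piece_def]
  show "j \<in> cover \<Longrightarrow> piece j \<in> sets borel" "j \<in> cover \<Longrightarrow> piece j \<subseteq> coord_ball j"
    "disjoint_family_on piece cover" "(\<Union>j\<in>cover. piece j) = UNIV"
    using * by blast+
qed

lemma piece_subset_dom: "j \<in> cover \<Longrightarrow> piece j \<subseteq> chart_dom (fst j)"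
  using piece_subset[of j] cover_ball_eq[of j] by blast

definition coord_piece :: "('a, 'n) chart \<times> (real, 'n) vec \<times> real \<Rightarrow> (real, 'n) vec set" where
  "coord_piece j = coord (fst j) ` piece j"

lemma
  assumes "j \<in> cover"
  shows coord_piece_borel: "coord_piece j \<in> sets borel"
    and coord_piece_subset: "coord_piece j \<subseteq> coord_cball j"
proof -
  show "coord_piece j \<in> sets borel"
    unfolding coord_piece_def
    by (intro coord_image_measurable cover_chart piece_subset_dom piece_borel assms)
  have "coord_piece j \<subseteq> ball (fst (snd j)) (snd (snd j))"
    unfolding coord_piece_def using piece_subset[OF assms] unfolding cover_ball_eq[OF assms] by blast
  then show "coord_piece j \<subseteq> coord_cball j"
    using ball_subset_cball by blast
qed

end

section \<open>Existence and uniqueness of the Riemannian volume measure\<close>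

locale riemannian_manifold = smooth_manifold A
  for A :: "('a::{t2_space,second_countable_topology}, 'n::{finite,wellorder}) chart set" +
  fixes g :: "('a, 'n) tensor2"
  assumes tensor: "tensor2_field A g"
    and pos_def: "pos_def_tensor2 A g"
    and continuous_on_metric: "c \<in> A \<Longrightarrow> continuous_on (chart_im c) (g c)"
begin

abbreviation dens :: "('a, 'n) chart \<Rightarrow> real^_ \<Rightarrow> real" where
  "dens c x \<equiv> sqrt (det (g c x))"

lemma det_metric_pos: "c \<in> A \<Longrightarrow> x \<in> chart_im c \<Longrightarrow> det (g c x) > 0"
  using pos_def unfolding pos_def_tensor2_def by (intro pos_def_imp_det_pos) blast

lemma continuous_on_dens: "c \<in> A \<Longrightarrow> continuous_on (chart_im c) (dens c)"
  by (intro continuous_on_real_sqrt continuous_on_det continuous_on_component continuous_on_metric)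

lemma metric_transform:
  assumes "c \<in> A" "d \<in> A" "p \<in> chart_dom c \<inter> chart_dom d"
  shows "g c (coord c p) = transpose (jacobian c d (coord c p)) ** g d (coord d p) ** jacobian c d (coord c p)"
  using tensor assms unfolding tensor2_field_def Let_def by blast

lemma dens_transform:
  assumes "c \<in> A" "d \<in> A" "p \<in> chart_dom c \<inter> chart_dom d"
  shows "dens c (coord c p) = \<bar>det (jacobian c d (coord c p))\<bar> * dens d (coord d p)"
  by (simp add: metric_transform[OF assms] det_mul det_transpose real_sqrt_mult)

lemma indicator_dens_measurable:
  assumes "c \<in> A" "S \<in> sets borel" "S \<subseteq> chart_im c"
  shows "(\<lambda>x. indicator S x *\<^sub>R dens c x) \<in> borel_measurable borel"
  using continuous_on_subset[OF continuous_on_dens[OF assms(1)] assms(3)]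
  by (rule borel_measurable_continuous_on_indicator[OF assms(2)])

text \<open>The consistency condition for gluing. The transition map is C1 and injective on the
  overlap, and its Jacobian factor is exactly the one by which \<open>dens\<close>
  transforms.\<close>

lemma nn_integral_dens_overlap:
  assumes c: "c \<in> A" and d: "d \<in> A" and B: "B \<in> sets borel" "B \<subseteq> chart_dom c \<inter> chart_dom d"
  shows "(\<integral>\<^sup>+ x \<in> coord c ` B. ennreal (dens c x) \<partial>lborel) = (\<integral>\<^sup>+ x \<in> coord d ` B. ennreal (dens d x) \<partial>lborel)"
proof -
  let ?\<theta> = "coord d \<circ> chart_inv c"
  have image: "?\<theta> ` coord c ` B = coord d ` B"
    using B(2) c by (force simp: image_comp chart_inv_coord intro!: image_cong)
  have meas: "coord c ` B \<in> sets borel" "coord d ` B \<in> sets borel"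
    using B c d by (auto intro!: coord_image_measurable)
  have "(\<integral>\<^sup>+ x \<in> coord c ` B. ennreal (dens c x) \<partial>lborel) = (\<integral>\<^sup>+ x \<in> ?\<theta> ` coord c ` B. ennreal (dens d x) \<partial>lborel)"
  proof (rule nn_integral_change_of_variables[where \<theta>' = "\<lambda>x. frechet_derivative ?\<theta> (at x)"])
    show "coord c ` B \<in> sets borel" by (rule meas)
    show "(?\<theta> has_derivative frechet_derivative ?\<theta> (at x)) (at x)" if "x \<in> coord c ` B" for x
      using that B(2) by (intro Ck_on_Suc_has_derivative[OF Ck_on_transition[OF c d, of "Suc 0"]]) auto
    show "inj_on ?\<theta> (coord c ` B)"
    proof (rule inj_onI)
      fix x y assume "x \<in> coord c ` B" "y \<in> coord c ` B" and eq: "?\<theta> x = ?\<theta> y"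
      then obtain p q where pq: "p \<in> B" "x = coord c p" "q \<in> B" "y = coord c q" by blast
      with eq B(2) c have "coord d p = coord d q"
        by (simp add: chart_inv_coord subset_iff)
      then have "p = q"
        using pq B(2) chart_inv_coord[OF d] by (metis IntD2 subsetD)
      with pq show "x = y" by simp
    qed
    show "(\<lambda>x. indicator (coord c ` B) x *\<^sub>R dens c x) \<in> borel_measurable borel"
      using B(2) by (intro indicator_dens_measurable c meas) auto
    show "(\<lambda>x. indicator (?\<theta> ` coord c ` B) x *\<^sub>R dens d x) \<in> borel_measurable borel"
      unfolding image using B(2) by (intro indicator_dens_measurable d meas) auto
    show "dens d y \<ge> 0" if "y \<in> ?\<theta> ` coord c ` B" for y
      using that B(2) det_metric_pos[OF d] unfolding image by (intro real_sqrt_ge_zero) force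
    show "dens c x = \<bar>det (jacobian c d x)\<bar> * dens d (?\<theta> x)" if "x \<in> coord c ` B" for x
      using that dens_transform[OF c d] B(2) c by (auto simp: chart_inv_coord subset_iff)
  qed
  then show ?thesis
    unfolding image .
qed

text \<open>The push-forward of the weighted Lebesgue measure to the manifold.
  \<open>chart_ext\<close> sends all points off \<open>chart_im c\<close> to
  \<open>undefined\<close>; the indicator makes sure that they carry no mass.\<close>

definition chart_measure :: "('a, 'n) chart \<Rightarrow> 'a measure" where
  "chart_measure c =
    distr (density lborel (\<lambda>x. ennreal (indicator (chart_im c) x *\<^sub>R dens c x))) borel (chart_ext c)"

lemma sets_chart_measure: "sets (chart_measure c) = sets borel"
  by (simp add: chart_measure_def)

lemma emeasure_chart_measure:
  assumes "c \<in> A" "B \<in> sets borel"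
  shows "emeasure (chart_measure c) B = (\<integral>\<^sup>+ x \<in> coord c ` (B \<inter> chart_dom c). ennreal (dens c x) \<partial>lborel)"
proof -
  have [measurable]: "chart_ext c \<in> borel_measurable borel"
    by (rule chart_ext_measurable[OF assms(1)])
  have "chart_im c \<in> sets borel"
    using open_chart_im[OF assms(1)] by simp
  then have [measurable]: "(\<lambda>x. indicator (chart_im c) x *\<^sub>R dens c x) \<in> borel_measurable borel"
    by (intro indicator_dens_measurable assms(1)) auto
  have eq: "coord c ` (B \<inter> chart_dom c) = chart_im c \<inter> chart_ext c -` B"
    unfolding coord_image_eq[OF assms(1) Int_lower2]
    using chart_inv_in[OF assms(1)] by (auto simp: chart_ext_def)
  have vimage: "chart_ext c -` B \<in> sets lborel"
    using measurable_sets[OF chart_ext_measurable[OF assms(1)] assms(2)] by simp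
  have "emeasure (chart_measure c) B = emeasure (density lborel (\<lambda>x. ennreal (indicator (chart_im c) x *\<^sub>R dens c x))) (chart_ext c -` B)"
    unfolding chart_measure_def using assms(2) by (subst emeasure_distr) auto
  also have "\<dots> = (\<integral>\<^sup>+ x. ennreal (indicator (chart_im c) x *\<^sub>R dens c x) * indicator (chart_ext c -` B) x \<partial>lborel)"
    using vimage by (intro emeasure_density) (simp_all del: real_scaleR_def)
  also have "\<dots> = (\<integral>\<^sup>+ x \<in> coord c ` (B \<inter> chart_dom c). ennreal (dens c x) \<partial>lborel)"
    unfolding eq by (intro nn_integral_cong) (simp add: indicator_def)
  finally show ?thesis .
qed

end

locale compact_riemannian_manifold = compact_manifold A + riemannian_manifold A g
  for A :: "('a::{t2_space,second_countable_topology}, 'n::{finite,wellorder}) chart set"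
    and g :: "('a, 'n) tensor2"
begin

text \<open>The witness for the description in \<open>vol_measure\<close>: each cell of the
  partition is measured in the chart to which it belongs.\<close>

definition glued_measure :: "'a measure" where
  "glued_measure = measure_of UNIV (sets borel)
    (\<lambda>B. \<Sum>j\<in>cover. emeasure (chart_measure (fst j)) (B \<inter> piece j))"

lemma sets_glued_measure: "sets glued_measure = sets borel"
  using sets.sigma_sets_eq[of borel] by (simp add: glued_measure_def)

lemma emeasure_glued_measure:
  assumes "B \<in> sets borel"
  shows "emeasure glued_measure B = (\<Sum>j\<in>cover. emeasure (chart_measure (fst j)) (B \<inter> piece j))"
  unfolding glued_measure_def
proof (rule emeasure_measure_of_sigma[OF _ _ _ assms])
  show "sigma_algebra UNIV (sets borel)"
    using sets.sigma_algebra_axioms[of borel] by simp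
  show "positive (sets borel) (\<lambda>B. \<Sum>j\<in>cover. emeasure (chart_measure (fst j)) (B \<inter> piece j))"
    by (simp add: positive_def)
  show "countably_additive (sets borel) (\<lambda>B. \<Sum>j\<in>cover. emeasure (chart_measure (fst j)) (B \<inter> piece j))"
  proof (rule countably_additiveI)
    fix F :: "nat \<Rightarrow> 'a set" assume F: "range F \<subseteq> sets borel" "disjoint_family F"
    have "(\<Sum>i. emeasure (chart_measure (fst j)) (F i \<inter> piece j)) =
        emeasure (chart_measure (fst j)) ((\<Union>i. F i) \<inter> piece j)" if "j \<in> cover" for j
    proof -
      have "range (\<lambda>i. F i \<inter> piece j) \<subseteq> sets (chart_measure (fst j))"
        unfolding sets_chart_measure using F(1) piece_borel[OF that] by (auto intro!: sets.Int)
      moreover have "disjoint_family (\<lambda>i. F i \<inter> piece j)"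
        using F(2) unfolding disjoint_family_on_def by blast
      ultimately have "(\<Sum>i. emeasure (chart_measure (fst j)) (F i \<inter> piece j)) =
          emeasure (chart_measure (fst j)) (\<Union>i. F i \<inter> piece j)"
        by (rule suminf_emeasure)
      then show ?thesis by simp
    qed
    then show "(\<Sum>i. \<Sum>j\<in>cover. emeasure (chart_measure (fst j)) (F i \<inter> piece j)) =
        (\<Sum>j\<in>cover. emeasure (chart_measure (fst j)) ((\<Union>i. F i) \<inter> piece j))"
      by (subst suminf_sum) (auto intro: summableI)
  qed
qed

abbreviation vol_property :: "'a measure \<Rightarrow> bool" where
  "vol_property \<mu> \<equiv> sets \<mu> = sets borel \<and>
    (\<forall>c\<in>A. \<forall>B\<in>sets borel. B \<subseteq> chart_dom c \<longrightarrow>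
      emeasure \<mu> B = (\<integral>\<^sup>+ x \<in> coord c ` B. ennreal (dens c x) \<partial>lborel))"

lemma emeasure_split_pieces:
  assumes "sets \<mu> = sets borel" "B \<in> sets borel"
  shows "emeasure \<mu> B = (\<Sum>j\<in>cover. emeasure \<mu> (B \<inter> piece j))"
proof -
  have "(\<Sum>j\<in>cover. emeasure \<mu> (B \<inter> piece j)) = emeasure \<mu> (\<Union>j\<in>cover. B \<inter> piece j)"
  proof (rule sum_emeasure)
    show "disjoint_family_on (\<lambda>j. B \<inter> piece j) cover"
      using disjoint_pieces unfolding disjoint_family_on_def by blast
    show "(\<lambda>j. B \<inter> piece j) ` cover \<subseteq> sets \<mu>"
      using piece_borel assms by (auto intro!: sets.Int)
  qed (rule finite_cover)
  also have "(\<Union>j\<in>cover. B \<inter> piece j) = B"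
    using pieces_UNIV by blast
  finally show ?thesis by simp
qed

text \<open>For \<open>B\<close> inside the chart \<open>c\<close>, every
  \<open>B \<inter> piece j\<close> lies in the overlap of \<open>c\<close> with the chart of
  \<open>j\<close>. It can thus be measured in \<open>c\<close>, after which the cells add up
  again.\<close>

lemma vol_property_glued_measure: "vol_property glued_measure"
proof (intro conjI ballI impI sets_glued_measure)
  fix c B assume c: "c \<in> A" and B: "B \<in> sets borel" "B \<subseteq> chart_dom c"
  have "emeasure (chart_measure (fst j)) (B \<inter> piece j) = emeasure (chart_measure c) (B \<inter> piece j)"
    if j: "j \<in> cover" for j
  proof -
    have meas: "B \<inter> piece j \<in> sets borel"
      using B(1) piece_borel[OF j] by (rule sets.Int)
    have eq: "B \<inter> piece j \<inter> chart_dom (fst j) = B \<inter> piece j" "B \<inter> piece j \<inter> chart_dom c = B \<inter> piece j"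
      using B(2) piece_subset_dom[OF j] by blast+
    show ?thesis
      unfolding emeasure_chart_measure[OF cover_chart[OF j] meas] emeasure_chart_measure[OF c meas] eq
      using B(2) piece_subset_dom[OF j] by (intro nn_integral_dens_overlap cover_chart[OF j] c meas) blast
  qed
  then have "emeasure glued_measure B = (\<Sum>j\<in>cover. emeasure (chart_measure c) (B \<inter> piece j))"
    by (simp add: emeasure_glued_measure[OF B(1)])
  also have "\<dots> = emeasure (chart_measure c) B"
    by (rule emeasure_split_pieces[OF sets_chart_measure B(1), symmetric])
  also have "\<dots> = (\<integral>\<^sup>+ x \<in> coord c ` B. ennreal (dens c x) \<partial>lborel)"
    using B(2) by (simp add: emeasure_chart_measure[OF c B(1)] Int_absorb2)
  finally show "emeasure glued_measure B = (\<integral>\<^sup>+ x \<in> coord c ` B. ennreal (dens c x) \<partial>lborel)" .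
qed

text \<open>Each \<open>B \<inter> piece j\<close> lies in a single chart domain, where the property
  prescribes its measure; finitely many such parts determine that of \<open>B\<close>.\<close>

lemma vol_property_unique:
  assumes "vol_property \<mu>" "vol_property \<nu>"
  shows "\<mu> = \<nu>"
proof (rule measure_eqI)
  show "sets \<mu> = sets \<nu>" using assms by simp
  fix B assume "B \<in> sets \<mu>"
  with assms have B: "B \<in> sets borel" by simp
  have "emeasure \<mu> (B \<inter> piece j) = emeasure \<nu> (B \<inter> piece j)" if j: "j \<in> cover" for j
  proof -
    have "B \<inter> piece j \<in> sets borel" "B \<inter> piece j \<subseteq> chart_dom (fst j)"
      using B piece_borel[OF j] piece_subset_dom[OF j] by auto
    then have "emeasure \<rho> (B \<inter> piece j) =
        (\<integral>\<^sup>+ x \<in> coord (fst j) ` (B \<inter> piece j). ennreal (dens (fst j) x) \<partial>lborel)"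
      if "vol_property \<rho>" for \<rho>
      using that cover_chart[OF j] by blast
    from this[OF assms(1)] this[OF assms(2)] show ?thesis by simp
  qed
  then show "emeasure \<mu> B = emeasure \<nu> B"
    using emeasure_split_pieces[OF _ B, of \<mu>] emeasure_split_pieces[OF _ B, of \<nu>] assms by simp
qed

lemma vol_property_vol_measure: "vol_property (vol_measure A g)"
proof -
  have "\<exists>!\<mu>. vol_property \<mu>"
    by (rule ex1I[where a = glued_measure], rule vol_property_glued_measure,
        rule vol_property_unique[OF _ vol_property_glued_measure])
  then show ?thesis
    unfolding vol_measure_def by (rule theI')
qed

section \<open>Integration against the volume measure in charts\<close>

lemma sets_vol_measure: "sets (vol_measure A g) = sets borel"
  using vol_property_vol_measure by blast

text \<open>Writes the volume measure restricted to a chart as a push-forward of a density, so that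
  Bochner integrals over it follow from the general rules for densities and push-forwards.\<close>

lemma density_vol_measure:
  assumes "c \<in> A"
  shows "density (vol_measure A g) (\<lambda>p. ennreal (indicator (chart_dom c) p)) = chart_measure c"
proof (rule measure_eqI)
  show "sets (density (vol_measure A g) (\<lambda>p. ennreal (indicator (chart_dom c) p))) = sets (chart_measure c)"
    by (simp add: sets_vol_measure sets_chart_measure)
  fix B assume "B \<in> sets (density (vol_measure A g) (\<lambda>p. ennreal (indicator (chart_dom c) p)))"
  then have B: "B \<in> sets borel"
    by (simp add: sets_vol_measure)
  have dom: "chart_dom c \<in> sets borel"
    using open_chart_dom[OF assms] by simp
  then have "(\<lambda>p. ennreal (indicator (chart_dom c) p)) \<in> borel_measurable (vol_measure A g)"
    using sets_vol_measure by (intro measurable_compose[OF borel_measurable_indicator measurable_ennreal]) simp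
  then have "emeasure (density (vol_measure A g) (\<lambda>p. ennreal (indicator (chart_dom c) p))) B =
      (\<integral>\<^sup>+ p. ennreal (indicator (chart_dom c) p) * indicator B p \<partial>vol_measure A g)"
    using B by (intro emeasure_density) (simp_all add: sets_vol_measure)
  also have "\<dots> = (\<integral>\<^sup>+ p. indicator (B \<inter> chart_dom c) p \<partial>vol_measure A g)"
    by (intro nn_integral_cong) (auto simp: indicator_def)
  also have "\<dots> = emeasure (vol_measure A g) (B \<inter> chart_dom c)"
    using B dom by (intro nn_integral_indicator) (simp add: sets_vol_measure)
  also have "\<dots> = emeasure (chart_measure c) B"
    using vol_property_vol_measure assms B dom by (simp add: emeasure_chart_measure)
  finally show "emeasure (density (vol_measure A g) (\<lambda>p. ennreal (indicator (chart_dom c) p))) B = emeasure (chart_measure c) B" .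
qed

lemma
  fixes f :: "'a \<Rightarrow> real"
  assumes c: "c \<in> A" and E: "E \<in> sets borel" "E \<subseteq> chart_dom c" and f: "f \<in> borel_measurable borel"
  shows set_integrable_vol_measure: "set_integrable (vol_measure A g) E f \<longleftrightarrow>
      set_integrable lborel (coord c ` E) (\<lambda>x. f (chart_inv c x) * dens c x)" (is ?integrable)
    and set_integral_vol_measure: "(LINT p:E|vol_measure A g. f p) =
      (LINT x:coord c ` E|lborel. f (chart_inv c x) * dens c x)" (is ?integral)
proof -
  let ?V = "vol_measure A g"
  let ?F = "\<lambda>p. indicator E p *\<^sub>R f p"
  have dom: "chart_dom c \<in> sets borel"
    using open_chart_dom[OF c] by simp
  have F: "?F \<in> borel_measurable borel"
    using E(1) f by measurable
  have F_V: "?F \<in> borel_measurable ?V" "(indicator (chart_dom c) :: 'a \<Rightarrow> real) \<in> borel_measurable ?V"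
    using F dom sets_vol_measure by (auto cong: measurable_cong_sets)
  have nn: "AE p in ?V. 0 \<le> (indicator (chart_dom c) p :: real)"
    by simp
  have eq1: "(\<lambda>p. indicator (chart_dom c) p *\<^sub>R ?F p) = ?F"
    using E(2) by (auto simp: fun_eq_iff indicator_def)
  have w: "(\<lambda>x. indicator (chart_im c) x *\<^sub>R dens c x) \<in> borel_measurable lborel"
    using indicator_dens_measurable[OF c, of "chart_im c"] open_chart_im[OF c] by simp
  have w_nonneg: "AE x in lborel. 0 \<le> indicator (chart_im c) x *\<^sub>R dens c x"
    using det_metric_pos[OF c] by (intro AE_I2) (auto simp: indicator_def intro!: real_sqrt_ge_zero less_imp_le)
  have ext: "chart_ext c \<in> measurable (density lborel (\<lambda>x. ennreal (indicator (chart_im c) x *\<^sub>R dens c x))) borel"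
    using chart_ext_measurable[OF c] by (simp cong: measurable_cong_sets)
  have Fext: "(\<lambda>x. ?F (chart_ext c x)) \<in> borel_measurable lborel"
    using measurable_compose[OF chart_ext_measurable[OF c] F] by simp
  have eq2: "(\<lambda>x. (indicator (chart_im c) x *\<^sub>R dens c x) *\<^sub>R ?F (chart_ext c x)) =
      (\<lambda>x. indicator (coord c ` E) x *\<^sub>R (f (chart_inv c x) * dens c x))"
    unfolding coord_image_eq[OF c E(2)] by (auto simp: fun_eq_iff indicator_def chart_ext_def)
  have "integrable ?V ?F \<longleftrightarrow> integrable (chart_measure c) ?F"
    unfolding density_vol_measure[OF c, symmetric]
    by (simp only: integrable_density[OF F_V nn] eq1)
  also have "\<dots> \<longleftrightarrow> integrable lborel (\<lambda>x. (indicator (chart_im c) x *\<^sub>R dens c x) *\<^sub>R ?F (chart_ext c x))"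
    unfolding chart_measure_def integrable_distr_eq[OF ext F] by (rule integrable_density[OF Fext w w_nonneg])
  finally show ?integrable
    unfolding set_integrable_def eq2 .
  have "integral\<^sup>L ?V ?F = integral\<^sup>L (chart_measure c) ?F"
    unfolding density_vol_measure[OF c, symmetric]
    by (simp only: integral_density[OF F_V nn] eq1)
  also have "\<dots> = (LINT x|lborel. (indicator (chart_im c) x *\<^sub>R dens c x) *\<^sub>R ?F (chart_ext c x))"
    unfolding chart_measure_def integral_distr[OF ext F] by (rule integral_density[OF Fext w w_nonneg])
  finally show ?integral
    unfolding set_lebesgue_integral_def eq2 .
qed

lemma continuous_on_chart_integrand:
  assumes "continuous_on UNIV f" "c \<in> A" "K \<subseteq> chart_im c"
  shows "continuous_on K (\<lambda>x. f (chart_inv c x) * dens c x)"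
proof -
  have "continuous_on (chart_im c) (\<lambda>x. f (chart_inv c x) * dens c x)"
    using continuous_on_compose2[OF assms(1) continuous_on_chart_inv[OF assms(2)]] continuous_on_dens[OF assms(2)]
    by (intro continuous_on_mult) auto
  then show ?thesis
    by (rule continuous_on_subset[OF _ assms(3)])
qed

lemma set_integrable_piece:
  assumes f: "continuous_on UNIV (f :: 'a \<Rightarrow> real)" and j: "j \<in> cover"
  shows "set_integrable (vol_measure A g) (piece j) f"
  unfolding set_integrable_vol_measure[OF cover_chart[OF j] piece_borel[OF j] piece_subset_dom[OF j]
      borel_measurable_continuous_onI[OF f]] coord_piece_def[symmetric]
  by (rule set_integrable_continuous_on_compact[OF compact_cball
        continuous_on_chart_integrand[OF f cover_chart[OF j] cover_cball[OF j]]
        coord_piece_borel[OF j] coord_piece_subset[OF j]])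

text \<open>Each piece carries a Lebesgue integral over a Borel subset of a closed ball on which the
  integrand is continuous; this yields both integrability and the finite sum.\<close>

lemma
  assumes f: "continuous_on UNIV (f :: 'a \<Rightarrow> real)"
  shows integrable_vol_measure_continuous: "integrable (vol_measure A g) f"
    and integral_vol_measure_pieces: "integral\<^sup>L (vol_measure A g) f =
      (\<Sum>j\<in>cover. LINT x:coord_piece j|lborel. f (chart_inv (fst j) x) * dens (fst j) x)"
proof -
  let ?V = "vol_measure A g"
  have sum: "(\<Sum>j\<in>cover. indicator (piece j) p *\<^sub>R f p) = f p" for p
  proof -
    obtain i where i: "i \<in> cover" "p \<in> piece i"
      using pieces_UNIV by blast
    then have "(\<Sum>j\<in>cover. indicator (piece j) p *\<^sub>R f p) = (\<Sum>j\<in>cover. if j = i then f p else 0)"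
      using disjoint_pieces by (intro sum.cong) (auto simp: indicator_def disjoint_family_on_def)
    then show ?thesis
      using i finite_cover by simp
  qed
  have int: "integrable ?V (\<lambda>p. indicator (piece j) p *\<^sub>R f p)" if "j \<in> cover" for j
    using set_integrable_piece[OF f that] by (simp add: set_integrable_def)
  have "integrable ?V (\<lambda>p. \<Sum>j\<in>cover. indicator (piece j) p *\<^sub>R f p)"
    by (intro Bochner_Integration.integrable_sum int)
  then show "integrable ?V f"
    unfolding sum .
  have "integral\<^sup>L ?V f = (LINT p|?V. (\<Sum>j\<in>cover. indicator (piece j) p *\<^sub>R f p))"
    unfolding sum ..
  also have "\<dots> = (\<Sum>j\<in>cover. LINT p|?V. indicator (piece j) p *\<^sub>R f p)"
    by (intro Bochner_Integration.integral_sum int)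
  also have "\<dots> = (\<Sum>j\<in>cover. LINT x:coord_piece j|lborel. f (chart_inv (fst j) x) * dens (fst j) x)"
    using set_integral_vol_measure[OF cover_chart piece_borel piece_subset_dom borel_measurable_continuous_onI[OF f]]
    by (intro sum.cong) (simp_all add: set_lebesgue_integral_def coord_piece_def)
  finally show "integral\<^sup>L ?V f = (\<Sum>j\<in>cover. LINT x:coord_piece j|lborel. f (chart_inv (fst j) x) * dens (fst j) x)" .
qed

text \<open>Makes \<open>vol\<close> meaningful, because \<open>measure\<close> returns 0 on sets of
  infinite measure.\<close>

lemma emeasure_vol_measure_finite: "emeasure (vol_measure A g) UNIV < \<infinity>"
proof -
  have space: "space (vol_measure A g) = UNIV"
    using sets_eq_imp_space_eq[OF sets_vol_measure] by simp
  have "integrable (vol_measure A g) (\<lambda>_. 1 :: real)"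
    by (rule integrable_vol_measure_continuous) simp
  then show ?thesis
    unfolding integrable_iff_bounded by (simp add: space)
qed

lemma vol_eq_integral: "vol A g = (LINT p|vol_measure A g. 1)"
  using sets_eq_imp_space_eq[OF sets_vol_measure] by (simp add: vol_def)

end

section \<open>The divergence theorem\<close>

definition grad_dot :: "(real^'n \<Rightarrow> real^'n^'n::finite) \<Rightarrow> (real^'n \<Rightarrow> real) \<Rightarrow> (real^'n \<Rightarrow> real) \<Rightarrow> real^'n \<Rightarrow> real" where
  "grad_dot G u v x = (\<Sum>i\<in>UNIV. \<Sum>j\<in>UNIV. ginv G x $ i $ j * pd i u x * pd j v x)"

definition laplacian :: "(real^'n \<Rightarrow> real^'n^'n::finite) \<Rightarrow> (real^'n \<Rightarrow> real) \<Rightarrow> real^'n \<Rightarrow> real" where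
  "laplacian G v = trace_wrt G (\<lambda>x. \<chi> i j. hessian G v i j x)"

text \<open>The gradient of \<open>v\<close> weighted by the volume density; its plain coordinate
  divergence is \<open>sqrt (det G)\<close> times the Laplacian.\<close>

definition flux :: "(real^'n \<Rightarrow> real^'n^'n::finite) \<Rightarrow> (real^'n \<Rightarrow> real) \<Rightarrow> 'n \<Rightarrow> real^'n \<Rightarrow> real" where
  "flux G v i x = sqrt (det (G x)) * (\<Sum>j\<in>UNIV. ginv G x $ i $ j * pd j v x)"

lemma C1_on_flux:
  assumes S: "open S" and G: "\<And>i j. Ck_on (Suc 0) (\<lambda>y. G y $ i $ j) S"
    and pos: "\<And>y. y \<in> S \<Longrightarrow> det (G y) > 0" and v: "Ck_on (Suc (Suc 0)) v S"
  shows "Ck_on (Suc 0) (flux G v i) S"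
proof -
  have nz: "det (G y) \<noteq> 0" if "y \<in> S" for y
    using pos[OF that] by simp
  show ?thesis
    unfolding flux_def[abs_def]
    by (intro C1_on_mult C1_on_sqrt C1_on_det C1_on_sum C1_on_matrix_inv S G pos nz Ck_on_pd v)
qed

text \<open>With summation over \<open>i\<close>, the right-hand side is minus the
  \<open>i\<close>-th partial derivative of \<open>sqrt (det G) * ginv G $ i $ k\<close>, divided by
  \<open>sqrt (det G)\<close>, the derivatives of the determinant and of the inverse being
  expanded.\<close>

lemma christoffel_contraction:
  assumes I: "\<And>i j. ginv G x $ i $ j = ginv G x $ j $ i"
    and D: "\<And>l i j. pd l (\<lambda>y. G y $ i $ j) x = pd l (\<lambda>y. G y $ j $ i) x"
  shows "(\<Sum>i\<in>UNIV. \<Sum>j\<in>UNIV. ginv G x $ i $ j * christoffel G k i j x) =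
    (\<Sum>i\<in>UNIV. (ginv G x ** (\<chi> a b. pd i (\<lambda>y. G y $ a $ b) x) ** ginv G x) $ i $ k)
    - (\<Sum>i\<in>UNIV. trace (ginv G x ** (\<chi> a b. pd i (\<lambda>y. G y $ a $ b) x)) * ginv G x $ i $ k) / 2"
proof -
  let ?I = "\<lambda>i j. ginv G x $ i $ j" and ?D = "\<lambda>l i j. pd l (\<lambda>y. G y $ i $ j) x"
  \<comment> \<open>Of the three terms in a Christoffel symbol, the first two have the same
    contraction \<open>T1\<close> by symmetry in \<open>i\<close> and \<open>j\<close>; the third
    one gives \<open>T3\<close>.\<close>
  define T1 where "T1 = (\<Sum>i\<in>UNIV. \<Sum>j\<in>UNIV. \<Sum>l\<in>UNIV. ?I i j * ?I k l * ?D i j l)"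
  define T3 where "T3 = (\<Sum>i\<in>UNIV. \<Sum>j\<in>UNIV. \<Sum>l\<in>UNIV. ?I i j * ?I k l * ?D l i j)"
  have T2: "(\<Sum>i\<in>UNIV. \<Sum>j\<in>UNIV. \<Sum>l\<in>UNIV. ?I i j * ?I k l * ?D j i l) = T1"
    unfolding T1_def by (subst sum.swap) (simp add: I[of _ _])
  have "(\<Sum>i\<in>UNIV. \<Sum>j\<in>UNIV. ?I i j * christoffel G k i j x) =
      (\<Sum>i\<in>UNIV. \<Sum>j\<in>UNIV. \<Sum>l\<in>UNIV. ?I i j * ?I k l * ?D i j l + ?I i j * ?I k l * ?D j i l - ?I i j * ?I k l * ?D l i j) / 2"
    unfolding christoffel_def by (simp add: sum_distrib_left sum_divide_distrib algebra_simps)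
  also have "\<dots> = (T1 + T1 - T3) / 2"
    unfolding sum.distrib sum_subtractf T2 T1_def[symmetric] T3_def[symmetric] ..
  also have "\<dots> = T1 - T3 / 2" by simp
  also have "T1 = (\<Sum>i\<in>UNIV. (ginv G x ** (\<chi> a b. pd i (\<lambda>y. G y $ a $ b) x) ** ginv G x) $ i $ k)"
    unfolding T1_def
  proof (rule sum.cong[OF refl])
    fix i
    have "(\<Sum>j\<in>UNIV. \<Sum>l\<in>UNIV. ?I i j * ?I k l * ?D i j l) = (\<Sum>l\<in>UNIV. \<Sum>j\<in>UNIV. ?I i j * ?I l k * ?D i j l)"
      unfolding I[of k] by (rule sum.swap)
    then show "(\<Sum>j\<in>UNIV. \<Sum>l\<in>UNIV. ?I i j * ?I k l * ?D i j l) =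
        (ginv G x ** (\<chi> a b. pd i (\<lambda>y. G y $ a $ b) x) ** ginv G x) $ i $ k"
      by (simp add: matrix_matrix_mult_def sum_distrib_right sum_distrib_left mult_ac)
  qed
  also have "T3 = (\<Sum>i\<in>UNIV. trace (ginv G x ** (\<chi> a b. pd i (\<lambda>y. G y $ a $ b) x)) * ginv G x $ i $ k)"
  proof -
    have "T3 = (\<Sum>i\<in>UNIV. \<Sum>l\<in>UNIV. \<Sum>j\<in>UNIV. ?I i j * ?I k l * ?D l i j)"
      unfolding T3_def by (rule sum.cong[OF refl], rule sum.swap)
    also have "\<dots> = (\<Sum>l\<in>UNIV. \<Sum>i\<in>UNIV. \<Sum>j\<in>UNIV. ?I i j * ?I k l * ?D l i j)"
      by (rule sum.swap)
    also have "\<dots> = (\<Sum>l\<in>UNIV. \<Sum>i\<in>UNIV. \<Sum>j\<in>UNIV. ?I i j * ?D l j i * ?I l k)"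
      by (intro sum.cong refl) (simp add: I[of k] D[of _ _ i for i] mult_ac)
    finally show ?thesis
      by (simp add: trace_def matrix_matrix_mult_def sum_distrib_right)
  qed
  finally show ?thesis .
qed

text \<open>Bookkeeping for \<open>divergence_flux\<close>, with \<open>B\<close> the inverse
  metric, \<open>t\<close> the traces, \<open>M\<close> the sandwiched derivatives of the metric and
  \<open>w\<close> the partial derivatives of \<open>v\<close>: the bracket takes the shape found in
  \<open>christoffel_contraction\<close>.\<close>

lemma sum_regroup:
  fixes t w :: "'n::finite \<Rightarrow> real"
  shows "(\<Sum>i\<in>UNIV. \<Sum>j\<in>UNIV. t i / 2 * (B i j * w j)) - (\<Sum>i\<in>UNIV. \<Sum>j\<in>UNIV. M i j * w j) =
    - (\<Sum>k\<in>UNIV. ((\<Sum>i\<in>UNIV. M i k) - (\<Sum>i\<in>UNIV. t i * B i k) / 2) * w k)"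
proof -
  have "(\<Sum>i\<in>UNIV. \<Sum>j\<in>UNIV. t i / 2 * (B i j * w j)) = (\<Sum>k\<in>UNIV. \<Sum>i\<in>UNIV. t i / 2 * (B i k * w k))"
    by (rule sum.swap)
  also have "\<dots> = (\<Sum>k\<in>UNIV. (\<Sum>i\<in>UNIV. t i * B i k) / 2 * w k)"
    unfolding sum_divide_distrib sum_distrib_right by (intro sum.cong refl) simp
  finally have 1: "(\<Sum>i\<in>UNIV. \<Sum>j\<in>UNIV. t i / 2 * (B i j * w j)) = \<dots>" .
  have "(\<Sum>i\<in>UNIV. \<Sum>j\<in>UNIV. M i j * w j) = (\<Sum>k\<in>UNIV. \<Sum>i\<in>UNIV. M i k * w k)"
    by (rule sum.swap)
  also have "\<dots> = (\<Sum>k\<in>UNIV. (\<Sum>i\<in>UNIV. M i k) * w k)"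
    by (simp add: sum_distrib_right)
  finally show ?thesis
    unfolding 1 by (simp add: left_diff_distrib sum_subtractf)
qed

text \<open>In the Leibniz rule the second derivatives of \<open>v\<close> give the leading part of
  the Hessian trace, while the derivatives of \<open>sqrt det\<close> and of the inverse metric
  combine into the contracted Christoffel term.\<close>

lemma divergence_flux:
  fixes G :: "real^3 \<Rightarrow> real^3^3"
  assumes S: "open S" "x \<in> S" and G: "\<And>i j. Ck_on (Suc 0) (\<lambda>y. G y $ i $ j) S"
    and pos: "\<And>y. y \<in> S \<Longrightarrow> det (G y) > 0" and sym: "\<And>y. y \<in> S \<Longrightarrow> transpose (G y) = G y"
    and v: "Ck_on (Suc (Suc 0)) v S"
  shows "(\<Sum>i\<in>UNIV. pd i (flux G v i) x) = sqrt (det (G x)) * laplacian G v x"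
proof -
  let ?s = "sqrt (det (G x))" and ?I = "\<lambda>i j. ginv G x $ i $ j"
    and ?D = "\<lambda>i. \<chi> a b. pd i (\<lambda>y. G y $ a $ b) x"
  have nz: "det (G y) \<noteq> 0" if "y \<in> S" for y
    using pos[OF that] by simp
  have diff_s: "(\<lambda>y. sqrt (det (G y))) differentiable (at x)"
    by (rule Ck_on_Suc_differentiable[OF C1_on_sqrt[OF C1_on_det[OF G] pos] S(2)])
  have diff_I: "(\<lambda>y. ginv G y $ i $ j) differentiable (at x)" for i j
    by (rule Ck_on_Suc_differentiable[OF C1_on_matrix_inv[OF S(1) G nz] S(2)])
  have diff_v: "pd j v differentiable (at x)" for j
    by (rule Ck_on_Suc_differentiable[OF Ck_on_pd[OF v] S(2)])
  have symG: "G y $ i $ j = G y $ j $ i" if "y \<in> S" for y i j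
    using sym[OF that] by (metis (no_types, lifting) transpose_def vec_lambda_beta)
  have D: "pd l (\<lambda>y. G y $ i $ j) x = pd l (\<lambda>y. G y $ j $ i) x" for l i j
    by (rule pd_cong[OF S]) (rule symG)
  have "transpose (ginv G x) = ginv G x"
    using transpose_matrix_inv[OF nz[OF S(2)]] sym[OF S(2)] by simp
  then have I: "?I i j = ?I j i" for i j
    by (metis (no_types, lifting) transpose_def vec_lambda_beta)
  have "pd i (flux G v i) x = ?s * (trace (ginv G x ** ?D i) / 2 * (\<Sum>j\<in>UNIV. ?I i j * pd j v x)
      + (\<Sum>j\<in>UNIV. - (ginv G x ** ?D i ** ginv G x) $ i $ j * pd j v x + ?I i j * pd i (pd j v) x))" for i
  proof -
    have "pd i (flux G v i) x = pd i (\<lambda>y. sqrt (det (G y))) x * (\<Sum>j\<in>UNIV. ?I i j * pd j v x)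
        + ?s * pd i (\<lambda>y. \<Sum>j\<in>UNIV. ginv G y $ i $ j * pd j v y) x"
      unfolding flux_def[abs_def]
      by (rule pd_mult[OF diff_s differentiable_sum]) (simp_all add: differentiable_mult diff_I diff_v)
    also have "pd i (\<lambda>y. \<Sum>j\<in>UNIV. ginv G y $ i $ j * pd j v y) x =
        (\<Sum>j\<in>UNIV. pd i (\<lambda>y. ginv G y $ i $ j) x * pd j v x + ?I i j * pd i (pd j v) x)"
      using diff_I diff_v by (subst pd_sum) (simp_all add: differentiable_mult pd_mult)
    also have "(\<lambda>j. pd i (\<lambda>y. ginv G y $ i $ j) x) = (\<lambda>j. - (ginv G x ** ?D i ** ginv G x) $ i $ j)"
      by (rule ext, rule pd_matrix_inv[OF S G nz])
    also have "pd i (\<lambda>y. sqrt (det (G y))) x = ?s * trace (ginv G x ** ?D i) / 2"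
      by (rule pd_sqrt_det[OF S(2) G pos])
    finally show ?thesis
      by (simp add: algebra_simps)
  qed
  then have "pd i (flux G v i) x =
      ?s * ((\<Sum>j\<in>UNIV. trace (ginv G x ** ?D i) / 2 * (?I i j * pd j v x))
        - (\<Sum>j\<in>UNIV. (ginv G x ** ?D i ** ginv G x) $ i $ j * pd j v x)
        + (\<Sum>j\<in>UNIV. ?I i j * pd i (pd j v) x))" for i
    by (simp add: sum.distrib sum_negf sum_subtractf sum_distrib_left)
  then have "(\<Sum>i\<in>UNIV. pd i (flux G v i) x) =
      ?s * ((\<Sum>i\<in>UNIV. \<Sum>j\<in>UNIV. trace (ginv G x ** ?D i) / 2 * (?I i j * pd j v x))
        - (\<Sum>i\<in>UNIV. \<Sum>j\<in>UNIV. (ginv G x ** ?D i ** ginv G x) $ i $ j * pd j v x)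
        + (\<Sum>i\<in>UNIV. \<Sum>j\<in>UNIV. ?I i j * pd i (pd j v) x))"
    by (simp only: sum.distrib sum_subtractf sum_distrib_left[symmetric])
  also have "(\<Sum>i\<in>UNIV. \<Sum>j\<in>UNIV. trace (ginv G x ** ?D i) / 2 * (?I i j * pd j v x))
        - (\<Sum>i\<in>UNIV. \<Sum>j\<in>UNIV. (ginv G x ** ?D i ** ginv G x) $ i $ j * pd j v x) =
      - (\<Sum>k\<in>UNIV. (\<Sum>i\<in>UNIV. \<Sum>j\<in>UNIV. ?I i j * christoffel G k i j x) * pd k v x)"
    unfolding christoffel_contraction[of G x, OF I D] by (rule sum_regroup)
  also have "(\<Sum>k\<in>UNIV. (\<Sum>i\<in>UNIV. \<Sum>j\<in>UNIV. ?I i j * christoffel G k i j x) * pd k v x) =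
      (\<Sum>i\<in>UNIV. \<Sum>j\<in>UNIV. \<Sum>k\<in>UNIV. ?I i j * christoffel G k i j x * pd k v x)"
  proof -
    have "(\<Sum>k\<in>UNIV. (\<Sum>i\<in>UNIV. \<Sum>j\<in>UNIV. ?I i j * christoffel G k i j x) * pd k v x) =
        (\<Sum>k\<in>UNIV. \<Sum>i\<in>UNIV. \<Sum>j\<in>UNIV. ?I i j * christoffel G k i j x * pd k v x)"
      by (simp add: sum_distrib_right)
    also have "\<dots> = (\<Sum>i\<in>UNIV. \<Sum>k\<in>UNIV. \<Sum>j\<in>UNIV. ?I i j * christoffel G k i j x * pd k v x)"
      by (rule sum.swap)
    also have "\<dots> = (\<Sum>i\<in>UNIV. \<Sum>j\<in>UNIV. \<Sum>k\<in>UNIV. ?I i j * christoffel G k i j x * pd k v x)"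
      by (rule sum.cong[OF refl], rule sum.swap)
    finally show ?thesis .
  qed
  also have "- (\<Sum>i\<in>UNIV. \<Sum>j\<in>UNIV. \<Sum>k\<in>UNIV. ?I i j * christoffel G k i j x * pd k v x)
      + (\<Sum>i\<in>UNIV. \<Sum>j\<in>UNIV. ?I i j * pd i (pd j v) x) = laplacian G v x"
    by (simp add: laplacian_def trace_wrt_def hessian_def right_diff_distrib sum_subtractf sum_distrib_left mult.assoc)
  finally show ?thesis .
qed

text \<open>The integrand is the coordinate divergence of \<open>u * flux G v\<close>. This field
  vanishes off the compact \<open>K\<close>, so each of its partial derivatives integrates to
  zero.\<close>

lemma local_green:
  fixes G :: "real^3 \<Rightarrow> real^3^3"
  assumes S: "open S" and G: "\<And>i j. Ck_on (Suc 0) (\<lambda>y. G y $ i $ j) S"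
    and pos: "\<And>y. y \<in> S \<Longrightarrow> det (G y) > 0" and sym: "\<And>y. y \<in> S \<Longrightarrow> transpose (G y) = G y"
    and v: "Ck_on (Suc (Suc 0)) v S" and u: "Ck_on (Suc 0) u S"
    and K: "compact K" "K \<subseteq> S" and supp: "\<And>x. x \<in> S - K \<Longrightarrow> u x = 0"
  shows "(LINT x:K|lborel. (u x * laplacian G v x + grad_dot G u v x) * sqrt (det (G x))) = 0"
proof -
  have flux: "Ck_on (Suc 0) (flux G v i) S" for i
    by (rule C1_on_flux[OF S G pos v])
  have C1: "Ck_on (Suc 0) (\<lambda>x. u x * flux G v i x) S" for i
    by (rule C1_on_mult[OF u flux])
  have Kb: "K \<in> sets borel"
    by (rule borel_compact[OF K(1)])
  have int: "set_integrable lborel K (pd i (\<lambda>x. u x * flux G v i x))" for i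
    by (rule set_integrable_continuous_on_compact[OF K(1) continuous_on_subset[OF continuous_on_pd[OF C1] K(2)] Kb order_refl])
  have eq: "(\<Sum>i\<in>UNIV. pd i (\<lambda>x. u x * flux G v i x) x) =
      (u x * laplacian G v x + grad_dot G u v x) * sqrt (det (G x))" if "x \<in> K" for x
  proof -
    have x: "x \<in> S" using that K(2) by blast
    have "pd i (\<lambda>x. u x * flux G v i x) x = pd i u x * flux G v i x + u x * pd i (flux G v i) x" for i
      by (rule pd_mult[OF Ck_on_Suc_differentiable[OF u x] Ck_on_Suc_differentiable[OF flux x]])
    then have "(\<Sum>i\<in>UNIV. pd i (\<lambda>x. u x * flux G v i x) x) =
        (\<Sum>i\<in>UNIV. pd i u x * flux G v i x) + u x * (\<Sum>i\<in>UNIV. pd i (flux G v i) x)"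
      by (simp add: sum.distrib sum_distrib_left)
    also have "(\<Sum>i\<in>UNIV. pd i u x * flux G v i x) = sqrt (det (G x)) * grad_dot G u v x"
      by (simp add: flux_def grad_dot_def sum_distrib_left mult_ac)
    also have "(\<Sum>i\<in>UNIV. pd i (flux G v i) x) = sqrt (det (G x)) * laplacian G v x"
      by (rule divergence_flux[OF S x G pos sym v])
    finally show ?thesis
      by (simp add: algebra_simps)
  qed
  have "(LINT x:K|lborel. (u x * laplacian G v x + grad_dot G u v x) * sqrt (det (G x))) =
      (LINT x:K|lborel. (\<Sum>i\<in>UNIV. pd i (\<lambda>x. u x * flux G v i x) x))"
    by (rule set_lebesgue_integral_cong) (use Kb eq in auto)
  also have "\<dots> = (\<Sum>i\<in>UNIV. LINT x:K|lborel. pd i (\<lambda>x. u x * flux G v i x) x)"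
    using int unfolding set_lebesgue_integral_def set_integrable_def scaleR_sum_right
    by (intro Bochner_Integration.integral_sum)
  also have "\<dots> = 0"
    using supp by (intro sum.neutral ballI set_integral_pd_eq_0[OF S C1 K]) simp
  finally show ?thesis .
qed

subsection \<open>Behaviour under a change of chart\<close>

text \<open>The transformation law of an inverse metric: if the metric pulls back by
  \<open>J\<close>, its inverse pushes forward. The hypothesis forces \<open>J\<close> to be
  invertible.\<close>

lemma congruence_matrix_inv:
  fixes J D :: "real^'n^'n"
  assumes "det (transpose J ** D ** J) \<noteq> 0"
  shows "J ** matrix_inv (transpose J ** D ** J) ** transpose J = matrix_inv D"
proof -
  let ?G = "transpose J ** D ** J" and ?K = "matrix_inv (transpose J)"
  have "det (transpose J) \<noteq> 0"
    using assms by (auto simp: det_mul det_transpose)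
  then have K: "?K ** transpose J = mat 1"
    by (rule matrix_inv_left)
  \<comment> \<open>Inserting \<open>?K ** transpose J = mat 1\<close> on the left completes the
    factor \<open>?G\<close>, which then cancels against its inverse.\<close>
  have "D ** (J ** matrix_inv ?G ** transpose J) = (?K ** transpose J) ** D ** J ** matrix_inv ?G ** transpose J"
    by (simp add: K matrix_mul_assoc)
  also have "\<dots> = ?K ** (?G ** matrix_inv ?G) ** transpose J"
    by (simp add: matrix_mul_assoc)
  also have "\<dots> = mat 1"
    by (simp add: matrix_inv_right[OF assms] K)
  finally show ?thesis
    by (rule matrix_inv_unique[symmetric])
qed

lemma grad_dot_eq_inner:
  "grad_dot G u v x = (\<chi> i. pd i u x) \<bullet> (ginv G x *v (\<chi> j. pd j v x))"
  by (simp add: grad_dot_def inner_vec_def matrix_vector_mult_def sum_distrib_left mult_ac)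

lemma pd_compose:
  fixes f :: "real^'m \<Rightarrow> real" and \<theta> :: "real^'n \<Rightarrow> real^'m"
  assumes f: "f differentiable (at (\<theta> x))" and \<theta>: "\<theta> differentiable (at x)"
  shows "(\<chi> i. pd i (f \<circ> \<theta>) x) = transpose (matrix (frechet_derivative \<theta> (at x))) *v (\<chi> k. pd k f (\<theta> x))"
proof -
  have lin: "linear (frechet_derivative f (at (\<theta> x)))"
    by (rule linear_frechet_derivative[OF f])
  have "pd i (f \<circ> \<theta>) x = (\<Sum>k\<in>UNIV. frechet_derivative \<theta> (at x) (axis i 1) $ k * pd k f (\<theta> x))" for i
  proof -
    have "pd i (f \<circ> \<theta>) x = frechet_derivative f (at (\<theta> x)) (frechet_derivative \<theta> (at x) (axis i 1))"
      unfolding pd_def frechet_derivative_compose[OF \<theta> f] by simp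
    also have "\<dots> = frechet_derivative f (at (\<theta> x))
        (\<Sum>k\<in>UNIV. frechet_derivative \<theta> (at x) (axis i 1) $ k *\<^sub>R axis k 1)"
      by (simp add: basis_expansion flip: scalar_mult_eq_scaleR)
    also have "\<dots> = (\<Sum>k\<in>UNIV. frechet_derivative \<theta> (at x) (axis i 1) $ k * pd k f (\<theta> x))"
      by (simp add: linear_sum[OF lin] linear_cmul[OF lin] pd_def)
    finally show ?thesis .
  qed
  then show ?thesis
    by (simp add: vec_eq_iff matrix_vector_mult_def transpose_def matrix_def mult_ac)
qed

context smooth_manifold
begin

lemma pd_change_of_chart:
  assumes c: "c \<in> A" and d: "d \<in> A" and p: "p \<in> chart_dom c \<inter> chart_dom d"
    and u: "(u \<circ> chart_inv d) differentiable (at (coord d p))"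
  shows "(\<chi> i. pd i (u \<circ> chart_inv c) (coord c p)) =
    transpose (jacobian c d (coord c p)) *v (\<chi> k. pd k (u \<circ> chart_inv d) (coord d p))"
proof -
  let ?\<theta> = "coord d \<circ> chart_inv c"
  have x: "coord c p \<in> overlap c d" and \<theta>x: "?\<theta> (coord c p) = coord d p"
    using p c by (auto simp: chart_inv_coord)
  have "pd i (u \<circ> chart_inv c) (coord c p) = pd i ((u \<circ> chart_inv d) \<circ> ?\<theta>) (coord c p)" for i
    by (rule pd_cong[OF open_overlap[OF c d] x]) (auto simp: chart_inv_coord c d)
  moreover have "?\<theta> differentiable (at (coord c p))"
    by (rule Ck_on_Suc_differentiable[OF Ck_on_transition[OF c d, of "Suc 0"] x])
  ultimately show ?thesis
    using pd_compose[of "u \<circ> chart_inv d" ?\<theta> "coord c p"] u unfolding \<theta>x by simp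
qed

lemma continuous_on_charts:
  fixes f :: "'a \<Rightarrow> 'b::topological_space"
  assumes "\<And>c. c \<in> A \<Longrightarrow> continuous_on (chart_im c) (f \<circ> chart_inv c)"
  shows "continuous_on UNIV f"
proof -
  have "isCont f p" for p
  proof -
    let ?c = "chart_at A p"
    have "continuous_on (chart_dom ?c) ((f \<circ> chart_inv ?c) \<circ> coord ?c)"
      by (rule continuous_on_compose[OF continuous_on_coord[OF chart_at_mem(1)] assms[OF chart_at_mem(1)]])
    then have "continuous_on (chart_dom ?c) f"
      by (rule continuous_on_eq) (simp add: chart_inv_coord[OF chart_at_mem(1)])
    then show ?thesis
      using continuous_on_eq_continuous_at[OF open_chart_dom[OF chart_at_mem(1)], of p f] chart_at_mem(2) by blast
  qed
  then show ?thesis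
    by (simp add: continuous_at_imp_continuous_on)
qed

end

context riemannian_manifold
begin

text \<open>Each of the two differentials picks up a transposed Jacobian; moved over to the inverse
  metric, these turn it into the inverse metric of the other chart.\<close>

lemma grad_dot_change_of_chart:
  assumes c: "c \<in> A" and d: "d \<in> A" and p: "p \<in> chart_dom c \<inter> chart_dom d"
    and u: "(u \<circ> chart_inv d) differentiable (at (coord d p))"
    and v: "(v \<circ> chart_inv d) differentiable (at (coord d p))"
  shows "grad_dot (g c) (u \<circ> chart_inv c) (v \<circ> chart_inv c) (coord c p) =
    grad_dot (g d) (u \<circ> chart_inv d) (v \<circ> chart_inv d) (coord d p)"
proof -
  let ?J = "jacobian c d (coord c p)"
  have "det (g c (coord c p)) \<noteq> 0"
    using det_metric_pos[OF c, of "coord c p"] p by auto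
  then have "?J ** ginv (g c) (coord c p) ** transpose ?J = ginv (g d) (coord d p)"
    unfolding metric_transform[OF c d p] by (rule congruence_matrix_inv)
  moreover have "(transpose ?J *v a) \<bullet> (ginv (g c) (coord c p) *v (transpose ?J *v b)) =
      a \<bullet> ((?J ** ginv (g c) (coord c p) ** transpose ?J) *v b)" for a b
  proof -
    have "(transpose ?J *v a) \<bullet> z = a \<bullet> (?J *v z)" for z
      by (simp only: transpose_matrix_vector dot_lmul_matrix)
    then show ?thesis
      by (simp only: matrix_vector_mul_assoc matrix_mul_assoc)
  qed
  ultimately show ?thesis
    unfolding grad_dot_eq_inner pd_change_of_chart[OF c d p u] pd_change_of_chart[OF c d p v]
    by simp
qed

end

subsection \<open>A partition of unity\<close>

text \<open>The squared positive part is C1 but not C2. That is enough, because Green's identity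
  differentiates the cutoff once.\<close>

lemma has_real_derivative_max_0_power2:
  "((\<lambda>t. (max 0 t)\<^sup>2) has_real_derivative 2 * max 0 t) (at (t :: real))"
proof -
  consider "t < 0" | "t = 0" | "t > 0" by linarith
  then show ?thesis
  proof cases
    case 1
    have "((\<lambda>t::real. 0) has_real_derivative 2 * max 0 t) (at t)"
      using 1 by simp
    then show ?thesis
      by (rule DERIV_cong_ev[THEN iffD1, rotated -1])
        (use 1 eventually_nhds_in_open[of "{..<0::real}" t] in \<open>auto elim!: eventually_mono\<close>)
  next
    case 2
    \<comment> \<open>At the kink the difference quotient is \<open>max 0 y\<close> itself.\<close>
    have "((\<lambda>y::real. max 0 y) \<longlongrightarrow> max 0 0) (at 0)"
      by (intro tendsto_max tendsto_const tendsto_ident_at)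
    moreover have "\<forall>\<^sub>F y in at 0. max 0 y = ((max 0 y)\<^sup>2 - (max 0 0)\<^sup>2) / (y - 0 :: real)"
      by (auto simp: eventually_at_filter max_def power2_eq_square)
    ultimately have "((\<lambda>y. ((max 0 y)\<^sup>2 - (max 0 0)\<^sup>2) / (y - 0 :: real)) \<longlongrightarrow> max 0 0) (at 0)"
      by (rule Lim_transform_eventually)
    then show ?thesis
      unfolding 2 has_field_derivative_iff by simp
  next
    case 3
    have "((\<lambda>t. t\<^sup>2) has_real_derivative 2 * max 0 t) (at t)"
      using 3 by (auto intro!: derivative_eq_intros)
    then show ?thesis
      by (rule DERIV_cong_ev[THEN iffD1, rotated -1])
        (use 3 eventually_nhds_in_open[of "{0::real<..}" t] in \<open>auto elim!: eventually_mono\<close>)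
  qed
qed

text \<open>The factor \<open>r * \<bar>r\<bar>\<close> instead of \<open>r\<^sup>2\<close> makes the bump vanish for \<open>r \<le> 0\<close>, where the ball is empty.\<close>
definition bump :: "'b::euclidean_space \<Rightarrow> real \<Rightarrow> 'b \<Rightarrow> real" where
  "bump x r y = (max 0 (r * \<bar>r\<bar> - (y - x) \<bullet> (y - x)))\<^sup>2"

lemma C1_on_bump: "Ck_on (Suc 0) (bump x r) S"
  unfolding bump_def[abs_def]
proof (rule C1_on_compose_real[where \<phi> = "\<lambda>t. (max 0 t)\<^sup>2" and \<phi>' = "\<lambda>t. 2 * max 0 t"
      and f = "\<lambda>y. r * \<bar>r\<bar> - (y - x) \<bullet> (y - x)"])
  show "Ck_on (Suc 0) (\<lambda>y. r * \<bar>r\<bar> - (y - x) \<bullet> (y - x)) S"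
  proof (rule C1_onI)
    show "((\<lambda>y. r * \<bar>r\<bar> - (y - x) \<bullet> (y - x)) has_derivative (\<lambda>v. - 2 * ((y - x) \<bullet> v))) (at y)" for y
      by (rule has_derivative_eq_rhs, (rule derivative_intros)+) (simp add: fun_eq_iff inner_commute)
    show "continuous_on S (\<lambda>y. - 2 * ((y - x) \<bullet> v))" for v
      by (intro continuous_intros)
  qed
  show "((\<lambda>t. (max 0 t)\<^sup>2) has_real_derivative 2 * max 0 t) (at t)" for t :: real
    by (rule has_real_derivative_max_0_power2)
  show "continuous_on T (\<lambda>t::real. 2 * max 0 t)" for T
    by (intro continuous_intros)
qed

lemma bump_pos_iff: "bump x r y > 0 \<longleftrightarrow> y \<in> ball x r"
proof -
  have "bump x r y > 0 \<longleftrightarrow> (y - x) \<bullet> (y - x) < r * \<bar>r\<bar>"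
    by (auto simp: bump_def max_def)
  also have "(y - x) \<bullet> (y - x) = (dist x y)\<^sup>2"
    by (metis dist_commute dist_norm power2_norm_eq_inner)
  also have "(dist x y)\<^sup>2 < r * \<bar>r\<bar> \<longleftrightarrow> dist x y < r"
  proof (cases "r > 0")
    case True
    then have "r\<^sup>2 \<le> (dist x y)\<^sup>2 \<longleftrightarrow> r \<le> dist x y"
      by (intro power_mono_iff) auto
    moreover have "r * \<bar>r\<bar> = r\<^sup>2"
      using True by (simp add: power2_eq_square)
    ultimately show ?thesis by linarith
  next
    case False
    then have "r * \<bar>r\<bar> \<le> 0"
      by (intro mult_nonpos_nonneg) auto
    with False show ?thesis
      using zero_le_power2[of "dist x y"] zero_le_dist[of x y] by linarith
  qed
  finally show ?thesis by simp
qed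

lemma bump_nonneg: "bump x r y \<ge> 0"
  by (simp add: bump_def)

context compact_manifold
begin

text \<open>A compact set containing \<open>coord_ball j\<close>, off which the \<open>j\<close>-th
  bump vanishes. Despite its name it is not defined as the closure of
  \<open>piece j\<close>.\<close>

definition closed_piece :: "('a, 'n) chart \<times> (real, 'n) vec \<times> real \<Rightarrow> 'a set" where
  "closed_piece j = chart_inv (fst j) ` coord_cball j"

lemma
  assumes "j \<in> cover"
  shows closed_closed_piece: "closed (closed_piece j)"
    and closed_piece_subset_dom: "closed_piece j \<subseteq> chart_dom (fst j)"
    and coord_closed_piece: "coord (fst j) ` closed_piece j = coord_cball j"
proof -
  note c = cover_chart[OF assms] and K = cover_cball[OF assms]
  show "closed (closed_piece j)"
    unfolding closed_piece_def
    by (intro compact_imp_closed compact_continuous_image compact_cball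
        continuous_on_subset[OF continuous_on_chart_inv[OF c] K])
  show "closed_piece j \<subseteq> chart_dom (fst j)"
    unfolding closed_piece_def using chart_inv_in[OF c] K by blast
  show "coord (fst j) ` closed_piece j = coord_cball j"
    unfolding closed_piece_def image_image
    using coord_chart_inv[OF c] K by (auto simp: subset_iff image_iff)
qed

definition bump_at :: "('a, 'n) chart \<times> (real, 'n) vec \<times> real \<Rightarrow> 'a \<Rightarrow> real" where
  "bump_at j p = (if p \<in> chart_dom (fst j) then bump (fst (snd j)) (snd (snd j)) (coord (fst j) p) else 0)"

lemma bump_at_nonneg: "bump_at j p \<ge> 0"
  by (simp add: bump_at_def bump_nonneg)

lemma bump_at_pos_iff:
  assumes "j \<in> cover"
  shows "bump_at j p > 0 \<longleftrightarrow> p \<in> coord_ball j"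
  unfolding cover_ball_eq[OF assms] by (simp add: bump_at_def bump_pos_iff)

lemma coord_ball_subset_closed_piece: "coord_ball j \<subseteq> closed_piece j"
  unfolding closed_piece_def coord_ball_def by (auto simp: case_prod_beta)

lemma bump_at_eq_0:
  assumes "j \<in> cover" "p \<notin> closed_piece j"
  shows "bump_at j p = 0"
  using bump_at_pos_iff[OF assms(1)] coord_ball_subset_closed_piece[of j] assms(2) bump_at_nonneg[of j p]
  by (metis order_le_less subsetD)

text \<open>Where the chart of \<open>j\<close> is available, the bump is composed with a transition
  map; elsewhere the point has a neighbourhood off \<open>closed_piece j\<close>, a closed set
  inside that chart, and there the bump is zero.\<close>

lemma C1_bump_at:
  assumes j: "j \<in> cover" and c: "c \<in> A"
  shows "Ck_on (Suc 0) (bump_at j \<circ> chart_inv c) (chart_im c)"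
proof (rule Ck_on_local)
  fix x assume x: "x \<in> chart_im c"
  let ?d = "fst j"
  note d = cover_chart[OF j]
  show "\<exists>W. open W \<and> x \<in> W \<and> Ck_on (Suc 0) (bump_at j \<circ> chart_inv c) W"
  proof (cases "chart_inv c x \<in> chart_dom ?d")
    case True
    have "Ck_on (Suc 0) (\<lambda>y. bump (fst (snd j)) (snd (snd j)) ((coord ?d \<circ> chart_inv c) y)) (overlap c ?d)"
      by (rule C1_on_compose[OF C1_on_bump[where S = UNIV] Ck_on_transition[OF c d]]) simp
    then have "Ck_on (Suc 0) (bump_at j \<circ> chart_inv c) (overlap c ?d)"
      by (rule Ck_on_cong[OF open_overlap[OF c d], rotated]) (auto simp: bump_at_def chart_inv_coord[OF c])
    moreover have "x \<in> overlap c ?d"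
      using True x c by (intro image_eqI[of _ _ "chart_inv c x"]) (auto simp: coord_chart_inv chart_inv_coord)
    ultimately show ?thesis
      using open_overlap[OF c d] by blast
  next
    case False
    let ?W = "chart_im c \<inter> chart_inv c -` (- closed_piece j)"
    have W: "open ?W"
      by (rule continuous_open_preimage[OF continuous_on_chart_inv[OF c] open_chart_im[OF c]
            open_Compl[OF closed_closed_piece[OF j]]])
    moreover have "Ck_on (Suc 0) (bump_at j \<circ> chart_inv c) ?W"
      by (rule Ck_on_cong[OF W _ C1_on_const[of 0]]) (simp add: bump_at_eq_0[OF j])
    moreover have "x \<in> ?W"
      using False x closed_piece_subset_dom[OF j] by blast
    ultimately show ?thesis by blast
  qed
qed

definition part :: "('a, 'n) chart \<times> (real, 'n) vec \<times> real \<Rightarrow> 'a \<Rightarrow> real" where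
  "part j p = bump_at j p / (\<Sum>i\<in>cover. bump_at i p)"

lemma sum_bump_at_pos: "(\<Sum>i\<in>cover. bump_at i p) > 0"
proof -
  obtain i where "i \<in> cover" "p \<in> coord_ball i"
    using cover_UNIV by blast
  then show ?thesis
    using bump_at_pos_iff[of i p] by (intro sum_pos2[OF finite_cover, of i] bump_at_nonneg) auto
qed

lemma sum_part: "(\<Sum>j\<in>cover. part j p) = 1"
  using sum_bump_at_pos[of p] by (simp add: part_def flip: sum_divide_distrib)

lemma part_eq_0: "j \<in> cover \<Longrightarrow> p \<notin> closed_piece j \<Longrightarrow> part j p = 0"
  by (simp add: part_def bump_at_eq_0)

lemma C1_part:
  assumes "j \<in> cover" "c \<in> A"
  shows "Ck_on (Suc 0) (part j \<circ> chart_inv c) (chart_im c)"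
proof -
  have "Ck_on (Suc 0) (\<lambda>x. (bump_at j \<circ> chart_inv c) x / (\<Sum>i\<in>cover. (bump_at i \<circ> chart_inv c) x)) (chart_im c)"
    using sum_bump_at_pos less_imp_neq
    by (intro C1_on_divide C1_on_sum C1_bump_at assms) (auto simp: less_imp_neq[symmetric])
  then show ?thesis
    by (simp add: part_def[abs_def] comp_def)
qed

end

text \<open>Dimension three enters through the derivative of the determinant behind
  \<open>divergence_flux\<close>; one derivative of the metric is all that the flux
  requires.\<close>

locale compact_riemannian_3_manifold = compact_riemannian_manifold A g
  for A :: "('a::{t2_space,second_countable_topology}, 3) chart set" and g :: "('a, 3) tensor2" +
  assumes C1_metric: "c \<in> A \<Longrightarrow> Ck_on (Suc 0) (g c) (chart_im c)"
    and symmetric_metric: "c \<in> A \<Longrightarrow> x \<in> chart_im c \<Longrightarrow> transpose (g c x) = g c x"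
begin

lemma C1_metric_component: "c \<in> A \<Longrightarrow> Ck_on (Suc 0) (\<lambda>x. g c x $ i $ j) (chart_im c)"
  by (rule Ck_on_matrix_component[OF open_chart_im C1_metric])

lemma continuous_on_grad_dot:
  assumes c: "c \<in> A" and u: "Ck_on (Suc 0) u (chart_im c)" and v: "Ck_on (Suc 0) v (chart_im c)"
  shows "continuous_on (chart_im c) (grad_dot (g c) u v)"
proof -
  have "continuous_on (chart_im c) (\<lambda>x. ginv (g c) x $ i $ j)" for i j
    using det_metric_pos[OF c]
    by (intro continuous_on_matrix_inv Ck_on_Suc_continuous_on[OF C1_metric_component[OF c]]) force
  then show ?thesis
    unfolding grad_dot_def[abs_def]
    by (intro continuous_on_sum continuous_on_mult continuous_on_pd[OF u] continuous_on_pd[OF v])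
qed

text \<open>Multiply by the partition of unity and integrate by parts in every chart: the resulting terms
  \<open>\<langle>\<nabla>\<rho>\<^sub>j, \<nabla>v\<rangle>\<close> do not depend on the chart and add up to \<open>\<langle>\<nabla>1, \<nabla>v\<rangle> = 0\<close>.\<close>

lemma integral_laplacian_eq_0:
  fixes v F :: "'a \<Rightarrow> real"
  assumes v: "\<And>c. c \<in> A \<Longrightarrow> Ck_on (Suc (Suc 0)) (v \<circ> chart_inv c) (chart_im c)"
    and F: "continuous_on UNIV F"
    and lap: "\<And>c x. c \<in> A \<Longrightarrow> x \<in> chart_im c \<Longrightarrow> laplacian (g c) (v \<circ> chart_inv c) x = F (chart_inv c x)"
  shows "(LINT p|vol_measure A g. F p) = 0"
proof -
  \<comment> \<open>The pairing of the differentials of \<open>part j\<close> and \<open>v\<close>,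
    made a function on the manifold by evaluation in a chosen chart, so that it can be integrated
    against the volume measure.\<close>
  define \<Gamma> where "\<Gamma> j p = (let c = chart_at A p in
      grad_dot (g c) (part j \<circ> chart_inv c) (v \<circ> chart_inv c) (coord c p))" for j p
  have v1: "Ck_on (Suc 0) (v \<circ> chart_inv c) (chart_im c)" if "c \<in> A" for c
  proof (rule C1_onI)
    show "((v \<circ> chart_inv c) has_derivative frechet_derivative (v \<circ> chart_inv c) (at x)) (at x)"
      if "x \<in> chart_im c" for x
      by (rule Ck_on_Suc_has_derivative[OF v[OF \<open>c \<in> A\<close>] that])
    show "continuous_on (chart_im c) (\<lambda>x. frechet_derivative (v \<circ> chart_inv c) (at x) w)" for w
      using v[OF \<open>c \<in> A\<close>] by (intro Ck_on_Suc_continuous_on[of 0]) simp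
  qed
  have \<Gamma>: "\<Gamma> j (chart_inv c x) = grad_dot (g c) (part j \<circ> chart_inv c) (v \<circ> chart_inv c) x"
    if j: "j \<in> cover" and c: "c \<in> A" and x: "x \<in> chart_im c" for j c x
  proof -
    let ?p = "chart_inv c x"
    let ?d = "chart_at A ?p"
    have d: "?d \<in> A" "?p \<in> chart_dom ?d"
      by (rule chart_at_mem)+
    have p: "?p \<in> chart_dom ?d \<inter> chart_dom c" and px: "coord c ?p = x"
      using d(2) chart_inv_in[OF c x] coord_chart_inv[OF c x] by auto
    show ?thesis
      unfolding \<Gamma>_def Let_def
      using grad_dot_change_of_chart[OF d(1) c p, of "part j" v] x
        Ck_on_Suc_differentiable[OF C1_part[OF j c] x] Ck_on_Suc_differentiable[OF v1[OF c] x]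
      by (simp add: px)
  qed
  have cont_part: "continuous_on UNIV (part j)" if "j \<in> cover" for j
    by (rule continuous_on_charts) (rule Ck_on_Suc_continuous_on[OF C1_part[OF that]])
  have cont_\<Gamma>: "continuous_on UNIV (\<Gamma> j)" if j: "j \<in> cover" for j
  proof (rule continuous_on_charts)
    fix c assume c: "c \<in> A"
    show "continuous_on (chart_im c) (\<Gamma> j \<circ> chart_inv c)"
      using continuous_on_grad_dot[OF c C1_part[OF j c] v1[OF c]]
      by (rule continuous_on_eq) (simp add: \<Gamma>[OF j c])
  qed
  have cont: "continuous_on UNIV (\<lambda>p. part j p * F p + \<Gamma> j p)" if "j \<in> cover" for j
    by (intro continuous_on_add continuous_on_mult F cont_part cont_\<Gamma> that)
  have zero: "(LINT p|vol_measure A g. part j p * F p + \<Gamma> j p) = 0" if j: "j \<in> cover" for j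
  proof -
    let ?c = "fst j"
    note c = cover_chart[OF j] and E = closed_piece_subset_dom[OF j]
    have E_borel: "closed_piece j \<in> sets borel"
      by (rule borel_closed[OF closed_closed_piece[OF j]])
    have supp: "(part j \<circ> chart_inv ?c) x = 0" if "x \<in> chart_im ?c - coord_cball j" for x
    proof -
      have "chart_inv ?c x \<notin> closed_piece j"
        using that coord_closed_piece[OF j] coord_chart_inv[OF c, of x] by (metis DiffD1 DiffD2 imageI)
      then show ?thesis
        by (simp add: part_eq_0[OF j])
    qed
    \<comment> \<open>Off the closed set, \<open>part j\<close> is zero on a whole neighbourhood,
      hence so are its partial derivatives. The integral then reduces to the closed ball of one
      chart, where \<open>local_green\<close> applies.\<close>
    have \<Gamma>_out: "\<Gamma> j p = 0" if "p \<notin> closed_piece j" for p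
    proof -
      let ?d = "chart_at A p"
      note d = chart_at_mem[of p]
      let ?W = "chart_im ?d \<inter> chart_inv ?d -` (- closed_piece j)"
      have "open ?W"
        by (rule continuous_open_preimage[OF continuous_on_chart_inv[OF d(1)] open_chart_im[OF d(1)]
              open_Compl[OF closed_closed_piece[OF j]]])
      moreover have "coord ?d p \<in> ?W"
        using that d chart_inv_coord[OF d] by simp
      ultimately have "pd i (part j \<circ> chart_inv ?d) (coord ?d p) = pd i (\<lambda>_. 0) (coord ?d p)" for i
        by (rule pd_cong) (simp add: part_eq_0[OF j])
      then show ?thesis
        by (simp add: \<Gamma>_def Let_def grad_dot_def pd_const)
    qed
    have "(LINT p|vol_measure A g. part j p * F p + \<Gamma> j p) =
        (LINT p:closed_piece j|vol_measure A g. part j p * F p + \<Gamma> j p)"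
      unfolding set_lebesgue_integral_def
      by (rule Bochner_Integration.integral_cong[OF refl]) (auto simp: indicator_def part_eq_0[OF j] \<Gamma>_out)
    also have "\<dots> = (LINT x:coord_cball j|lborel.
        (part j (chart_inv ?c x) * F (chart_inv ?c x) + \<Gamma> j (chart_inv ?c x)) * dens ?c x)"
      unfolding set_integral_vol_measure[OF c E_borel E borel_measurable_continuous_onI[OF cont[OF j]]]
        coord_closed_piece[OF j] ..
    also have "\<dots> = (LINT x:coord_cball j|lborel.
        ((part j \<circ> chart_inv ?c) x * laplacian (g ?c) (v \<circ> chart_inv ?c) x
          + grad_dot (g ?c) (part j \<circ> chart_inv ?c) (v \<circ> chart_inv ?c) x) * dens ?c x)"
    proof (rule set_lebesgue_integral_cong)
      show "\<forall>x. x \<in> coord_cball j \<longrightarrow>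
          (part j (chart_inv ?c x) * F (chart_inv ?c x) + \<Gamma> j (chart_inv ?c x)) * dens ?c x =
          ((part j \<circ> chart_inv ?c) x * laplacian (g ?c) (v \<circ> chart_inv ?c) x
            + grad_dot (g ?c) (part j \<circ> chart_inv ?c) (v \<circ> chart_inv ?c) x) * dens ?c x"
      proof (intro allI impI)
        fix x assume "x \<in> coord_cball j"
        then have "x \<in> chart_im ?c"
          using cover_cball[OF j] by blast
        then show "(part j (chart_inv ?c x) * F (chart_inv ?c x) + \<Gamma> j (chart_inv ?c x)) * dens ?c x =
          ((part j \<circ> chart_inv ?c) x * laplacian (g ?c) (v \<circ> chart_inv ?c) x
            + grad_dot (g ?c) (part j \<circ> chart_inv ?c) (v \<circ> chart_inv ?c) x) * dens ?c x"
          by (simp only: lap[OF c] \<Gamma>[OF j c] o_apply)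
      qed
    qed simp
    also have "\<dots> = 0"
      by (rule local_green[OF open_chart_im[OF c] C1_metric_component[OF c] det_metric_pos[OF c]
            symmetric_metric[OF c] v[OF c] C1_part[OF j c] compact_cball cover_cball[OF j] supp])
    finally show ?thesis .
  qed
  have "F p = (\<Sum>j\<in>cover. part j p * F p + \<Gamma> j p)" for p
  proof -
    let ?c = "chart_at A p"
    note c = chart_at_mem[of p]
    have "(\<Sum>j\<in>cover. pd i (part j \<circ> chart_inv ?c) (coord ?c p)) = 0" for i
    proof -
      have "(\<Sum>j\<in>cover. pd i (part j \<circ> chart_inv ?c) (coord ?c p)) =
          pd i (\<lambda>y. \<Sum>j\<in>cover. (part j \<circ> chart_inv ?c) y) (coord ?c p)"
        using c by (intro pd_sum[symmetric] Ck_on_Suc_differentiable[OF C1_part]) auto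
      then show ?thesis
        by (simp add: sum_part pd_const)
    qed
    then have "(\<Sum>j\<in>cover. \<Gamma> j p) = 0"
      unfolding \<Gamma>_def Let_def grad_dot_def
      \<comment> \<open>The sum over the cover is moved inside to meet the only factor depending on
        \<open>j\<close>, the partial derivative of \<open>part j\<close>.\<close>
      by (subst sum.swap, subst sum.swap)
        (simp add: sum.swap[of _ cover] flip: sum_distrib_left sum_distrib_right)
    then show ?thesis
      using sum_part[of p] by (simp add: sum.distrib flip: sum_distrib_right)
  qed
  then have "(LINT p|vol_measure A g. F p) = (LINT p|vol_measure A g. (\<Sum>j\<in>cover. part j p * F p + \<Gamma> j p))"
    by (rule Bochner_Integration.integral_cong[OF refl])
  also have "\<dots> = (\<Sum>j\<in>cover. LINT p|vol_measure A g. part j p * F p + \<Gamma> j p)"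
    by (intro Bochner_Integration.integral_sum integrable_vol_measure_continuous cont)
  also have "\<dots> = 0"
    by (simp add: zero)
  finally show ?thesis .
qed

end

section \<open>Einstein flows\<close>

lemma trace_wrt_eq_trace: "trace_wrt G T x = trace (ginv G x ** transpose (T x))"
  unfolding trace_wrt_def by (rule sum_mult_eq_trace)

text \<open>In trace form the Jacobians of a change of chart can be collected by cyclicity.\<close>

lemma norm2_wrt_eq_trace: "norm2_wrt G T x = trace (T x ** ginv G x ** transpose (T x) ** transpose (ginv G x))"
proof -
  have "norm2_wrt G T x =
      (\<Sum>i\<in>UNIV. \<Sum>j\<in>UNIV. T x $ i $ j * (ginv G x ** T x ** transpose (ginv G x)) $ i $ j)"
    unfolding norm2_wrt_def
  proof (intro sum.cong refl)
    fix i j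
    have "(\<Sum>k\<in>UNIV. \<Sum>l\<in>UNIV. ginv G x $ i $ k * ginv G x $ j $ l * T x $ i $ j * T x $ k $ l) =
        (\<Sum>l\<in>UNIV. \<Sum>k\<in>UNIV. ginv G x $ i $ k * ginv G x $ j $ l * T x $ i $ j * T x $ k $ l)"
      by (rule sum.swap)
    then show "(\<Sum>k\<in>UNIV. \<Sum>l\<in>UNIV. ginv G x $ i $ k * ginv G x $ j $ l * T x $ i $ j * T x $ k $ l) =
        T x $ i $ j * (ginv G x ** T x ** transpose (ginv G x)) $ i $ j"
      by (simp add: matrix_matrix_mult_def transpose_def sum_distrib_left sum_distrib_right mult_ac)
  qed
  then show ?thesis
    by (simp add: sum_mult_eq_trace matrix_transpose_mul matrix_mul_assoc)
qed

context riemannian_manifold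
begin

text \<open>Cyclicity of the trace brings the Jacobians next to the inverse metric, where
  \<open>congruence_matrix_inv\<close> absorbs them.\<close>

lemma
  assumes c: "c \<in> A" and d: "d \<in> A" and p: "p \<in> chart_dom c \<inter> chart_dom d" and T: "tensor2_field A T"
  shows trace_wrt_change_of_chart:
      "trace_wrt (g c) (T c) (coord c p) = trace_wrt (g d) (T d) (coord d p)" (is ?trace)
    and norm2_traceless_change_of_chart:
      "norm2_wrt (g c) (traceless_part (g c) (T c)) (coord c p) =
       norm2_wrt (g d) (traceless_part (g d) (T d)) (coord d p)" (is ?norm)
proof -
  let ?J = "jacobian c d (coord c p)"
  have "det (g c (coord c p)) \<noteq> 0"
    using det_metric_pos[OF c, of "coord c p"] p by auto
  then have inv: "?J ** ginv (g c) (coord c p) ** transpose ?J = ginv (g d) (coord d p)"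
    unfolding metric_transform[OF c d p] by (rule congruence_matrix_inv)
  then have inv_transpose:
    "?J ** transpose (ginv (g c) (coord c p)) ** transpose ?J = transpose (ginv (g d) (coord d p))"
    by (metis matrix_mul_assoc matrix_transpose_mul transpose_transpose)
  have T_transform: "T c (coord c p) = transpose ?J ** T d (coord d p) ** ?J"
    using T c d p unfolding tensor2_field_def Let_def by blast
  have "trace_wrt (g c) (T c) (coord c p) =
      trace ((ginv (g c) (coord c p) ** transpose ?J ** transpose (T d (coord d p))) ** ?J)"
    by (simp add: trace_wrt_eq_trace T_transform matrix_transpose_mul matrix_mul_assoc)
  also have "\<dots> = trace (?J ** ginv (g c) (coord c p) ** transpose ?J ** transpose (T d (coord d p)))"
    by (subst trace_mul_sym) (simp add: matrix_mul_assoc)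
  also have "\<dots> = trace_wrt (g d) (T d) (coord d p)"
    by (simp add: inv trace_wrt_eq_trace)
  finally show ?trace .
  let ?P = "\<lambda>c. traceless_part (g c) (T c)"
  \<comment> \<open>The traceless part is itself a tensor because its coefficient, the trace, has
    just been shown to be the same in both charts.\<close>
  have P: "?P c (coord c p) = transpose ?J ** ?P d (coord d p) ** ?J"
    unfolding traceless_part_def \<open>?trace\<close> metric_transform[OF c d p] T_transform
    by (simp add: matrix_sub_ldistrib matrix_sub_rdistrib matrix_scalar_ac scalar_matrix_assoc)
  have "norm2_wrt (g c) (?P c) (coord c p) = trace (transpose ?J **
      (?P d (coord d p) ** (?J ** ginv (g c) (coord c p) ** transpose ?J) ** transpose (?P d (coord d p)) **
        ?J ** transpose (ginv (g c) (coord c p))))"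
    by (simp add: norm2_wrt_eq_trace P matrix_transpose_mul matrix_mul_assoc)
  also have "\<dots> = trace (?P d (coord d p) ** ginv (g d) (coord d p) ** transpose (?P d (coord d p)) **
      (?J ** transpose (ginv (g c) (coord c p)) ** transpose ?J))"
    unfolding inv by (subst trace_mul_sym) (simp add: matrix_mul_assoc)
  also have "\<dots> = norm2_wrt (g d) (?P d) (coord d p)"
    unfolding inv_transpose by (simp add: norm2_wrt_eq_trace)
  finally show ?norm .
qed

end

text \<open>To be read with \<open>B\<close> the Hessian of the lapse and \<open>C\<close> the Ricci
  tensor. Differentiating the inverse metric contributes
  \<open>2 * N * trace (I ** k ** I ** k)\<close>, with \<open>I\<close> the inverse metric, and the
  quadratic term in the evolution of \<open>k\<close> cancels it, so that only
  \<open>N * H\<^sup>2\<close> survives.\<close>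

lemma evolution_of_trace:
  fixes M k :: "real \<Rightarrow> real^'n^'n"
  assumes M: "\<And>i j. ((\<lambda>s. M s $ i $ j) has_real_derivative - 2 * N * k t $ i $ j) (at t within S)"
    and k: "\<And>i j. ((\<lambda>s. k s $ i $ j) has_real_derivative
        N * H * k t $ i $ j - 2 * N * (k t ** matrix_inv (M t) ** k t) $ i $ j - B i j + N * C i j) (at t within S)"
    and nz: "\<And>s. s \<in> S \<Longrightarrow> det (M s) \<noteq> 0" and t: "t \<in> S"
    and sym: "transpose (M t) = M t" "transpose (k t) = k t"
    and H: "H = (\<Sum>i\<in>UNIV. \<Sum>j\<in>UNIV. matrix_inv (M t) $ i $ j * k t $ i $ j)"
  shows "((\<lambda>s. \<Sum>i\<in>UNIV. \<Sum>j\<in>UNIV. matrix_inv (M s) $ i $ j * k s $ i $ j) has_real_derivative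
      N * H\<^sup>2 - (\<Sum>i\<in>UNIV. \<Sum>j\<in>UNIV. matrix_inv (M t) $ i $ j * B i j)
        + N * (\<Sum>i\<in>UNIV. \<Sum>j\<in>UNIV. matrix_inv (M t) $ i $ j * C i j)) (at t within S)"
proof -
  let ?I = "matrix_inv (M t)" and ?k = "k t"
  let ?Q = "?k ** ?I ** ?k"
  have symI: "transpose ?I = ?I"
    using transpose_matrix_inv[OF nz[OF t]] sym(1) by simp
  have inv: "((\<lambda>s. matrix_inv (M s) $ i $ j) has_real_derivative 2 * N * (?I ** ?k ** ?I) $ i $ j) (at t within S)"
    for i j
  proof -
    have "((\<lambda>s. matrix_inv (M s) $ i $ j) has_real_derivative
        - (?I ** ((- 2 * N) *\<^sub>R ?k) ** ?I) $ i $ j) (at t within S)"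
      using M by (intro has_real_derivative_matrix_inv nz t) simp_all
    moreover have "?I ** ((- 2 * N) *\<^sub>R ?k) ** ?I = (- 2 * N) *\<^sub>R (?I ** ?k ** ?I)"
      by (simp only: scalar_matrix_assoc matrix_scalar_ac)
    ultimately show ?thesis by simp
  qed
  let ?d = "\<lambda>i j. N * H * ?k $ i $ j - 2 * N * ?Q $ i $ j - B i j + N * C i j"
  have "((\<lambda>s. \<Sum>i\<in>UNIV. \<Sum>j\<in>UNIV. matrix_inv (M s) $ i $ j * k s $ i $ j) has_real_derivative
      (\<Sum>i\<in>UNIV. \<Sum>j\<in>UNIV. 2 * N * (?I ** ?k ** ?I) $ i $ j * ?k $ i $ j + ?d i j * ?I $ i $ j)) (at t within S)"
    by (intro DERIV_sum DERIV_mult inv k)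
  also have "(\<Sum>i\<in>UNIV. \<Sum>j\<in>UNIV. 2 * N * (?I ** ?k ** ?I) $ i $ j * ?k $ i $ j + ?d i j * ?I $ i $ j) =
      2 * N * (\<Sum>i\<in>UNIV. \<Sum>j\<in>UNIV. (?I ** ?k ** ?I) $ i $ j * ?k $ i $ j)
      + N * H * (\<Sum>i\<in>UNIV. \<Sum>j\<in>UNIV. ?I $ i $ j * ?k $ i $ j)
      - 2 * N * (\<Sum>i\<in>UNIV. \<Sum>j\<in>UNIV. ?I $ i $ j * ?Q $ i $ j)
      - (\<Sum>i\<in>UNIV. \<Sum>j\<in>UNIV. ?I $ i $ j * B i j) + N * (\<Sum>i\<in>UNIV. \<Sum>j\<in>UNIV. ?I $ i $ j * C i j)"
    unfolding sum_distrib_left sum.distrib[symmetric] sum_subtractf[symmetric]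
    by (intro sum.cong refl) (simp add: algebra_simps)
  also have "(\<Sum>i\<in>UNIV. \<Sum>j\<in>UNIV. (?I ** ?k ** ?I) $ i $ j * ?k $ i $ j) = trace (?I ** ?Q)"
    by (simp add: sum_mult_eq_trace sym(2) matrix_mul_assoc)
  also have "(\<Sum>i\<in>UNIV. \<Sum>j\<in>UNIV. ?I $ i $ j * ?Q $ i $ j) = trace (?I ** ?Q)"
    by (simp add: sum_mult_eq_trace matrix_transpose_mul sym(2) symI matrix_mul_assoc)
  finally show ?thesis
    by (simp add: H power2_eq_square mult.assoc)
qed

section \<open>Consequences of the flow equations on a time slice\<close>

locale hubble_time_einstein_flow = compact_manifold A
  for A :: "('a::{t2_space,second_countable_topology}, 3) chart set" +
  fixes L :: "real \<Rightarrow> 'a \<Rightarrow> real" and h K :: "real \<Rightarrow> ('a, 3) tensor2" and t0 :: real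
  assumes flow: "einstein_flow A {0<..t0} L h K"
    and hubble_time: "\<And>t p. t \<in> {0<..t0} \<Longrightarrow> t = - 3 / mean_curvature A (h t) (K t) p"
begin

lemma
  assumes "t \<in> {0<..t0}"
  shows symmetric_h: "symmetric_tensor2 A (h t)" and pos_def_h: "pos_def_tensor2 A (h t)"
    and symmetric_K: "symmetric_tensor2 A (K t)" and constraints: "constraint_equations A (h t) (K t)"
  using flow assms unfolding einstein_flow_def by blast+

lemma
  assumes "c \<in> A"
  shows smooth_h: "smooth_on ({0<..t0} \<times> chart_im c) (\<lambda>(t, x). h t c x)"
    and smooth_L: "smooth_on ({0<..t0} \<times> chart_im c) (\<lambda>(t, x). (L t \<circ> chart_inv c) x)"
  using flow assms
  unfolding einstein_flow_def smooth_tensor2_family_def smooth_function_family_def o_def by blast+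

lemma
  assumes "t \<in> {0<..t0}" "c \<in> A"
  shows Ck_h: "Ck_on k (h t c) (chart_im c)" and Ck_L: "Ck_on k (L t \<circ> chart_inv c) (chart_im c)"
  using smooth_on_slice[OF smooth_h open_chart_im] smooth_on_slice[OF smooth_L open_chart_im] assms
  by blast+

text \<open>Lets the results on volume and Laplacians be interpreted separately at each fixed
  time.\<close>

lemma riemannian:
  assumes "t \<in> {0<..t0}"
  shows "compact_riemannian_3_manifold A (h t)"
proof
  show "tensor2_field A (h t)"
    using symmetric_h[OF assms] unfolding symmetric_tensor2_def by blast
  show "transpose (h t c x) = h t c x" if "c \<in> A" "x \<in> chart_im c" for c x
    using symmetric_h[OF assms] that unfolding symmetric_tensor2_def by blast
  show "continuous_on (chart_im c) (h t c)" if "c \<in> A" for c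
    using Ck_h[OF assms that, of 0] by simp
  show "Ck_on (Suc 0) (h t c) (chart_im c)" if "c \<in> A" for c
    by (rule Ck_h[OF assms that])
qed (rule pos_def_h[OF assms])

lemma continuous_on_L:
  assumes "t \<in> {0<..t0}"
  shows "continuous_on UNIV (L t)"
proof (rule continuous_on_charts)
  show "continuous_on (chart_im c) (L t \<circ> chart_inv c)" if "c \<in> A" for c
    using Ck_L[OF assms that, of 0] by simp
qed

lemma chart_at_chart_inv:
  assumes "c \<in> A" "x \<in> chart_im c"
  shows "chart_inv c x \<in> chart_dom (chart_at A (chart_inv c x)) \<inter> chart_dom c"
  using chart_at_mem(2) chart_inv_in[OF assms] by blast

lemma trace_K:
  assumes t: "t \<in> {0<..t0}" and c: "c \<in> A" and x: "x \<in> chart_im c"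
  shows "trace_wrt (h t c) (K t c) x = - 3 / t"
proof -
  interpret compact_riemannian_3_manifold A "h t" by (rule riemannian[OF t])
  let ?p = "chart_inv c x"
  have K: "tensor2_field A (K t)"
    using symmetric_K[OF t] unfolding symmetric_tensor2_def by blast
  have "mean_curvature A (h t) (K t) ?p = trace_wrt (h t c) (K t c) x"
    unfolding mean_curvature_def Let_def
      trace_wrt_change_of_chart[OF chart_at_mem(1) c chart_at_chart_inv[OF c x] K] coord_chart_inv[OF c x] ..
  \<comment> \<open>Division by zero yields 0, so a vanishing mean curvature would give
    \<open>t = 0\<close>.\<close>
  moreover have "t > 0" "mean_curvature A (h t) (K t) ?p \<noteq> 0"
    using hubble_time[OF t, of ?p] t by auto
  moreover from this(2) have "t * mean_curvature A (h t) (K t) ?p = - 3"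
    using hubble_time[OF t, of ?p] by (rule nonzero_eq_divide_eq[THEN iffD1])
  ultimately show ?thesis
    by (simp add: field_simps)
qed

text \<open>By the Hamiltonian constraint the scalar curvature is an algebraic expression in \<open>h\<close> and \<open>K\<close>, so
  its independence of the chart needs no transformation law for second derivatives.\<close>

lemma scalar_curvature_chart:
  assumes t: "t \<in> {0<..t0}" and c: "c \<in> A" and x: "x \<in> chart_im c"
  shows "scalar_curvature A (h t) (chart_inv c x) = scal (h t c) x"
proof -
  interpret compact_riemannian_3_manifold A "h t" by (rule riemannian[OF t])
  let ?d = "chart_at A (chart_inv c x)"
  note p = chart_at_chart_inv[OF c x]
  have K: "tensor2_field A (K t)"
    using symmetric_K[OF t] unfolding symmetric_tensor2_def by blast
  have constr: "scal (h t b) y = norm2_wrt (h t b) (traceless_part (h t b) (K t b)) y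
      - (1 - 1 / real CARD(3)) * (trace_wrt (h t b) (K t b) y)\<^sup>2" if "b \<in> A" "y \<in> chart_im b" for b y
  proof -
    have "scal (h t b) y - norm2_wrt (h t b) (traceless_part (h t b) (K t b)) y
      + (1 - 1 / real CARD(3)) * (trace_wrt (h t b) (K t b) y)\<^sup>2 = 0"
      by (rule constraints[OF t, unfolded constraint_equations_def, rule_format, OF that, THEN conjunct1])
    then show ?thesis by linarith
  qed
  have im: "coord ?d (chart_inv c x) \<in> chart_im ?d"
    by (rule imageI) (rule chart_at_mem)
  show ?thesis
    unfolding scalar_curvature_def Let_def constr[OF chart_at_mem(1) im] constr[OF c x]
      trace_wrt_change_of_chart[OF chart_at_mem(1) c p K]
      norm2_traceless_change_of_chart[OF chart_at_mem(1) c p K] coord_chart_inv[OF c x] ..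
qed

lemma
  assumes t: "t \<in> {0<..t0}" and c: "c \<in> A" and x: "x \<in> chart_im c"
  shows h_evolution: "((\<lambda>s. h s c x $ i $ j) has_real_derivative
      - 2 * L t (chart_inv c x) * K t c x $ i $ j) (at t within {0<..t0})"
    and K_evolution: "((\<lambda>s. K s c x $ i $ j) has_real_derivative
      L t (chart_inv c x) * trace_wrt (h t c) (K t c) x * K t c x $ i $ j
      - 2 * L t (chart_inv c x) * (K t c x ** ginv (h t c) x ** K t c x) $ i $ j
      - hessian (h t c) (L t \<circ> chart_inv c) i j x
      + L t (chart_inv c x) * ricci (h t c) i j x) (at t within {0<..t0})"
proof -
  have "evolution_equations A {0<..t0} L h K"
    using flow unfolding einstein_flow_def by blast
  note * = this[unfolded evolution_equations_def Let_def o_apply, rule_format, OF t c x, of i j]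
  show "((\<lambda>s. h s c x $ i $ j) has_real_derivative
      - 2 * L t (chart_inv c x) * K t c x $ i $ j) (at t within {0<..t0})"
    using * by blast
  have "(\<Sum>a\<in>UNIV. \<Sum>b\<in>UNIV. ginv (h t c) x $ a $ b * K t c x $ i $ a * K t c x $ b $ j) =
      (\<Sum>b\<in>UNIV. \<Sum>a\<in>UNIV. ginv (h t c) x $ a $ b * K t c x $ i $ a * K t c x $ b $ j)"
    by (rule sum.swap)
  also have "\<dots> = (K t c x ** ginv (h t c) x ** K t c x) $ i $ j"
    unfolding matrix_matrix_mult_def vec_lambda_beta sum_distrib_right
    by (intro sum.cong refl) (simp add: mult_ac)
  finally show "((\<lambda>s. K s c x $ i $ j) has_real_derivative
      L t (chart_inv c x) * trace_wrt (h t c) (K t c) x * K t c x $ i $ j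
      - 2 * L t (chart_inv c x) * (K t c x ** ginv (h t c) x ** K t c x) $ i $ j
      - hessian (h t c) (L t \<circ> chart_inv c) i j x
      + L t (chart_inv c x) * ricci (h t c) i j x) (at t within {0<..t0})"
    using * by (simp add: comp_def)
qed

lemma laplacian_lapse:
  assumes t: "t \<in> {0<..t0}" and c: "c \<in> A" and x: "x \<in> chart_im c"
  shows "laplacian (h t c) (L t \<circ> chart_inv c) x =
    9 / t\<^sup>2 * L t (chart_inv c x) + L t (chart_inv c x) * scal (h t c) x - 3 / t\<^sup>2"
proof -
  let ?N = "L t (chart_inv c x)"
  have sym: "transpose (h t c x) = h t c x" "transpose (K t c x) = K t c x"
    using symmetric_h[OF t] symmetric_K[OF t] c x unfolding symmetric_tensor2_def by blast+
  have nz: "det (h s c x) \<noteq> 0" if "s \<in> {0<..t0}" for s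
  proof -
    interpret compact_riemannian_3_manifold A "h s" by (rule riemannian[OF that])
    show ?thesis using det_metric_pos[OF c x] by simp
  qed
  \<comment> \<open>The trace of \<open>K\<close> is differentiated twice over: here from the
    evolution equations, in \<open>D2\<close> from its explicit value \<open>- 3 / s\<close>.
    Comparing the two isolates the Laplacian of the lapse.\<close>
  have D1: "((\<lambda>s. trace_wrt (h s c) (K s c) x) has_real_derivative
      ?N * (trace_wrt (h t c) (K t c) x)\<^sup>2 - laplacian (h t c) (L t \<circ> chart_inv c) x + ?N * scal (h t c) x)
      (at t within {0<..t0})"
    using evolution_of_trace[OF h_evolution[OF t c x] K_evolution[OF t c x] nz t sym]
    by (simp add: trace_wrt_def laplacian_def scal_def)
  have D2: "((\<lambda>s. trace_wrt (h s c) (K s c) x) has_real_derivative 3 / t\<^sup>2) (at t within {0<..t0})"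
  proof (rule has_field_derivative_transform_within[of "\<lambda>s. - 3 / s" _ _ _ 1])
    have "((\<lambda>s. - 3 * inverse s) has_real_derivative - 3 * - (inverse t ^ Suc (Suc 0))) (at t within {0<..t0})"
      using t by (intro DERIV_cmult DERIV_inverse) simp
    then show "((\<lambda>s. - 3 / s) has_real_derivative 3 / t\<^sup>2) (at t within {0<..t0})"
      by (simp add: power2_eq_square divide_inverse)
  qed (use t in \<open>simp_all add: trace_K[OF _ c x]\<close>)
  \<comment> \<open>Derivatives within a set are unique only at points that are not isolated in
    it.\<close>
  have "at t within {0<..t0} \<noteq> bot"
  proof -
    have "t / 2 \<in> {0<..t0}" "t / 2 \<noteq> t"
      using t by auto
    then have "{0<..t0} \<noteq> {s}" for s
      using t by (metis singletonD)
    then have "t islimpt {0<..t0}"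
      using t by (intro connected_imp_perfect convex_connected convex_real_interval)
    then show ?thesis
      by (simp add: trivial_limit_within)
  qed
  then have "?N * (trace_wrt (h t c) (K t c) x)\<^sup>2 - laplacian (h t c) (L t \<circ> chart_inv c) x
      + ?N * scal (h t c) x = 3 / t\<^sup>2"
    by (rule vector_derivative_unique_within[OF _ D1[unfolded has_real_derivative_iff_has_vector_derivative]
          D2[unfolded has_real_derivative_iff_has_vector_derivative]])
  then show ?thesis
    unfolding trace_K[OF t c x] by (simp add: power_divide mult.commute)
qed

end

section \<open>Volume, lapse and curvature integrals as functions of time\<close>

context hubble_time_einstein_flow
begin

abbreviation scal_lapse_integral :: "real \<Rightarrow> real" where
  "scal_lapse_integral t \<equiv> (LINT p|vol_measure A (h t). L t p * scalar_curvature A (h t) p)"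

abbreviation lapse_integral :: "real \<Rightarrow> real" where
  "lapse_integral t \<equiv> (LINT p|vol_measure A (h t). L t p)"

lemma
  assumes t: "t \<in> {0<..t0}"
  shows integrable_scal_lapse: "integrable (vol_measure A (h t)) (\<lambda>p. L t p * scalar_curvature A (h t) p)"
    and scal_lapse_integral_eq: "scal_lapse_integral t = 3 / t\<^sup>2 * vol A (h t) - 9 / t\<^sup>2 * lapse_integral t"
proof -
  interpret compact_riemannian_3_manifold A "h t" by (rule riemannian[OF t])
  let ?S = "\<lambda>p. L t p * scalar_curvature A (h t) p"
  let ?F = "\<lambda>p. 9 / t\<^sup>2 * L t p + ?S p - 3 / t\<^sup>2"
  have lap: "laplacian (h t c) (L t \<circ> chart_inv c) x = ?F (chart_inv c x)" if "c \<in> A" "x \<in> chart_im c" for c x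
    by (simp only: laplacian_lapse[OF t that] scalar_curvature_chart[OF t that])
  have L2: "Ck_on (Suc (Suc 0)) (L t \<circ> chart_inv c) (chart_im c)" if "c \<in> A" for c
    by (rule Ck_L[OF t that])
  have L: "continuous_on UNIV (L t)"
    by (rule continuous_on_L[OF t])
  \<comment> \<open>The lapse equation expresses \<open>L * R\<close> by the Laplacian of the lapse,
    which is the divergence of a C1 flux divided by the density. Continuity follows without
    differentiating Christoffel symbols.\<close>
  have S: "continuous_on UNIV ?S"
  proof (rule continuous_on_charts)
    fix c assume c: "c \<in> A"
    have "continuous_on (chart_im c) (\<lambda>x. laplacian (h t c) (L t \<circ> chart_inv c) x - 9 / t\<^sup>2 * (L t \<circ> chart_inv c) x + 3 / t\<^sup>2)"
    proof (intro continuous_on_add continuous_on_diff continuous_on_mult continuous_on_const)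
      show "continuous_on (chart_im c) (L t \<circ> chart_inv c)"
        using Ck_L[OF t c, of 0] by simp
      have "continuous_on (chart_im c) (\<lambda>x. (\<Sum>i\<in>UNIV. pd i (flux (h t c) (L t \<circ> chart_inv c) i) x) / dens c x)"
      proof (intro continuous_on_divide continuous_on_sum continuous_on_pd continuous_on_dens c ballI)
        show "Ck_on (Suc 0) (flux (h t c) (L t \<circ> chart_inv c) i) (chart_im c)" for i
          by (rule C1_on_flux[OF open_chart_im[OF c] C1_metric_component[OF c] det_metric_pos[OF c] L2[OF c]])
        show "dens c x \<noteq> 0" if "x \<in> chart_im c" for x
          using det_metric_pos[OF c that] by simp
      qed
      then show "continuous_on (chart_im c) (laplacian (h t c) (L t \<circ> chart_inv c))"
      proof (rule continuous_on_eq)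
        fix x assume x: "x \<in> chart_im c"
        show "(\<Sum>i\<in>UNIV. pd i (flux (h t c) (L t \<circ> chart_inv c) i) x) / dens c x =
            laplacian (h t c) (L t \<circ> chart_inv c) x"
          using divergence_flux[OF open_chart_im[OF c] x C1_metric_component[OF c] det_metric_pos[OF c]
              symmetric_metric[OF c] L2[OF c]] det_metric_pos[OF c x] by simp
      qed
    qed
    then show "continuous_on (chart_im c) (?S \<circ> chart_inv c)"
      by (rule continuous_on_eq) (simp add: lap[OF c])
  qed
  show int_S: "integrable (vol_measure A (h t)) ?S"
    by (rule integrable_vol_measure_continuous[OF S])
  have F: "continuous_on UNIV ?F"
    by (intro continuous_on_diff continuous_on_add continuous_on_mult continuous_on_const L S)
  have "0 = (LINT p|vol_measure A (h t). ?F p)"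
    by (rule integral_laplacian_eq_0[OF L2 F lap, symmetric])
  also have "\<dots> = 9 / t\<^sup>2 * lapse_integral t + scal_lapse_integral t - 3 / t\<^sup>2 * vol A (h t)"
  proof -
    have int_L: "integrable (vol_measure A (h t)) (\<lambda>p. 9 / t\<^sup>2 * L t p)"
      by (intro integrable_mult_right integrable_vol_measure_continuous L)
    have int_1: "integrable (vol_measure A (h t)) (\<lambda>p. 3 / t\<^sup>2)"
      by (intro integrable_vol_measure_continuous continuous_on_const)
    have "(LINT p|vol_measure A (h t). 3 / t\<^sup>2) = (LINT p|vol_measure A (h t). 3 / t\<^sup>2 * 1)"
      by simp
    also have "\<dots> = 3 / t\<^sup>2 * vol A (h t)"
      unfolding vol_eq_integral by (rule integral_mult_right_zero)
    finally have one: "(LINT p|vol_measure A (h t). 3 / t\<^sup>2) = 3 / t\<^sup>2 * vol A (h t)" .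
    show ?thesis
      unfolding Bochner_Integration.integral_diff[OF Bochner_Integration.integrable_add[OF int_L int_S] int_1]
        Bochner_Integration.integral_add[OF int_L int_S] one integral_mult_right_zero ..
  qed
  finally show "scal_lapse_integral t = 3 / t\<^sup>2 * vol A (h t) - 9 / t\<^sup>2 * lapse_integral t"
    by linarith
qed

text \<open>Jacobi's formula with derivative \<open>-2 * L * K\<close> and trace of \<open>K\<close>
  equal to \<open>- 3 / t\<close> gives the logarithmic derivative \<open>6 * L / t\<close> of the
  determinant; the square root halves it.\<close>

lemma dens_evolution:
  assumes t: "t \<in> {0<..t0}" and c: "c \<in> A" and x: "x \<in> chart_im c"
  shows "((\<lambda>s. sqrt (det (h s c x))) has_real_derivative
    3 / t * (L t (chart_inv c x) * sqrt (det (h t c x)))) (at t within {0<..t0})"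
proof -
  interpret compact_riemannian_3_manifold A "h t" by (rule riemannian[OF t])
  let ?N = "L t (chart_inv c x)" and ?D = "(- 2 * L t (chart_inv c x)) *\<^sub>R K t c x"
  have pos: "det (h t c x) > 0"
    by (rule det_metric_pos[OF c x])
  have "transpose (K t c x) = K t c x"
    using symmetric_K[OF t] c x unfolding symmetric_tensor2_def by blast
  then have "trace (ginv (h t c) x ** K t c x) = - 3 / t"
    using trace_K[OF t c x] by (simp add: trace_wrt_eq_trace)
  moreover have "trace (ginv (h t c) x ** ?D) = - 2 * ?N * trace (ginv (h t c) x ** K t c x)"
    by (simp only: matrix_scalar_ac scalar_matrix_assoc[symmetric] trace_def vector_scaleR_component
        real_scaleR_def sum_distrib_left[symmetric])
  ultimately have trace: "trace (ginv (h t c) x ** ?D) = 6 * ?N / t"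
    by simp
  have det: "((\<lambda>s. det (h s c x)) has_real_derivative det (h t c x) * trace (ginv (h t c) x ** ?D)) (at t within {0<..t0})"
    using h_evolution[OF t c x] pos by (intro has_real_derivative_det) simp_all
  have "((\<lambda>s. sqrt (det (h s c x))) has_real_derivative
      inverse (sqrt (det (h t c x))) / 2 * (det (h t c x) * trace (ginv (h t c) x ** ?D))) (at t within {0<..t0})"
    by (rule DERIV_chain2[where f = sqrt and g = "\<lambda>s. det (h s c x)" and x = t, OF DERIV_real_sqrt[OF pos] det])
  also have "inverse (sqrt (det (h t c x))) / 2 * (det (h t c x) * trace (ginv (h t c) x ** ?D)) =
      3 / t * (?N * (det (h t c x) / sqrt (det (h t c x))))"
    unfolding trace by (simp add: inverse_eq_divide mult_ac)
  also have "det (h t c x) / sqrt (det (h t c x)) = sqrt (det (h t c x))"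
    using pos by (intro real_div_sqrt) simp
  finally show ?thesis .
qed

lemma continuous_on_lapse_dens_family:
  assumes c: "c \<in> A"
  shows "continuous_on ({0<..t0} \<times> chart_im c) (\<lambda>(t, x). L t (chart_inv c x) * sqrt (det (h t c x)))"
proof -
  have "continuous_on ({0<..t0} \<times> chart_im c) (\<lambda>z. (\<lambda>(t, x). h t c x) z $ i $ j)" for i j
    by (intro continuous_on_component smooth_on_imp_continuous_on smooth_h c)
  from continuous_on_real_sqrt[OF continuous_on_det[OF this]]
  have dens: "continuous_on ({0<..t0} \<times> chart_im c) (\<lambda>(t, x). sqrt (det (h t c x)))"
    by (simp add: case_prod_beta)
  have "continuous_on ({0<..t0} \<times> chart_im c) (\<lambda>(t, x). (L t \<circ> chart_inv c) x)"
    by (rule smooth_on_imp_continuous_on[OF smooth_L[OF c]])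
  from continuous_on_mult[OF this dens]
  show "continuous_on ({0<..t0} \<times> chart_im c) (\<lambda>(t, x). L t (chart_inv c x) * sqrt (det (h t c x)))"
    by (simp add: case_prod_beta)
qed

lemma lapse_integral_pieces:
  assumes "t \<in> {0<..t0}"
  shows "lapse_integral t =
    (\<Sum>j\<in>cover. LINT x:coord_piece j|lborel. L t (chart_inv (fst j) x) * sqrt (det (h t (fst j) x)))"
proof -
  interpret compact_riemannian_3_manifold A "h t" by (rule riemannian[OF assms])
  show ?thesis
    by (rule integral_vol_measure_pieces[OF continuous_on_L[OF assms]])
qed

lemma vol_pieces:
  assumes "t \<in> {0<..t0}"
  shows "vol A (h t) = (\<Sum>j\<in>cover. LINT x:coord_piece j|lborel. sqrt (det (h t (fst j) x)))"
proof -
  interpret compact_riemannian_3_manifold A "h t" by (rule riemannian[OF assms])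
  show ?thesis
    using integral_vol_measure_pieces[OF continuous_on_const[of UNIV 1]] by (simp add: vol_eq_integral)
qed

text \<open>Time is kept in \<open>{a..t0}\<close> with \<open>a > 0\<close>: the product with a
  closed ball is then compact, which supplies the uniform bounds for dominated convergence.\<close>

lemma continuous_on_lapse_integral:
  assumes "a > 0"
  shows "continuous_on {a..t0} lapse_integral"
proof -
  have sub: "{a..t0} \<subseteq> {0<..t0}"
    using assms by auto
  have "continuous_on {a..t0} (\<lambda>t. LINT x:coord_piece j|lborel. L t (chart_inv (fst j) x) * sqrt (det (h t (fst j) x)))"
    if j: "j \<in> cover" for j
    by (rule continuous_on_set_integral_param[OF compact_cball coord_piece_borel[OF j] coord_piece_subset[OF j]
          continuous_on_subset[OF continuous_on_lapse_dens_family[OF cover_chart[OF j]] Sigma_mono[OF sub cover_cball[OF j]]]])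
  then have "continuous_on {a..t0} (\<lambda>t. \<Sum>j\<in>cover. LINT x:coord_piece j|lborel. L t (chart_inv (fst j) x) * sqrt (det (h t (fst j) x)))"
    by (rule continuous_on_sum)
  then show ?thesis
    by (rule continuous_on_eq) (use sub in \<open>simp add: lapse_integral_pieces subset_iff\<close>)
qed

text \<open>The cells do not move with time, so each summand is differentiated under the integral
  over a fixed subset of a closed ball, with the rate given by
  \<open>dens_evolution\<close>.\<close>

lemma has_real_derivative_vol:
  assumes a: "a > 0" and t: "t \<in> {a..t0}"
  shows "((\<lambda>s. vol A (h s)) has_real_derivative 3 / t * lapse_integral t) (at t within {a..t0})"
proof -
  have sub: "{a..t0} \<subseteq> {0<..t0}"
    using a by auto
  have t': "t \<in> {0<..t0}"
    using t sub by blast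
  have piece: "((\<lambda>s. LINT x:coord_piece j|lborel. sqrt (det (h s (fst j) x))) has_real_derivative
      (LINT x:coord_piece j|lborel. 3 / t * (L t (chart_inv (fst j) x) * sqrt (det (h t (fst j) x))))) (at t within {a..t0})"
    if j: "j \<in> cover" for j
  proof (rule has_real_derivative_set_integral_param[where
        f' = "\<lambda>t x. 3 / t * (L t (chart_inv (fst j) x) * sqrt (det (h t (fst j) x)))",
        OF compact_cball coord_piece_borel[OF j] coord_piece_subset[OF j]])
    note c = cover_chart[OF j] and K = cover_cball[OF j]
    show "continuous_on (coord_cball j) (\<lambda>x. sqrt (det (h s (fst j) x)))" if "s \<in> {a..t0}" for s
    proof -
      interpret compact_riemannian_3_manifold A "h s" by (rule riemannian[OF subsetD[OF sub that]])
      show ?thesis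
        by (rule continuous_on_subset[OF continuous_on_dens[OF c] K])
    qed
    have "continuous_on ({a..t0} \<times> coord_cball j) (\<lambda>z. 3 / fst z)"
      using a by (intro continuous_on_divide continuous_on_const continuous_on_fst continuous_on_id) auto
    from continuous_on_mult[OF this continuous_on_subset[OF continuous_on_lapse_dens_family[OF c] Sigma_mono[OF sub K]]]
    show "continuous_on ({a..t0} \<times> coord_cball j)
        (\<lambda>(t, x). 3 / t * (L t (chart_inv (fst j) x) * sqrt (det (h t (fst j) x))))"
      by (simp add: case_prod_beta)
    show "((\<lambda>s. sqrt (det (h s (fst j) x))) has_real_derivative
        3 / s * (L s (chart_inv (fst j) x) * sqrt (det (h s (fst j) x)))) (at s within {a..t0})"
      if "s \<in> {a..t0}" "x \<in> coord_cball j" for s x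
      by (rule DERIV_subset[OF dens_evolution[OF subsetD[OF sub that(1)] c subsetD[OF K that(2)]] sub])
  qed (rule t)
  have "((\<lambda>s. \<Sum>j\<in>cover. LINT x:coord_piece j|lborel. sqrt (det (h s (fst j) x))) has_real_derivative
      (\<Sum>j\<in>cover. LINT x:coord_piece j|lborel. 3 / t * (L t (chart_inv (fst j) x) * sqrt (det (h t (fst j) x)))))
      (at t within {a..t0})"
    by (rule DERIV_sum) (rule piece)
  also have "(\<Sum>j\<in>cover. LINT x:coord_piece j|lborel. 3 / t * (L t (chart_inv (fst j) x) * sqrt (det (h t (fst j) x)))) =
      3 / t * lapse_integral t"
    unfolding lapse_integral_pieces[OF t'] set_integral_mult_right sum_distrib_left ..
  finally show ?thesis
    by (rule has_field_derivative_transform_within[of _ _ _ _ 1]) (use t sub in \<open>simp_all add: vol_pieces subset_iff\<close>)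
qed

lemma has_real_derivative_vol_over_t:
  assumes a: "a > 0" and t: "t \<in> {a..t0}"
  shows "((\<lambda>s. inverse s * vol A (h s)) has_real_derivative - (1 / 3) * scal_lapse_integral t) (at t within {a..t0})"
proof -
  have t': "t \<in> {0<..t0}"
    using a t by simp
  have "t \<noteq> 0" using a t by auto
  from DERIV_mult[OF DERIV_inverse[OF this] has_real_derivative_vol[OF a t]]
  have "((\<lambda>s. inverse s * vol A (h s)) has_real_derivative
      - (inverse t ^ Suc (Suc 0)) * vol A (h t) + 3 / t * lapse_integral t * inverse t) (at t within {a..t0})" .
  also have "- (inverse t ^ Suc (Suc 0)) * vol A (h t) + 3 / t * lapse_integral t * inverse t =
      - (1 / 3) * scal_lapse_integral t"
    unfolding scal_lapse_integral_eq[OF t'] by (simp add: field_simps power2_eq_square)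
  finally show ?thesis .
qed

text \<open>Needed for the fundamental theorem of calculus. It is inferred from the expression by
  volume and lapse integral, so the dependence of the curvature on time is not examined.\<close>

lemma continuous_on_scal_lapse_integral:
  assumes "a > 0"
  shows "continuous_on {a..t0} scal_lapse_integral"
proof -
  have "continuous_on {a..t0} (\<lambda>s. vol A (h s))"
    by (rule DERIV_continuous_on[OF has_real_derivative_vol[OF assms]])
  then have "continuous_on {a..t0} (\<lambda>t. 3 / t\<^sup>2 * vol A (h t) - 9 / t\<^sup>2 * lapse_integral t)"
    using assms continuous_on_lapse_integral[OF assms]
    by (intro continuous_on_diff continuous_on_mult continuous_on_divide continuous_on_const continuous_on_power
        continuous_on_id) auto
  then show ?thesis
    by (rule continuous_on_eq) (use assms in \<open>simp add: scal_lapse_integral_eq\<close>)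
qed

text \<open>The powers of \<open>t\<close> cancel exactly, which makes the weighted integrand three
  times the derivative of \<open>vol / t\<close>.\<close>

lemma weighted_integral_eq:
  assumes "t \<in> {0<..t0}"
  shows "(LINT p|vol_measure A (h t). (- (t\<^sup>2) * scalar_curvature A (h t) p) * L t p / t) / t = - scal_lapse_integral t"
proof -
  have "t \<noteq> 0" using assms by simp
  then have "(- (t\<^sup>2) * r) * l / t = - t * (l * r)" for r l :: real
    by (simp add: power2_eq_square)
  then have "(LINT p|vol_measure A (h t). (- (t\<^sup>2) * scalar_curvature A (h t) p) * L t p / t) = - t * scal_lapse_integral t"
    by (simp only: integral_mult_right_zero)
  with \<open>t \<noteq> 0\<close> show ?thesis by simp
qed

end

text \<open>The clauses on finite mass and integrability exclude the default value 0 of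
  \<open>measure\<close> and of a Bochner integral that does not exist. The improper integral
  appears as a bound \<open>C\<close> independent of \<open>t1\<close>, since its integrand may
  change sign.\<close>

theorem theorem1p9:
  fixes A :: "('a::{t2_space,second_countable_topology}, 3) chart set"
    and L :: "real \<Rightarrow> 'a \<Rightarrow> real"
    and h K :: "real \<Rightarrow> ('a, 3) tensor2"
    and t0 :: real
  assumes manifold: "smooth_atlas A"
    and "compact (UNIV :: 'a set)" and "connected (UNIV :: 'a set)"
    and "t0 > 0"
    and flow: "einstein_flow A {0<..t0} L h K"
    and "cmc A {0<..t0} h K"
    and "crushing_singularity A {0<..t0} h K"
    and hubble_time: "\<forall>t\<in>{0<..t0}. \<forall>p. t = - 3 / mean_curvature A (h t) (K t) p"
  shows "(\<forall>t\<in>{0<..t0}.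
            emeasure (vol_measure A (h t)) UNIV < \<infinity> \<and>
            integrable (vol_measure A (h t)) (\<lambda>p. L t p * scalar_curvature A (h t) p) \<and>
            ((\<lambda>s. inverse s * vol A (h s)) has_real_derivative
               - (1 / 3) * (\<integral>p. L t p * scalar_curvature A (h t) p \<partial>vol_measure A (h t)))
              (at t within {0<..t0})) \<and>
         (\<forall>t1\<in>{0<..t0}. set_integrable lborel {t1..t0}
            (\<lambda>t. (\<integral>p. (- (t\<^sup>2) * scalar_curvature A (h t) p) * L t p / t \<partial>vol_measure A (h t)) / t)) \<and>
         (\<exists>C. \<forall>t1\<in>{0<..t0}.
            (LBINT t:{t1..t0}.
               (\<integral>p. (- (t\<^sup>2) * scalar_curvature A (h t) p) * L t p / t \<partial>vol_measure A (h t)) / t) \<le> C)"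
proof -
  interpret hubble_time_einstein_flow A L h K t0
    using manifold assms(2) flow hubble_time
    by (intro hubble_time_einstein_flow.intro compact_manifold.intro smooth_manifold.intro
        compact_manifold_axioms.intro hubble_time_einstein_flow_axioms.intro) blast+
  let ?w = "\<lambda>t. (LINT p|vol_measure A (h t). (- (t\<^sup>2) * scalar_curvature A (h t) p) * L t p / t) / t"
  have "emeasure (vol_measure A (h t)) UNIV < \<infinity> \<and>
      integrable (vol_measure A (h t)) (\<lambda>p. L t p * scalar_curvature A (h t) p) \<and>
      ((\<lambda>s. inverse s * vol A (h s)) has_real_derivative - (1 / 3) * scal_lapse_integral t) (at t within {0<..t0})"
    if t: "t \<in> {0<..t0}" for t
  proof (intro conjI)
    interpret compact_riemannian_3_manifold A "h t" by (rule riemannian[OF t])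
    show "emeasure (vol_measure A (h t)) UNIV < \<infinity>"
      by (rule emeasure_vol_measure_finite)
    show "integrable (vol_measure A (h t)) (\<lambda>p. L t p * scalar_curvature A (h t) p)"
      by (rule integrable_scal_lapse[OF t])
    \<comment> \<open>Near \<open>t\<close> the two intervals coincide, and \<open>t/2\<close> is a
      positive lower end as required for compact time intervals.\<close>
    have "at t within {0<..t0} = at t within {t/2..t0}"
      by (rule at_within_nhd[of _ "{t/2<..}"]) (use t in auto)
    then show "((\<lambda>s. inverse s * vol A (h s)) has_real_derivative - (1 / 3) * scal_lapse_integral t) (at t within {0<..t0})"
      using has_real_derivative_vol_over_t[of "t/2" t] t by simp
  qed
  moreover have "set_integrable lborel {t1..t0} ?w \<and>
      (LBINT t:{t1..t0}. ?w t) \<le> 3 * (inverse t0 * vol A (h t0))" if t1: "t1 \<in> {0<..t0}" for t1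
  proof -
    have "t1 > 0" "t1 \<le> t0"
      using t1 by auto
    have w: "?w t = - scal_lapse_integral t" if "t \<in> {t1..t0}" for t
      using that \<open>t1 > 0\<close> by (intro weighted_integral_eq) simp
    have cont: "continuous_on {t1..t0} (\<lambda>t. - scal_lapse_integral t)"
      by (intro continuous_on_minus continuous_on_scal_lapse_integral \<open>t1 > 0\<close>)
    have "continuous_on {t1..t0} ?w"
      using cont by (rule continuous_on_eq) (simp only: w)
    then have "set_integrable lborel {t1..t0} ?w"
      by (rule borel_integrable_atLeastAtMost')
    moreover have "(LBINT t:{t1..t0}. ?w t) = (LBINT t:{t1..t0}. - scal_lapse_integral t)"
      by (rule set_lebesgue_integral_cong) (use w in auto)
    moreover have "(LBINT t:{t1..t0}. - scal_lapse_integral t) =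
        3 * (inverse t0 * vol A (h t0)) - 3 * (inverse t1 * vol A (h t1))"
      unfolding set_lebesgue_integral_def
    proof (rule integral_FTC_atLeastAtMost[OF \<open>t1 \<le> t0\<close> _ cont])
      fix t assume "t1 \<le> t" "t \<le> t0"
      then have "((\<lambda>s. 3 * (inverse s * vol A (h s))) has_real_derivative
          3 * (- (1 / 3) * scal_lapse_integral t)) (at t within {t1..t0})"
        by (intro DERIV_cmult has_real_derivative_vol_over_t \<open>t1 > 0\<close>) simp
      then show "((\<lambda>s. 3 * (inverse s * vol A (h s))) has_vector_derivative - scal_lapse_integral t) (at t within {t1..t0})"
        by (simp add: has_real_derivative_iff_has_vector_derivative)
    qed
    moreover have "inverse t1 * vol A (h t1) \<ge> 0"
      using \<open>t1 > 0\<close> by (simp add: vol_def)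
    ultimately show ?thesis by linarith
  qed
  ultimately show ?thesis by blast
qed

end
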